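(* The cotangent bundle of the moduli space $\hat{\mathcal{T}}^n$ of $n$-complex structures is given by $$T^*\hat{\mathcal{T}}^n=\Big\{[(\mu_2,\dots,\mu_n,t_2,\dots,t_n)]\;\Big|\;\mu_k\in\Gamma(K^{1-k}\otimes\bar K),\ t_k\in\Gamma(K^k)\text{ and for all }k\in\{2,\dots,n\}:$$ $$(-\bar\partial+\mu_2\partial+k\,\partial\mu_2)t_k+\sum_{l=1}^{n-k}\big((l+k)\,\partial\mu_{l+2}+(l+1)\mu_{l+2}\partial\big)t_{k+l}=0\Big\},$$ where $[\cdot]$ denotes the equivalence class under the action of higher diffeomorphisms $\mathrm{Symp}_0(T^*\Sigma)$.
   Context: $\Sigma$ is a smooth closed connected oriented surface of genus $g\geq 2$ with a reference complex coordinate $z$, $\partial=\partial/\partial z$, $\bar\partial=\partial/\partial\bar z$; $p,\bar p$ are the induced linear coordinates on the fibers of $T^{*\mathbb{C}}\Sigma=T^*\Sigma\otimes\mathbb{C}$; $K=T^{*(1,0)}\Sigma$, and $\Gamma(\cdot)$ denotes smooth sections. Symbols such as $\partial\mu_2$ are multiplication operators by the derivative, while $\mu_2\partial$ is a differential operator. $\mathrm{Hilb}^n_0(\mathbb{C}^2)$ is the set of ideals of $\mathbb{C}[x,y]$ of codimension $n$ supported at the origin; $\mathrm{Hilb}^n_0(T^{*\mathbb{C}}\Sigma)$ is the bundle obtained by applying it fiberwise. An $n$-complex structure is a section $I$ of $\mathrm{Hilb}^n_0(T^{*\mathbb{C}}\Sigma)$ with $I(z)+\overline I(z)=\langle p,\bar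 p\rangle$ for all $z$. It is compatible if $I=\langle p^n,-\bar p+\mu_2p+\dots+\mu_np^{n-1}\rangle$ with $\mu_2\bar\mu_2<1$; then $\mu_k\in\Gamma(K^{1-k}\otimes\bar K)$. A higher diffeomorphism is a hamiltonian diffeomorphism of $T^*\Sigma$ preserving the zero-section setwise; they form the group $\mathrm{Symp}_0(T^*\Sigma)$. A Hamiltonian $H$ (vanishing on the zero-section) acts infinitesimally on $I=\langle f_1,\dots,f_r\rangle$ by $f_i\mapsto f_i+\varepsilon\{H,f_i\}\bmod I$, with $\{H,f\}=\partial_pH\,\partial f-\partial H\,\partial_pf+\partial_{\bar p}H\,\bar\partial f-\bar\partial H\,\partial_{\bar p}f$. The moduli space $\hat{\mathcal T}^n$ is the space of compatible $n$-complex structures modulo $\mathrm{Symp}_0(T^*\Sigma)$. Cotangent vectors are described via the pairing $\int_\Sigma\sum_k t_k\,\delta\mu_k$ between differentials of type $(k,0)$ and of type $(1-k,1)$: the cotangent space at $\mu$ consists of those $(t_k)$ annihilating all variations $\delta\mu$ coming from higher diffeomorphisms. *)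

theory Defs
  imports
    "HOL-Analysis.Analysis"
    "HOL-Computational_Algebra.Polynomial"
    "HOL-Homology.Homology_Groups"
begin

section \<open>Smooth functions and Wirtinger derivatives\<close>

fun times_differentiable_on ::
  "nat \<Rightarrow> 'a::real_normed_vector set \<Rightarrow> ('a \<Rightarrow> 'b::real_normed_vector) \<Rightarrow> bool" where
  "times_differentiable_on 0 S f \<longleftrightarrow> continuous_on S f"
| "times_differentiable_on (Suc m) S f \<longleftrightarrow>
     (\<forall>x\<in>S. f differentiable (at x)) \<and>
     (\<forall>v. times_differentiable_on m S (\<lambda>x. frechet_derivative f (at x) v))"

text \<open>Derivatives are two-sided, so this is the usual notion for open \<open>S\<close> only.\<close>

definition smooth_on :: "'a::real_normed_vector set \<Rightarrow> ('a \<Rightarrow> 'b::real_normed_vector) \<Rightarrow> bool" where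
  "smooth_on S f \<longleftrightarrow> (\<forall>m. times_differentiable_on m S f)"

definition del :: "(complex \<Rightarrow> complex) \<Rightarrow> complex \<Rightarrow> complex" where
  "del f z = (frechet_derivative f (at z) 1 - \<i> * frechet_derivative f (at z) \<i>) / 2"

definition delbar :: "(complex \<Rightarrow> complex) \<Rightarrow> complex \<Rightarrow> complex" where
  "delbar f z = (frechet_derivative f (at z) 1 + \<i> * frechet_derivative f (at z) \<i>) / 2"


section \<open>Closed Riemann surfaces\<close>

text \<open>A chart is a coordinate domain together with a complex coordinate. The orientation and the
  smooth structure are those induced by the holomorphic atlas.\<close>

type_synonym 'a chart = "'a set \<times> ('a \<Rightarrow> complex)"

definition chart_image :: "'a chart \<Rightarrow> complex set" where
  "chart_image c = snd c ` fst c"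

definition chart_point :: "'a chart \<Rightarrow> complex \<Rightarrow> 'a" where
  "chart_point c z = inv_into (fst c) (snd c) z"

definition overlap :: "'a chart \<Rightarrow> 'a chart \<Rightarrow> complex set" where
  "overlap c d = snd c ` (fst c \<inter> fst d)"

definition transition :: "'a chart \<Rightarrow> 'a chart \<Rightarrow> complex \<Rightarrow> complex" where
  "transition c d z = snd d (chart_point c z)"

definition holomorphic_atlas :: "'a topology \<Rightarrow> 'a chart set \<Rightarrow> bool" where
  "holomorphic_atlas X A \<longleftrightarrow>
     (\<forall>c\<in>A. openin X (fst c) \<and> open (chart_image c) \<and>
        homeomorphic_map (subtopology X (fst c)) (top_of_set (chart_image c)) (snd c)) \<and>
     (\<Union>c\<in>A. fst c) = topspace X \<and>
     (\<forall>c\<in>A. \<forall>d\<in>A. transition c d holomorphic_on overlap c d)"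

definition closed_riemann_surface :: "'a topology \<Rightarrow> 'a chart set \<Rightarrow> nat \<Rightarrow> bool" where
  "closed_riemann_surface X A g \<longleftrightarrow>
     Hausdorff_space X \<and> compact_space X \<and> connected_space X \<and> holomorphic_atlas X A \<and>
     homology_group 1 X \<cong> free_Abelian_group {..<2 * g}"


section \<open>Differentials and integration\<close>

text \<open>A family of local expressions in the charts. It is set to zero off the chart images, so that
  a differential is represented by exactly one family.\<close>

type_synonym 'a local_family = "'a chart \<Rightarrow> complex \<Rightarrow> complex"

definition smooth_family :: "'a chart set \<Rightarrow> 'a local_family \<Rightarrow> bool" where
  "smooth_family A s \<longleftrightarrow>
     (\<forall>c\<in>A. smooth_on (chart_image c) (s c)) \<and>
     (\<forall>c z. \<not> (c \<in> A \<and> z \<in> chart_image c) \<longrightarrow> s c z = 0)"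

text \<open>Smooth sections of the line bundle \<open>K\<^sup>k \<otimes> K\<close>-bar\<open>\<^sup>l\<close>, that is, differentials
  \<open>s(z) dz\<^sup>k dz\<close>-bar\<open>\<^sup>l\<close> of type \<open>(k,l)\<close>.\<close>

definition differentials :: "'a chart set \<Rightarrow> int \<Rightarrow> int \<Rightarrow> 'a local_family set" where
  "differentials A k l = {s. smooth_family A s \<and>
     (\<forall>c\<in>A. \<forall>d\<in>A. \<forall>z\<in>overlap c d.
        s c z = s d (transition c d z) * deriv (transition c d) z powi k
                                       * cnj (deriv (transition c d) z) powi l)}"

definition partition_of_unity :: "'a chart set \<Rightarrow> 'a chart set \<Rightarrow> ('a chart \<Rightarrow> 'a \<Rightarrow> real) \<Rightarrow> bool" where
  "partition_of_unity A F \<rho> \<longleftrightarrow>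
     finite F \<and> F \<subseteq> A \<and>
     (\<forall>c\<in>F. (\<forall>x. \<rho> c x \<ge> 0) \<and>
        (\<forall>d\<in>A. smooth_on (chart_image d) (\<lambda>z. \<rho> c (chart_point d z))) \<and>
        (\<exists>S. compact S \<and> S \<subseteq> chart_image c \<and>
           (\<forall>d\<in>A. \<forall>x\<in>fst d. \<rho> c x \<noteq> 0 \<longrightarrow> x \<in> fst c \<and> snd c x \<in> S))) \<and>
     (\<forall>d\<in>A. \<forall>x\<in>fst d. (\<Sum>c\<in>F. \<rho> c x) = 1)"

text \<open>The integral over the surface of a differential of type \<open>(1,1)\<close>, which is independent of the
  partition of unity. The factor is \<open>dz \<and> dz\<close>-bar \<open>= -2\<i> dx \<and> dy\<close>.\<close>

definition surface_integral :: "'a chart set \<Rightarrow> 'a local_family \<Rightarrow> complex" where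
  "surface_integral A \<omega> = (SOME J. \<exists>F \<rho>. partition_of_unity A F \<rho> \<and>
     J = (\<Sum>c\<in>F. - 2 * \<i> * integral (chart_image c) (\<lambda>z. of_real (\<rho> c (chart_point c z)) * \<omega> c z)))"


section \<open>The punctual Hilbert scheme of the plane\<close>

text \<open>Elements of \<open>\<complex>[p, p\<close>-bar\<open>]\<close> are polynomials in the outer variable \<open>p\<close>-bar whose coefficients are
  polynomials in the inner variable \<open>p\<close>; the two variables are independent. An ideal is a
  submodule of the ring over itself.\<close>

type_synonym fpoly = "complex poly poly"

definition fmonom :: "complex \<Rightarrow> nat \<Rightarrow> nat \<Rightarrow> fpoly" where
  \<comment> \<open>\<open>a p\<^sup>i p\<close>-bar\<open>\<^sup>j\<close>\<close>
  "fmonom a i j = Polynomial.monom (Polynomial.monom a i) j"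

definition is_ideal :: "fpoly set \<Rightarrow> bool" where
  "is_ideal J \<longleftrightarrow> Modules.module.subspace (*) J"

definition ideal_gen :: "fpoly set \<Rightarrow> fpoly set" where
  "ideal_gen B = Modules.module.span (*) B"

definition codimension :: "fpoly set \<Rightarrow> nat \<Rightarrow> bool" where
  \<comment> \<open>the quotient has a basis of \<open>n\<close> elements over the complex numbers\<close>
  "codimension J n \<longleftrightarrow> (\<exists>b :: nat \<Rightarrow> fpoly. \<forall>f.
     \<exists>!a. a \<in> {..<n} \<rightarrow>\<^sub>E UNIV \<and> f - (\<Sum>i<n. fmonom (a i) 0 0 * b i) \<in> J)"

definition zero_locus :: "fpoly set \<Rightarrow> (complex \<times> complex) set" where
  "zero_locus J = {(a, b). \<forall>f\<in>J. poly (poly f [:b:]) a = 0}"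

definition Hilb0 :: "nat \<Rightarrow> fpoly set set" where
  "Hilb0 n = {J. is_ideal J \<and> codimension J n \<and> zero_locus J = {(0, 0)}}"

text \<open>Conjugation also exchanges \<open>p\<close> and \<open>p\<close>-bar.\<close>

definition fconj :: "fpoly \<Rightarrow> fpoly" where
  "fconj f = (\<Sum>j\<le>Polynomial.degree f. \<Sum>i\<le>Polynomial.degree (Polynomial.coeff f j).
     fmonom (cnj (Polynomial.coeff (Polynomial.coeff f j) i)) j i)"

text \<open>The substitution \<open>p \<mapsto> a p\<close>, \<open>p\<close>-bar \<open>\<mapsto> a\<close>-bar \<open>p\<close>-bar.\<close>

definition fscale :: "complex \<Rightarrow> fpoly \<Rightarrow> fpoly" where
  "fscale a f = pcompose (map_poly (\<lambda>q. pcompose q [:0, a:]) f) [:0, [:cnj a:]:]"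


section \<open>Compatible \<open>n\<close>-complex structures\<close>

text \<open>A section of the bundle of punctual Hilbert schemes, in the charts. If \<open>w\<close> is another
  coordinate, then \<open>p\<^sub>z = w' p\<^sub>w\<close> because of \<open>p\<^sub>z dz = p\<^sub>w dw\<close>.\<close>

definition Hilb_section ::
  "'a chart set \<Rightarrow> nat \<Rightarrow> ('a chart \<Rightarrow> complex \<Rightarrow> fpoly set) \<Rightarrow> bool" where
  "Hilb_section A n I \<longleftrightarrow>
     (\<forall>c\<in>A. \<forall>z\<in>chart_image c. I c z \<in> Hilb0 n) \<and>
     (\<forall>c\<in>A. \<forall>d\<in>A. \<forall>z\<in>overlap c d. \<forall>f.
        f \<in> I c z \<longleftrightarrow> fscale (deriv (transition c d) z) f \<in> I d (transition c d z))"

definition n_complex_structure ::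
  "'a chart set \<Rightarrow> nat \<Rightarrow> ('a chart \<Rightarrow> complex \<Rightarrow> fpoly set) \<Rightarrow> bool" where
  "n_complex_structure A n I \<longleftrightarrow> Hilb_section A n I \<and>
     (\<forall>c\<in>A. \<forall>z\<in>chart_image c.
        {f + fconj h | f h. f \<in> I c z \<and> h \<in> I c z} = ideal_gen {fmonom 1 1 0, fmonom 1 0 1})"

type_synonym 'a family_tuple = "nat \<Rightarrow> 'a local_family"

definition structure_of :: "nat \<Rightarrow> 'a family_tuple \<Rightarrow> 'a chart \<Rightarrow> complex \<Rightarrow> fpoly set" where
  "structure_of n \<mu> c z = ideal_gen
     {fmonom 1 n 0, - fmonom 1 0 1 + (\<Sum>k=2..n. fmonom (\<mu> k c z) (k - 1) 0)}"

text \<open>Compatible structures are represented by their coefficients \<open>\<mu>\<^sub>2, \<dots>, \<mu>\<^sub>n\<close>. No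
  transformation law of the coefficients is imposed here: it is a consequence of the ideals
  forming a section.\<close>

definition compatible :: "'a chart set \<Rightarrow> nat \<Rightarrow> 'a family_tuple \<Rightarrow> bool" where
  "compatible A n \<mu> \<longleftrightarrow>
     \<mu> \<in> {2..n} \<rightarrow>\<^sub>E Collect (smooth_family A) \<and>
     n_complex_structure A n (structure_of n \<mu>) \<and>
     (\<forall>c\<in>A. \<forall>z\<in>chart_image c. (cmod (\<mu> 2 c z))\<^sup>2 < 1)"


section \<open>The cotangent bundle of the surface\<close>

text \<open>A real covector \<open>p dz + p\<close>-bar \<open>dz\<close>-bar is given by its coordinate \<open>p\<close> in one chart, hence
  by the family of its coordinates in all charts around the base point.\<close>

type_synonym 'a covector = "'a \<times> ('a chart \<Rightarrow> complex)"

definition covector :: "'a chart set \<Rightarrow> 'a chart \<Rightarrow> complex \<Rightarrow> complex \<Rightarrow> 'a covector" where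
  "covector A c z p = (chart_point c z,
     \<lambda>d. if d \<in> A \<and> chart_point c z \<in> fst d then p / deriv (transition c d) z else 0)"

definition covector_coords :: "'a chart \<Rightarrow> 'a covector \<Rightarrow> complex \<times> complex" where
  "covector_coords d \<xi> = (snd d (fst \<xi>), snd \<xi> d)"

definition cotangent_surface :: "'a chart set \<Rightarrow> 'a covector set" where
  "cotangent_surface A = {covector A c z p | c z p. c \<in> A \<and> z \<in> chart_image c}"

definition zero_section :: "'a chart set \<Rightarrow> 'a covector set" where
  "zero_section A = {covector A c z 0 | c z. c \<in> A \<and> z \<in> chart_image c}"

definition smooth_cotangent ::
  "'a chart set \<Rightarrow> ('a covector \<Rightarrow> 'b::real_normed_vector) \<Rightarrow> bool" where
  "smooth_cotangent A f \<longleftrightarrow>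
     (\<forall>c\<in>A. smooth_on (chart_image c \<times> UNIV) (\<lambda>(z, p). f (covector A c z p)))"

definition in_chart ::
  "'a chart set \<Rightarrow> 'a chart \<Rightarrow> ('a covector \<Rightarrow> real) \<Rightarrow> complex \<Rightarrow> complex \<Rightarrow> complex" where
  "in_chart A c H z p = of_real (H (covector A c z p))"

text \<open>Fibrewise Taylor polynomial at the zero section, up to total degree \<open>n - 1\<close>. Every
  ideal in \<open>Hilb0 n\<close> contains all monomials of degree at least \<open>n\<close>, so this suffices to
  reduce a smooth function modulo such an ideal.\<close>

definition taylor :: "nat \<Rightarrow> (complex \<Rightarrow> complex) \<Rightarrow> fpoly" where
  "taylor n f = (\<Sum>i<n. \<Sum>j<n - i.
     fmonom ((del ^^ i) ((delbar ^^ j) f) 0 / (fact i * fact j)) i j)"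


section \<open>Higher diffeomorphisms\<close>

text \<open>The Hamiltonian vector field of \<open>h(z,p)\<close> is \<open>\<partial>\<^sub>p h \<partial>\<^sub>z - \<partial>\<^sub>z h \<partial>\<^sub>p\<close> plus its conjugate, in
  accordance with the Poisson bracket below.\<close>

definition hamiltonian_vector ::
  "(complex \<Rightarrow> complex \<Rightarrow> complex) \<Rightarrow> complex \<times> complex \<Rightarrow> complex \<times> complex" where
  "hamiltonian_vector h = (\<lambda>(z, p). (del (h z) p, - del (\<lambda>w. h w p) z))"

definition hamiltonian_isotopy ::
  "'a chart set \<Rightarrow> (real \<Rightarrow> 'a covector \<Rightarrow> real) \<Rightarrow> (real \<Rightarrow> 'a covector \<Rightarrow> 'a covector) \<Rightarrow> bool" where
  "hamiltonian_isotopy A H \<Phi> \<longleftrightarrow>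
     (\<forall>c\<in>A. smooth_on (UNIV \<times> chart_image c \<times> UNIV) (\<lambda>(s, z, p). H s (covector A c z p))) \<and>
     (\<forall>s. bij_betw (\<Phi> s) (cotangent_surface A) (cotangent_surface A)) \<and>
     (\<forall>\<xi>\<in>cotangent_surface A. \<Phi> 0 \<xi> = \<xi>) \<and>
     (\<forall>c\<in>A. \<forall>d\<in>A.
        let W = {(s, z, p). z \<in> chart_image c \<and> fst (\<Phi> s (covector A c z p)) \<in> fst d} in
        open W \<and>
        smooth_on W (\<lambda>(s, z, p). covector_coords d (\<Phi> s (covector A c z p))) \<and>
        (\<forall>(s, z, p)\<in>W.
           ((\<lambda>r. covector_coords d (\<Phi> r (covector A c z p))) has_vector_derivative
              hamiltonian_vector (in_chart A d (H s))
                (covector_coords d (\<Phi> s (covector A c z p)))) (at s)))"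

definition Symp0 :: "'a chart set \<Rightarrow> ('a covector \<Rightarrow> 'a covector) set" where
  "Symp0 A = {\<Phi> 1 | \<Phi> H. hamiltonian_isotopy A H \<Phi> \<and> \<Phi> 1 ` zero_section A = zero_section A}"

definition function_ideal :: "'a chart set \<Rightarrow> nat \<Rightarrow> 'a family_tuple \<Rightarrow> ('a covector \<Rightarrow> complex) set" where
  "function_ideal A n \<mu> = {f. smooth_cotangent A f \<and>
     (\<forall>c\<in>A. \<forall>z\<in>chart_image c. taylor n (\<lambda>p. f (covector A c z p)) \<in> structure_of n \<mu> c z)}"

text \<open>\<open>\<Phi>\<close> acts on structures by pull-back of their ideals of functions: it carries \<open>\<mu>\<close> to \<open>\<nu>\<close>.\<close>

definition carries ::
  "'a chart set \<Rightarrow> nat \<Rightarrow> ('a covector \<Rightarrow> 'a covector) \<Rightarrow> 'a family_tuple \<Rightarrow> 'a family_tuple \<Rightarrow> bool" where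
  "carries A n \<Phi> \<mu> \<nu> \<longleftrightarrow>
     (\<forall>f. smooth_cotangent A f \<longrightarrow>
        (f \<circ> \<Phi> \<in> function_ideal A n \<nu> \<longleftrightarrow> f \<in> function_ideal A n \<mu>))"

definition structure_equivalence :: "'a chart set \<Rightarrow> nat \<Rightarrow> ('a family_tuple \<times> 'a family_tuple) set" where
  "structure_equivalence A n = {(\<mu>, \<nu>). compatible A n \<mu> \<and> compatible A n \<nu> \<and>
     (\<exists>\<Phi>\<in>Symp0 A. carries A n \<Phi> \<mu> \<nu>)}"

definition moduli_space :: "'a chart set \<Rightarrow> nat \<Rightarrow> 'a family_tuple set set" where
  "moduli_space A n = {\<mu>. compatible A n \<mu>} // structure_equivalence A n"


section \<open>Infinitesimal action and cotangent vectors\<close>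

definition poisson ::
  "(complex \<Rightarrow> complex \<Rightarrow> complex) \<Rightarrow> (complex \<Rightarrow> complex \<Rightarrow> complex) \<Rightarrow> complex \<Rightarrow> complex \<Rightarrow> complex" where
  "poisson h f z p =
     del (h z) p * del (\<lambda>w. f w p) z - del (\<lambda>w. h w p) z * del (f z) p +
     delbar (h z) p * delbar (\<lambda>w. f w p) z - delbar (\<lambda>w. h w p) z * delbar (f z) p"

text \<open>The variations of the structure \<open>\<mu>\<close> coming from higher diffeomorphisms. Modulo the ideal, the
  generators change by \<open>{H, p\<^sup>n}\<close> and \<open>{H, - p\<close>-bar\<open> + \<Sum> \<mu>\<^sub>k p\<^sup>k\<^sup>-\<^sup>1}\<close>, and this has to agree with
  their change by \<open>0\<close> and \<open>\<Sum> \<delta>\<mu>\<^sub>k p\<^sup>k\<^sup>-\<^sup>1\<close> under a variation of the coefficients.\<close>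

definition higher_variations :: "'a chart set \<Rightarrow> nat \<Rightarrow> 'a family_tuple \<Rightarrow> 'a family_tuple set" where
  "higher_variations A n \<mu> = {\<delta>. \<delta> \<in> (\<Pi>\<^sub>E k\<in>{2..n}. differentials A (1 - int k) 1) \<and>
     (\<exists>H :: 'a covector \<Rightarrow> real. smooth_cotangent A H \<and> (\<forall>\<xi>\<in>zero_section A. H \<xi> = 0) \<and>
        (\<forall>c\<in>A. \<forall>z\<in>chart_image c.
           taylor n (poisson (in_chart A c H) (\<lambda>w p. p ^ n) z) \<in> structure_of n \<mu> c z \<and>
           taylor n (poisson (in_chart A c H) (\<lambda>w p. - cnj p + (\<Sum>k=2..n. \<mu> k c w * p ^ (k - 1))) z)
             - (\<Sum>k=2..n. fmonom (\<delta> k c z) (k - 1) 0) \<in> structure_of n \<mu> c z))}"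

definition pairing :: "'a chart set \<Rightarrow> nat \<Rightarrow> 'a family_tuple \<Rightarrow> 'a family_tuple \<Rightarrow> complex" where
  "pairing A n t \<delta> = surface_integral A (\<lambda>c z. \<Sum>k=2..n. t k c z * \<delta> k c z)"

definition cotangent_space :: "'a chart set \<Rightarrow> nat \<Rightarrow> 'a family_tuple \<Rightarrow> 'a family_tuple set" where
  "cotangent_space A n \<mu> = {t. t \<in> (\<Pi>\<^sub>E k\<in>{2..n}. differentials A (int k) 0) \<and>
     (\<forall>\<delta>\<in>higher_variations A n \<mu>. pairing A n t \<delta> = 0)}"

definition structure_curve :: "'a chart set \<Rightarrow> nat \<Rightarrow> (real \<Rightarrow> 'a family_tuple) \<Rightarrow> bool" where
  "structure_curve A n m \<longleftrightarrow> (\<forall>s. compatible A n (m s)) \<and>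
     (\<forall>k\<in>{2..n}. \<forall>c\<in>A. smooth_on (UNIV \<times> chart_image c) (\<lambda>(s, z). m s k c z))"

definition velocity :: "(real \<Rightarrow> 'a family_tuple) \<Rightarrow> 'a family_tuple" where
  "velocity m k c z = vector_derivative (\<lambda>s. m s k c z) (at 0)"

text \<open>The cotangent lift of the action of \<open>\<Phi>\<close>, characterized by preserving the pairing with tangent
  vectors, which are transported by the differential of the action.\<close>

definition lift_carries ::
  "'a chart set \<Rightarrow> nat \<Rightarrow> ('a covector \<Rightarrow> 'a covector) \<Rightarrow>
     'a family_tuple \<times> 'a family_tuple \<Rightarrow> 'a family_tuple \<times> 'a family_tuple \<Rightarrow> bool" where
  "lift_carries A n \<Phi> = (\<lambda>(\<mu>, t) (\<nu>, u). carries A n \<Phi> \<mu> \<nu> \<and>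
     (\<forall>m m'. structure_curve A n m \<and> structure_curve A n m' \<and> m 0 = \<mu> \<and> m' 0 = \<nu> \<and>
        (\<forall>s. carries A n \<Phi> (m s) (m' s)) \<longrightarrow>
        pairing A n t (velocity m) = pairing A n u (velocity m')))"

definition phase_space :: "'a chart set \<Rightarrow> nat \<Rightarrow> ('a family_tuple \<times> 'a family_tuple) set" where
  "phase_space A n =
     {(\<mu>, t). compatible A n \<mu> \<and> t \<in> (\<Pi>\<^sub>E k\<in>{2..n}. differentials A (int k) 0)}"

definition cotangent_equivalence ::
  "'a chart set \<Rightarrow> nat \<Rightarrow>
     (('a family_tuple \<times> 'a family_tuple) \<times> ('a family_tuple \<times> 'a family_tuple)) set" where
  "cotangent_equivalence A n = {(x, y). x \<in> phase_space A n \<and> y \<in> phase_space A n \<and>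
     (\<exists>\<Phi>\<in>Symp0 A. lift_carries A n \<Phi> x y)}"

text \<open>The fibre over a point of the moduli space, that is, over an orbit of compatible structures,
  and the total space of the cotangent bundle.\<close>

definition cotangent_fibre ::
  "'a chart set \<Rightarrow> nat \<Rightarrow> 'a family_tuple set \<Rightarrow> ('a family_tuple \<times> 'a family_tuple) set set" where
  "cotangent_fibre A n \<tau> =
     {(\<mu>, t). \<mu> \<in> \<tau> \<and> t \<in> cotangent_space A n \<mu>} // cotangent_equivalence A n"

definition cotangent_bundle ::
  "'a chart set \<Rightarrow> nat \<Rightarrow> ('a family_tuple \<times> 'a family_tuple) set set" where
  "cotangent_bundle A n = (\<Union>\<tau>\<in>moduli_space A n. cotangent_fibre A n \<tau>)"

end

theory Submission
  imports Defs "HOL-Complex_Analysis.Complex_Analysis"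
begin

text \<open>
  Modulo the ideal of \<open>\<mu>\<close> the variable \<open>p\<close>-bar equals \<open>M(p) = \<Sum> \<mu>\<^sub>k p\<^sup>k\<^sup>-\<^sup>1\<close>, so a Hamiltonian \<open>H\<close> acts only
  through its symbol \<open>w(p) = H(p, M(p)) = \<Sum> w\<^sub>m p\<^sup>m\<close>, and by the chain rule the Poisson bracket with the
  second generator reduces to \<open>\<delta>\<mu> = \<partial>\<close>-bar\<open> w + w' \<partial>M - M' \<partial>w\<close> modulo \<open>p\<^sup>n\<close>. Integration by parts turns the
  pairing \<open>\<integral> \<Sum> t\<^sub>k \<delta>\<mu>\<^sub>k\<close> into \<open>\<integral> \<Sum> w\<^sub>k\<^sub>-\<^sub>1 E\<^sub>k\<close>, where \<open>E\<^sub>k\<close> is the left-hand side of the \<open>k\<close>-th equation; hence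
  the equations imply that \<open>t\<close> annihilates all variations. Conversely, the Hamiltonian \<open>2 Re (f p\<^sup>j)\<close>, with
  \<open>f\<close> supported in a chart, has \<open>w\<^sub>m = 0\<close> for \<open>m < j\<close> and \<open>w\<^sub>j = f + f\<close>-bar \<open>\<mu>\<^sub>2\<^sup>j\<close>. By descending induction
  only the term \<open>w\<^sub>j E\<^sub>j\<^sub>+\<^sub>1\<close> survives, and comparing \<open>f\<close> with \<open>\<i>f\<close> for real bump functions \<open>f\<close> removes
  the conjugate part, so that \<open>E\<^sub>j\<^sub>+\<^sub>1 = 0\<close>. Finally, the coefficients of a compatible structure are
  differentials because the ideal in a chart determines its coefficients uniquely.
\<close>

text \<open>Every object is a family of local expressions, so each formula poses two tasks: an
  identity in one chart and its behaviour under coordinate changes. For the second, the left-hand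
  sides E_k are never transformed directly. The sum of the products w_(k-1) E_k equals the pairing
  density minus two divergences, and these three are visibly (1,1)-forms.
  \<open>surface_integral\<close> picks an unspecified partition of unity. Two facts, valid for an
  arbitrary one, do the work: divergences of covariant fields integrate to zero, and an integrand
  with compact support in one chart may be integrated in that chart. Hamiltonians are real, so f p^j
  cannot be tested without its conjugate. That conjugate contributes f-bar M^j, which also begins in
  degree j; this is why the induction can descend. Finally, both sides of the theorem are images of
  sets of pairs under the same map to equivalence classes, so the comparison takes place on
  representatives.\<close>

section \<open>Calculus of smooth maps between normed spaces\<close>

lemma frechet_eqI:
  assumes "(f has_derivative f') (at x)" shows "frechet_derivative f (at x) = f'"
  using assms by (metis frechet_derivative_at)

lemma frechet_cong_open:
  assumes "open S" "x \<in> S" "\<And>y. y \<in> S \<Longrightarrow> f y = g y"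
  shows "frechet_derivative f (at x) = frechet_derivative g (at x)"
proof -
  \<comment> \<open>Both functions admit the same derivatives D, so the choice made by
    \<open>frechet_derivative\<close> agrees even at points where no derivative exists.\<close>
  have "(f has_derivative D) (at x) \<longleftrightarrow> (g has_derivative D) (at x)" for D
    using has_derivative_transform_within_open[of _ D x UNIV S] assms by metis
  then show ?thesis unfolding frechet_derivative_def by simp
qed

lemma differentiable_cong_open:
  assumes "open S" "x \<in> S" "\<And>y. y \<in> S \<Longrightarrow> f y = g y"
  shows "f differentiable (at x) \<longleftrightarrow> g differentiable (at x)"
proof -
  have "(f has_derivative D) (at x) \<longleftrightarrow> (g has_derivative D) (at x)" for D
    using has_derivative_transform_within_open[of _ D x UNIV S] assms by metis
  then show ?thesis unfolding differentiable_def by simp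
qed

lemma times_differentiable_on_cong:
  assumes "open S" "\<And>y. y \<in> S \<Longrightarrow> f y = g y"
  shows "times_differentiable_on m S f \<longleftrightarrow> times_differentiable_on m S g"
  using assms(2)
proof (induction m arbitrary: f g)
  case 0 then show ?case using continuous_on_cong[of S S f g] by simp
next
  case (Suc m)
  have d: "frechet_derivative f (at x) v = frechet_derivative g (at x) v" if "x \<in> S" for x v
    using frechet_cong_open[OF assms(1) that, of f g] Suc.prems by simp
  have "times_differentiable_on m S (\<lambda>x. frechet_derivative f (at x) v) =
        times_differentiable_on m S (\<lambda>x. frechet_derivative g (at x) v)" for v
    by (rule Suc.IH) (rule d)
  moreover have "(f differentiable (at x)) = (g differentiable (at x))" if "x \<in> S" for x
    using differentiable_cong_open[OF assms(1) that, of f g] Suc.prems by simp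
  ultimately show ?case by simp
qed

text \<open>The recursive definition does not mention lower orders; the descent rests on the base
  case, where differentiability gives continuity.\<close>

lemma times_differentiable_on_Suc_imp:
  "times_differentiable_on (Suc m) S f \<Longrightarrow> times_differentiable_on m S f"
proof (induction m arbitrary: f)
  case 0 then show ?case
    by (auto intro!: continuous_at_imp_continuous_on differentiable_imp_continuous_within)
next
  case (Suc m)
  have "times_differentiable_on m S (\<lambda>x. frechet_derivative f (at x) v)" for v
    using Suc.prems by (intro Suc.IH) simp
  with Suc.prems show ?case by simp
qed

lemma times_differentiable_on_const: "times_differentiable_on m S (\<lambda>x. c)"
  by (induction m arbitrary: c) simp_all

lemma times_differentiable_on_linear:
  assumes "open S" "bounded_linear L" "times_differentiable_on m S f"
  shows "times_differentiable_on m S (\<lambda>x. L (f x))"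
  using assms(3)
proof (induction m arbitrary: f)
  case 0 then show ?case
    using bounded_linear.continuous_on[OF assms(2)] by simp
next
  case (Suc m)
  have hd: "((\<lambda>x. L (f x)) has_derivative (\<lambda>v. L (frechet_derivative f (at x) v))) (at x)"
    if "x \<in> S" for x
    using Suc.prems that by (auto intro!: bounded_linear.has_derivative[OF assms(2)]
        simp: frechet_derivative_works[symmetric])
  have "times_differentiable_on m S (\<lambda>x. frechet_derivative (\<lambda>x. L (f x)) (at x) v)" for v
    using Suc.prems by (subst times_differentiable_on_cong[OF assms(1), where g="\<lambda>x. L (frechet_derivative f (at x) v)"])
      (auto simp: frechet_eqI[OF hd] intro: Suc.IH)
  with hd show ?case by (auto simp: differentiable_def)
qed

lemma times_differentiable_on_add:
  assumes "open S" "times_differentiable_on m S f" "times_differentiable_on m S g"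
  shows "times_differentiable_on m S (\<lambda>x. f x + g x)"
  using assms(2,3)
proof (induction m arbitrary: f g)
  case 0 then show ?case by (simp add: continuous_on_add)
next
  case (Suc m)
  have hd: "((\<lambda>x. f x + g x) has_derivative
      (\<lambda>v. frechet_derivative f (at x) v + frechet_derivative g (at x) v)) (at x)"
    if "x \<in> S" for x
    using Suc.prems that by (auto intro!: has_derivative_add simp: frechet_derivative_works[symmetric])
  have "times_differentiable_on m S (\<lambda>x. frechet_derivative (\<lambda>x. f x + g x) (at x) v)" for v
    using Suc.prems by (subst times_differentiable_on_cong[OF assms(1),
          where g="\<lambda>x. frechet_derivative f (at x) v + frechet_derivative g (at x) v"])
      (auto simp: frechet_eqI[OF hd] intro: Suc.IH)
  with hd show ?case by (auto simp: differentiable_def)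
qed

text \<open>By the product rule each directional derivative is a sum of two expressions P(f, g') and
  P(f', g). The induction hypothesis applies to them once the undifferentiated factors are known to
  have the lower order too.\<close>

lemma times_differentiable_on_bilinear:
  assumes "open S" "bounded_bilinear P" "times_differentiable_on m S f" "times_differentiable_on m S g"
  shows "times_differentiable_on m S (\<lambda>x. P (f x) (g x))"
  using assms(3,4)
proof (induction m arbitrary: f g)
  case 0 then show ?case by (simp add: bounded_bilinear.continuous_on[OF assms(2)])
next
  case (Suc m)
  have hd: "((\<lambda>x. P (f x) (g x)) has_derivative
      (\<lambda>v. P (f x) (frechet_derivative g (at x) v) + P (frechet_derivative f (at x) v) (g x))) (at x)"
    if "x \<in> S" for x
    using Suc.prems that
    by (intro bounded_bilinear.FDERIV[OF assms(2)]) (auto simp: frechet_derivative_works[symmetric])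
  have fg: "times_differentiable_on m S f" "times_differentiable_on m S g"
    by (rule times_differentiable_on_Suc_imp[OF Suc.prems(1)])
      (rule times_differentiable_on_Suc_imp[OF Suc.prems(2)])
  have "times_differentiable_on m S (\<lambda>x. frechet_derivative (\<lambda>x. P (f x) (g x)) (at x) v)" for v
    using Suc.prems fg by (subst times_differentiable_on_cong[OF assms(1),
          where g="\<lambda>x. P (f x) (frechet_derivative g (at x) v) + P (frechet_derivative f (at x) v) (g x)"])
      (auto simp: frechet_eqI[OF hd] intro!: Suc.IH times_differentiable_on_add[OF assms(1)])
  with hd show ?case by (auto simp: differentiable_def)
qed

lemma times_differentiable_on_sum:
  assumes "open S" "\<And>i. i \<in> I \<Longrightarrow> times_differentiable_on m S (f i)"
  shows "times_differentiable_on m S (\<lambda>x. \<Sum>i\<in>I. f i x)"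
  using assms(2)
  by (induction I rule: infinite_finite_induct)
    (auto simp: times_differentiable_on_const intro: times_differentiable_on_add[OF assms(1)])

text \<open>In the chain rule f' is taken in the direction g'(x) v, which varies with x, whereas the
  definition controls only fixed directions. Expanding g'(x) v in a basis of the middle space turns
  the derivative into a finite sum of products with fixed directions.\<close>

lemma times_differentiable_on_compose:
  fixes g :: "'a::real_normed_vector \<Rightarrow> 'b::euclidean_space" and f :: "'b \<Rightarrow> 'c::real_normed_vector"
  assumes "open S" "open T" "g ` S \<subseteq> T"
    and "times_differentiable_on m S g" "times_differentiable_on m T f"
  shows "times_differentiable_on m S (\<lambda>x. f (g x))"
  using assms(4,5)
proof (induction m arbitrary: f)
  case 0 then show ?case
    using continuous_on_compose2[of T f S g] assms(3) by simp
next
  case (Suc m)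
  have hd: "((\<lambda>x. f (g x)) has_derivative
      (\<lambda>v. \<Sum>b\<in>Basis. (frechet_derivative g (at x) v \<bullet> b) *\<^sub>R frechet_derivative f (at (g x)) b)) (at x)"
    if x: "x \<in> S" for x
  proof -
    have g: "(g has_derivative frechet_derivative g (at x)) (at x)"
      and f: "(f has_derivative frechet_derivative f (at (g x))) (at (g x))"
      using Suc.prems x assms(3) by (auto simp: frechet_derivative_works[symmetric])
    have "linear (frechet_derivative f (at (g x)))"
      using f by (simp add: has_derivative_linear)
    then have *: "frechet_derivative f (at (g x)) (\<Sum>b\<in>Basis. (y \<bullet> b) *\<^sub>R b) =
        (\<Sum>b\<in>Basis. (y \<bullet> b) *\<^sub>R frechet_derivative f (at (g x)) b)" for y
      by (simp add: linear_sum linear_scale del: euclidean_representation)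
    have "frechet_derivative f (at (g x)) y =
        (\<Sum>b\<in>Basis. (y \<bullet> b) *\<^sub>R frechet_derivative f (at (g x)) b)" for y
      using *[of y] unfolding euclidean_representation .
    then show ?thesis
      by (intro has_derivative_eq_rhs[OF has_derivative_compose[OF g f]] ext)
  qed
  have g: "times_differentiable_on m S g"
    by (rule times_differentiable_on_Suc_imp[OF Suc.prems(1)])
  have "times_differentiable_on m S (\<lambda>x. frechet_derivative (\<lambda>x. f (g x)) (at x) v)" for v
    using Suc.prems g by (subst times_differentiable_on_cong[OF assms(1),
          where g="\<lambda>x. \<Sum>b\<in>Basis. (frechet_derivative g (at x) v \<bullet> b) *\<^sub>R frechet_derivative f (at (g x)) b"])
      (auto simp: frechet_eqI[OF hd] intro!: Suc.IH times_differentiable_on_sum[OF assms(1)]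
         times_differentiable_on_bilinear[OF assms(1) bounded_bilinear_scaleR]
         times_differentiable_on_linear[OF assms(1) bounded_linear_inner_left])
  with hd show ?case by (auto simp: differentiable_def)
qed

text \<open>Derivatives are two-sided, so the notion is local; this glues functions that are given
  by a formula near some points and vanish near the others.\<close>

lemma times_differentiable_on_local:
  assumes "\<And>x. x \<in> S \<Longrightarrow> \<exists>U. open U \<and> x \<in> U \<and> times_differentiable_on m U f"
  shows "times_differentiable_on m S f"
  using assms
proof (induction m arbitrary: f)
  case 0
  have "isCont f x" if "x \<in> S" for x
  proof -
    from 0[OF that] obtain U where "open U" "x \<in> U" "continuous_on U f" by auto
    then show ?thesis by (simp add: continuous_on_eq_continuous_at)
  qed
  then show ?case by (simp add: continuous_at_imp_continuous_on)
next
  case (Suc m)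
  have "\<exists>U. open U \<and> x \<in> U \<and> times_differentiable_on m U (\<lambda>x. frechet_derivative f (at x) v)"
    if "x \<in> S" for x v using Suc.prems[OF that] by auto
  moreover have "f differentiable (at x)" if "x \<in> S" for x using Suc.prems[OF that] by auto
  ultimately show ?case using Suc.IH by auto
qed

lemma times_differentiable_on_subset:
  "times_differentiable_on m S f \<Longrightarrow> T \<subseteq> S \<Longrightarrow> times_differentiable_on m T f"
  by (induction m arbitrary: f) (auto intro: continuous_on_subset)

lemma smooth_on_cong:
  "open S \<Longrightarrow> (\<And>y. y \<in> S \<Longrightarrow> f y = g y) \<Longrightarrow> smooth_on S f \<longleftrightarrow> smooth_on S g"
  unfolding smooth_on_def using times_differentiable_on_cong by blast

lemma smooth_on_local:
  assumes "\<And>x. x \<in> S \<Longrightarrow> \<exists>U. open U \<and> x \<in> U \<and> smooth_on U f"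
  shows "smooth_on S f"
  unfolding smooth_on_def
proof
  fix m show "times_differentiable_on m S f"
    by (rule times_differentiable_on_local) (use assms in \<open>unfold smooth_on_def, blast\<close>)
qed

lemma smooth_on_subset: "smooth_on S f \<Longrightarrow> T \<subseteq> S \<Longrightarrow> smooth_on T f"
  unfolding smooth_on_def using times_differentiable_on_subset by blast

lemma smooth_on_const [simp]: "smooth_on S (\<lambda>x. c)"
  unfolding smooth_on_def by (simp add: times_differentiable_on_const)

lemma smooth_on_imp_differentiable: "smooth_on S f \<Longrightarrow> x \<in> S \<Longrightarrow> f differentiable (at x)"
  unfolding smooth_on_def by (metis times_differentiable_on.simps(2))

lemma smooth_on_imp_continuous_on: "smooth_on S f \<Longrightarrow> continuous_on S f"
  unfolding smooth_on_def by (metis times_differentiable_on.simps(1))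

lemma smooth_on_frechet: "smooth_on S f \<Longrightarrow> smooth_on S (\<lambda>x. frechet_derivative f (at x) v)"
  unfolding smooth_on_def by (metis times_differentiable_on.simps(2))

lemma smooth_on_has_derivative:
  "smooth_on S f \<Longrightarrow> x \<in> S \<Longrightarrow> (f has_derivative frechet_derivative f (at x)) (at x)"
  using smooth_on_imp_differentiable frechet_derivative_works by blast

lemma smooth_on_linear:
  "open S \<Longrightarrow> bounded_linear L \<Longrightarrow> smooth_on S f \<Longrightarrow> smooth_on S (\<lambda>x. L (f x))"
  unfolding smooth_on_def by (simp add: times_differentiable_on_linear)

lemma smooth_on_add:
  "open S \<Longrightarrow> smooth_on S f \<Longrightarrow> smooth_on S g \<Longrightarrow> smooth_on S (\<lambda>x. f x + g x)"
  unfolding smooth_on_def by (simp add: times_differentiable_on_add)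

lemma smooth_on_sum:
  "open S \<Longrightarrow> (\<And>i. i \<in> I \<Longrightarrow> smooth_on S (f i)) \<Longrightarrow> smooth_on S (\<lambda>x. \<Sum>i\<in>I. f i x)"
  unfolding smooth_on_def by (simp add: times_differentiable_on_sum)

lemma smooth_on_bilinear:
  "open S \<Longrightarrow> bounded_bilinear P \<Longrightarrow> smooth_on S f \<Longrightarrow> smooth_on S g \<Longrightarrow> smooth_on S (\<lambda>x. P (f x) (g x))"
  unfolding smooth_on_def by (simp add: times_differentiable_on_bilinear)

lemma smooth_on_compose:
  fixes g :: "'a::real_normed_vector \<Rightarrow> 'b::euclidean_space"
  shows "smooth_on T f \<Longrightarrow> smooth_on S g \<Longrightarrow> open S \<Longrightarrow> open T \<Longrightarrow> g ` S \<subseteq> T \<Longrightarrow>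
    smooth_on S (\<lambda>x. f (g x))"
  unfolding smooth_on_def using times_differentiable_on_compose by blast

lemma smooth_on_linear_self:
  assumes "bounded_linear L" shows "smooth_on S L"
proof -
  have hd: "frechet_derivative L (at x) = L" for x
    by (rule frechet_eqI) (rule bounded_linear_imp_has_derivative[OF assms])
  have "times_differentiable_on m S L" for m
    using linear_continuous_on[OF assms] bounded_linear_imp_differentiable[OF assms]
    by (cases m) (simp_all add: hd times_differentiable_on_const)
  then show ?thesis unfolding smooth_on_def by blast
qed

lemmas smooth_on_ident = smooth_on_linear_self[OF bounded_linear_ident]
  and smooth_on_fst = smooth_on_linear_self[OF bounded_linear_fst]
  and smooth_on_snd = smooth_on_linear_self[OF bounded_linear_snd]

lemmas smooth_on_mult = smooth_on_bilinear[OF _ bounded_bilinear_mult]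
  and smooth_on_of_real = smooth_on_linear[OF _ bounded_linear_of_real]
  and smooth_on_Re = smooth_on_linear[OF _ bounded_linear_Re]
  and smooth_on_Im = smooth_on_linear[OF _ bounded_linear_Im]
  and smooth_on_minus = smooth_on_linear[OF _ bounded_linear_minus[OF bounded_linear_ident]]

lemma smooth_on_diff:
  "open S \<Longrightarrow> smooth_on S f \<Longrightarrow> smooth_on S g \<Longrightarrow> smooth_on S (\<lambda>x. f x - g x)"
  using smooth_on_add[of S f "\<lambda>x. - g x"] smooth_on_minus[of S g] by simp

lemma smooth_on_Pair:
  assumes "open S" "smooth_on S f" "smooth_on S g"
  shows "smooth_on S (\<lambda>x. (f x, g x))"
proof -
  have "smooth_on S (\<lambda>x. (f x, 0) + (0, g x))"
    by (intro smooth_on_add assms smooth_on_linear[OF assms(1) _ assms(2), of "\<lambda>a. (a, 0)"]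
        smooth_on_linear[OF assms(1) _ assms(3), of "\<lambda>a. (0, a)"]
        bounded_linear_Pair bounded_linear_ident bounded_linear_zero)
  then show ?thesis by simp
qed

lemma smooth_on_power:
  fixes f :: "'a::real_normed_vector \<Rightarrow> 'b::real_normed_field"
  shows "open S \<Longrightarrow> smooth_on S f \<Longrightarrow> smooth_on S (\<lambda>x. f x ^ n)"
  by (induction n) (auto intro: smooth_on_mult)

text \<open>The derivative is a product of constants and of \<open>inverse\<close> itself, so the
  induction on the order closes with the product rule.\<close>

lemma smooth_on_inverse_real: "smooth_on (- {0}) (inverse :: real \<Rightarrow> real)"
proof -
  have o: "open (- {0::real})" by auto
  have hd: "(inverse has_derivative (\<lambda>v. - (inverse x * v * inverse x))) (at x)" if "x \<in> - {0}" for x :: real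
    using that by (intro has_derivative_inverse') auto
  have "times_differentiable_on m (- {0}) (inverse :: real \<Rightarrow> real)" for m
  proof (induction m)
    case 0 show ?case by (auto intro: continuous_on_inverse continuous_on_id)
  next
    case (Suc m)
    have "times_differentiable_on m (- {0}) (\<lambda>x::real. (-1) * (inverse x * v * inverse x))" for v
      by (intro times_differentiable_on_bilinear[OF o bounded_bilinear_mult] Suc times_differentiable_on_const)
    then have "times_differentiable_on m (- {0}) (\<lambda>x. frechet_derivative inverse (at x) v)" for v :: real
      by (subst times_differentiable_on_cong[OF o]) (auto simp: frechet_eqI[OF hd])
    with hd show ?case by (auto simp: differentiable_def)
  qed
  then show ?thesis unfolding smooth_on_def by blast
qed

lemma holomorphic_imp_smooth_on:
  assumes "open S" "f holomorphic_on S" shows "smooth_on S f"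
proof -
  have "times_differentiable_on m S f" for m
    using assms(2)
  proof (induction m arbitrary: f)
    case 0 then show ?case by (simp add: holomorphic_on_imp_continuous_on)
  next
    case (Suc m)
    have hd: "(f has_derivative (*) (deriv f x)) (at x)" if "x \<in> S" for x
      using Suc.prems assms(1) that holomorphic_derivI has_field_derivative_def by metis
    have "times_differentiable_on m S (\<lambda>x. frechet_derivative f (at x) v)" for v
      using Suc.prems by (subst times_differentiable_on_cong[OF assms(1), where g="\<lambda>x. deriv f x * v"])
        (auto simp: frechet_eqI[OF hd] intro!: Suc.IH times_differentiable_on_const
          times_differentiable_on_bilinear[OF assms(1) bounded_bilinear_mult]
          holomorphic_on_mult holomorphic_on_const holomorphic_deriv[OF _ assms(1)])
    with hd show ?case by (auto simp: differentiable_def)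
  qed
  then show ?thesis unfolding smooth_on_def by blast
qed

lemma smooth_on_eq_const: "(\<And>x. x \<in> S \<Longrightarrow> f x = c) \<Longrightarrow> open S \<Longrightarrow> smooth_on S f"
  using smooth_on_cong[of S f "\<lambda>_. c"] by simp

section \<open>Symmetry of second derivatives\<close>

lemma frechet_line:
  assumes "(f has_derivative frechet_derivative f (at (a + t *\<^sub>R v))) (at (a + t *\<^sub>R v))"
  shows "((\<lambda>t. f (a + t *\<^sub>R v)) has_derivative (\<lambda>h. h *\<^sub>R frechet_derivative f (at (a + t *\<^sub>R v)) v)) (at t)"
proof -
  have 1: "((\<lambda>t. a + t *\<^sub>R v) has_derivative (\<lambda>h. h *\<^sub>R v)) (at t)"
    by (auto intro!: derivative_eq_intros)
  have lin: "linear (frechet_derivative f (at (a + t *\<^sub>R v)))"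
    using assms has_derivative_linear by blast
  from has_derivative_compose[OF 1 assms] show ?thesis
    by (simp add: linear_scale[OF lin])
qed

text \<open>Two applications of the mean value theorem, first in the direction u and then in the
  direction v.\<close>

lemma second_difference_mean_value:
  fixes f :: "'a::real_normed_vector \<Rightarrow> real"
  assumes "open S" "smooth_on S f" and h: "h > 0"
    and sub: "\<And>s t. 0 \<le> s \<Longrightarrow> s \<le> h \<Longrightarrow> 0 \<le> t \<Longrightarrow> t \<le> h \<Longrightarrow> x + s *\<^sub>R u + t *\<^sub>R v \<in> S"
  shows "\<exists>s t. 0 \<le> s \<and> s \<le> h \<and> 0 \<le> t \<and> t \<le> h \<and>
     f (x + h *\<^sub>R u + h *\<^sub>R v) - f (x + h *\<^sub>R u) - f (x + h *\<^sub>R v) + f x =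
     h\<^sup>2 * frechet_derivative (\<lambda>y. frechet_derivative f (at y) u) (at (x + s *\<^sub>R u + t *\<^sub>R v)) v"
proof -
  define f1 where "f1 = (\<lambda>y. frechet_derivative f (at y) u)"
  have sm1: "smooth_on S f1" unfolding f1_def by (rule smooth_on_frechet[OF assms(2)])
  \<comment> \<open>The second difference is k h - k 0, so the first application concerns a function
    of one real variable.\<close>
  define k where "k = (\<lambda>s. f (x + h *\<^sub>R v + s *\<^sub>R u) - f (x + s *\<^sub>R u))"
  have kd: "(k has_derivative (\<lambda>r. r * (f1 (x + h *\<^sub>R v + s *\<^sub>R u) - f1 (x + s *\<^sub>R u)))) (at s)"
    if "0 \<le> s" "s \<le> h" for s
  proof -
    have "x + h *\<^sub>R v + s *\<^sub>R u \<in> S" "x + s *\<^sub>R u \<in> S"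
      using sub[of s h] sub[of s 0] that h by (auto simp: algebra_simps)
    then have "(k has_derivative (\<lambda>r. r *\<^sub>R f1 (x + h *\<^sub>R v + s *\<^sub>R u) - r *\<^sub>R f1 (x + s *\<^sub>R u))) (at s)"
      unfolding k_def f1_def
      by (intro has_derivative_diff frechet_line smooth_on_has_derivative[OF assms(2)])
    then show ?thesis by (simp add: right_diff_distrib)
  qed
  have "\<exists>s\<in>{0<..<h}. k h - k 0 = (h - 0) * (f1 (x + h *\<^sub>R v + s *\<^sub>R u) - f1 (x + s *\<^sub>R u))"
    using h by (rule mvt_simple) (auto intro: has_derivative_subset[OF kd])
  then obtain s where s: "0 < s" "s < h"
      and ks: "k h - k 0 = h * (f1 (x + h *\<^sub>R v + s *\<^sub>R u) - f1 (x + s *\<^sub>R u))"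
    by auto
  have ld: "((\<lambda>t. f1 (x + s *\<^sub>R u + t *\<^sub>R v)) has_derivative
      (\<lambda>r. r * frechet_derivative f1 (at (x + s *\<^sub>R u + t *\<^sub>R v)) v)) (at t)"
    if "0 \<le> t" "t \<le> h" for t
    using frechet_line[of f1 "x + s *\<^sub>R u" t v] smooth_on_has_derivative[OF sm1 sub[of s t]] s that by simp
  have "\<exists>t\<in>{0<..<h}. f1 (x + s *\<^sub>R u + h *\<^sub>R v) - f1 (x + s *\<^sub>R u + 0 *\<^sub>R v)
      = (h - 0) * frechet_derivative f1 (at (x + s *\<^sub>R u + t *\<^sub>R v)) v"
    using h by (rule mvt_simple) (auto intro: has_derivative_subset[OF ld])
  then obtain t where t: "0 < t" "t < h" and "f1 (x + s *\<^sub>R u + h *\<^sub>R v) - f1 (x + s *\<^sub>R u + 0 *\<^sub>R v)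
      = h * frechet_derivative f1 (at (x + s *\<^sub>R u + t *\<^sub>R v)) v" by auto
  then have "k h - k 0 = h\<^sup>2 * frechet_derivative f1 (at (x + s *\<^sub>R u + t *\<^sub>R v)) v"
    using ks by (simp add: algebra_simps power2_eq_square)
  then show ?thesis using s t unfolding k_def f1_def
    by (intro exI[of _ s] exI[of _ t]) (simp add: algebra_simps)
qed

text \<open>The second difference is symmetric in u and v. Hence the two mixed derivatives take
  equal values at two points arbitrarily close to x, and continuity of both forces equality at
  x.\<close>

lemma frechet_symmetric_real:
  fixes f :: "'a::real_normed_vector \<Rightarrow> real"
  assumes S: "open S" "smooth_on S f" "x \<in> S"
  shows "frechet_derivative (\<lambda>y. frechet_derivative f (at y) u) (at x) v =
         frechet_derivative (\<lambda>y. frechet_derivative f (at y) v) (at x) u" (is "?A x = ?B x")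
proof (rule ccontr)
  assume ne: "?A x \<noteq> ?B x"
  \<comment> \<open>Half of the supposed gap: two approximations within e of a common value
    contradict the triangle inequality.\<close>
  define e where "e = dist (?A x) (?B x) / 2"
  have e: "e > 0" using ne by (simp add: e_def)
  have "continuous_on S ?A" "continuous_on S ?B"
    by (intro smooth_on_imp_continuous_on smooth_on_frechet S)+
  then have c: "isCont ?A x" "isCont ?B x" using S by (auto simp: continuous_on_eq_continuous_at)
  obtain d1 where d1: "d1 > 0" "\<And>y. dist y x < d1 \<Longrightarrow> dist (?A y) (?A x) < e"
    using c(1) e unfolding continuous_at_eps_delta by blast
  obtain d2 where d2: "d2 > 0" "\<And>y. dist y x < d2 \<Longrightarrow> dist (?B y) (?B x) < e"
    using c(2) e unfolding continuous_at_eps_delta by blast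
  obtain d3 where d3: "d3 > 0" "ball x d3 \<subseteq> S" using S open_contains_ball by blast
  define d where "d = min d1 (min d2 d3)"
  \<comment> \<open>Chosen so that the whole parallelogram with sides h u and h v stays within d/2
    of x; the summand 1 keeps the denominator positive when u and v vanish.\<close>
  define h where "h = d / 2 / (norm u + norm v + 1)"
  have nn: "norm u + norm v + 1 > 0" by (smt (verit) norm_ge_zero)
  have d: "d > 0" using d1 d2 d3 by (simp add: d_def)
  have h: "h > 0" using d nn by (simp add: h_def)
  have small: "dist (x + s *\<^sub>R u + t *\<^sub>R v) x < d" if "0 \<le> s" "s \<le> h" "0 \<le> t" "t \<le> h" for s t
  proof -
    have "dist (x + s *\<^sub>R u + t *\<^sub>R v) x \<le> s * norm u + t * norm v"
      using that norm_triangle_ineq[of "s *\<^sub>R u" "t *\<^sub>R v"] by (simp add: dist_norm)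
    also have "\<dots> \<le> h * norm u + h * norm v" using that by (intro add_mono mult_right_mono) auto
    also have "\<dots> \<le> h * (norm u + norm v + 1)" using h by (simp add: algebra_simps)
    also have "\<dots> = d / 2" using nn unfolding h_def by (intro nonzero_divide_eq_eq[THEN iffD1, symmetric]) auto
    also have "\<dots> < d" using d by simp
    finally show ?thesis .
  qed
  have in1: "x + s *\<^sub>R u + t *\<^sub>R v \<in> S" if "0 \<le> s" "s \<le> h" "0 \<le> t" "t \<le> h" for s t
    using small[OF that] d3 by (auto simp: d_def dist_commute)
  have in2: "x + s *\<^sub>R v + t *\<^sub>R u \<in> S" if "0 \<le> s" "s \<le> h" "0 \<le> t" "t \<le> h" for s t
    using in1[of t s] that by (simp add: algebra_simps)
  obtain s t where st: "0 \<le> s" "s \<le> h" "0 \<le> t" "t \<le> h"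
    "f (x + h *\<^sub>R u + h *\<^sub>R v) - f (x + h *\<^sub>R u) - f (x + h *\<^sub>R v) + f x = h\<^sup>2 * ?A (x + s *\<^sub>R u + t *\<^sub>R v)"
    using second_difference_mean_value[OF S(1,2) h in1] by blast
  obtain s' t' where st': "0 \<le> s'" "s' \<le> h" "0 \<le> t'" "t' \<le> h"
    "f (x + h *\<^sub>R v + h *\<^sub>R u) - f (x + h *\<^sub>R v) - f (x + h *\<^sub>R u) + f x = h\<^sup>2 * ?B (x + s' *\<^sub>R v + t' *\<^sub>R u)"
    using second_difference_mean_value[OF S(1,2) h in2] by blast
  have "h\<^sup>2 * ?A (x + s *\<^sub>R u + t *\<^sub>R v) = h\<^sup>2 * ?B (x + s' *\<^sub>R v + t' *\<^sub>R u)"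
    using st(5) st'(5) by (simp add: algebra_simps)
  then have eq: "?A (x + s *\<^sub>R u + t *\<^sub>R v) = ?B (x + s' *\<^sub>R v + t' *\<^sub>R u)" using h by simp
  have "dist (?A (x + s *\<^sub>R u + t *\<^sub>R v)) (?A x) < e"
    using d1 small[OF st(1-4)] by (simp add: d_def)
  moreover have "dist (x + s' *\<^sub>R v + t' *\<^sub>R u) x < d2"
    using small[OF st'(3,4,1,2)] by (simp add: d_def algebra_simps)
  then have "dist (?B (x + s' *\<^sub>R v + t' *\<^sub>R u)) (?B x) < e" using d2 by blast
  ultimately show False using eq unfolding e_def
    by (smt (verit) dist_commute dist_triangle_half_l)
qed

lemma frechet_linear_compose:
  assumes "bounded_linear L" "f differentiable (at x)"
  shows "frechet_derivative (\<lambda>x. L (f x)) (at x) v = L (frechet_derivative f (at x) v)"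
  using frechet_eqI[OF bounded_linear.has_derivative[OF assms(1)]] assms(2)
  by (metis frechet_derivative_works)

text \<open>The mean value theorem concerns real functions, so the symmetry is transferred through
  real and imaginary parts.\<close>

lemma frechet_symmetric:
  fixes f :: "'a::real_normed_vector \<Rightarrow> complex"
  assumes S: "open S" "smooth_on S f" "x \<in> S"
  shows "frechet_derivative (\<lambda>y. frechet_derivative f (at y) u) (at x) v =
         frechet_derivative (\<lambda>y. frechet_derivative f (at y) v) (at x) u"
proof -
  have *: "L (frechet_derivative (\<lambda>y. frechet_derivative f (at y) u) (at x) v) =
           frechet_derivative (\<lambda>y. frechet_derivative (\<lambda>y. L (f y)) (at y) u) (at x) v"
    if L: "bounded_linear L" for L :: "complex \<Rightarrow> real" and u v
  proof -
    have "L (frechet_derivative (\<lambda>y. frechet_derivative f (at y) u) (at x) v) =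
       frechet_derivative (\<lambda>y. L (frechet_derivative f (at y) u)) (at x) v"
      using smooth_on_imp_differentiable[OF smooth_on_frechet[OF S(2)] S(3)]
      by (simp add: frechet_linear_compose[OF L])
    also have "\<dots> = frechet_derivative (\<lambda>y. frechet_derivative (\<lambda>y. L (f y)) (at y) u) (at x) v"
      by (rule fun_cong[OF frechet_cong_open[OF S(1,3)]])
        (simp add: frechet_linear_compose[OF L] smooth_on_imp_differentiable[OF S(2)])
    finally show ?thesis .
  qed
  show ?thesis
    unfolding complex_eq_iff
    using *[OF bounded_linear_Re, of u v] *[OF bounded_linear_Re, of v u]
      *[OF bounded_linear_Im, of u v] *[OF bounded_linear_Im, of v u]
      frechet_symmetric_real[OF S(1) smooth_on_Re[OF S(1,2)] S(3), of u v]
      frechet_symmetric_real[OF S(1) smooth_on_Im[OF S(1,2)] S(3), of u v]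
    by argo
qed

section \<open>Wirtinger derivatives in one complex variable\<close>

lemma del_eqI: "(f has_derivative D) (at z) \<Longrightarrow> del f z = (D 1 - \<i> * D \<i>) / 2"
  and delbar_eqI: "(f has_derivative D) (at z) \<Longrightarrow> delbar f z = (D 1 + \<i> * D \<i>) / 2"
  by (simp_all add: del_def delbar_def frechet_eqI)

lemma differentiable_works:
  "f differentiable (at x) \<Longrightarrow> (f has_derivative frechet_derivative f (at x)) (at x)"
  using frechet_derivative_works by blast

lemma del_cong:
  assumes "open S" "x \<in> S" "\<And>y. y \<in> S \<Longrightarrow> f y = g y"
  shows "del f x = del g x" "delbar f x = delbar g x"
  using frechet_cong_open[of S x f g] assms by (simp_all add: del_def delbar_def)

lemma del_const [simp]: "del (\<lambda>z. c) z = 0" "delbar (\<lambda>z. c) z = 0"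
  by (simp_all add: del_def delbar_def)

lemma del_add:
  assumes "f differentiable (at z)" "g differentiable (at z)"
  shows "del (\<lambda>z. f z + g z) z = del f z + del g z"
    and "delbar (\<lambda>z. f z + g z) z = delbar f z + delbar g z"
  using has_derivative_add[OF assms[THEN differentiable_works]]
  by (simp_all add: del_eqI delbar_eqI del_def[of f] del_def[of g] delbar_def[of f] delbar_def[of g] field_simps)

lemma del_mult:
  assumes "f differentiable (at z)" "g differentiable (at z)"
  shows "del (\<lambda>z. f z * g z) z = del f z * g z + f z * del g z"
    and "delbar (\<lambda>z. f z * g z) z = delbar f z * g z + f z * delbar g z"
  using has_derivative_mult[OF assms[THEN differentiable_works]]
  by (simp_all add: del_eqI delbar_eqI del_def[of f] del_def[of g] delbar_def[of f] delbar_def[of g] field_simps)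

lemma del_minus:
  assumes "f differentiable (at z)"
  shows "del (\<lambda>z. - f z) z = - del f z" "delbar (\<lambda>z. - f z) z = - delbar f z"
  using has_derivative_minus[OF differentiable_works[OF assms]]
  by (simp_all add: del_eqI delbar_eqI del_def[of f] delbar_def[of f] field_simps)

lemma del_cmult:
  assumes "f differentiable (at z)"
  shows "del (\<lambda>z. c * f z) z = c * del f z" "delbar (\<lambda>z. c * f z) z = c * delbar f z"
  using del_mult[of "\<lambda>_. c" z f] assms by simp_all

lemma del_sum:
  assumes "\<And>i. i \<in> I \<Longrightarrow> f i differentiable (at z)"
  shows "del (\<lambda>z. \<Sum>i\<in>I. f i z) z = (\<Sum>i\<in>I. del (f i) z)"
    and "delbar (\<lambda>z. \<Sum>i\<in>I. f i z) z = (\<Sum>i\<in>I. delbar (f i) z)"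
proof -
  have "((\<lambda>z. \<Sum>i\<in>I. f i z) has_derivative (\<lambda>v. \<Sum>i\<in>I. frechet_derivative (f i) (at z) v)) (at z)"
    by (intro has_derivative_sum differentiable_works assms)
  from del_eqI[OF this] delbar_eqI[OF this]
  show "del (\<lambda>z. \<Sum>i\<in>I. f i z) z = (\<Sum>i\<in>I. del (f i) z)"
    "delbar (\<lambda>z. \<Sum>i\<in>I. f i z) z = (\<Sum>i\<in>I. delbar (f i) z)"
    by (simp_all add: del_def delbar_def sum_divide_distrib sum_subtractf sum.distrib sum_distrib_left
        diff_divide_distrib add_divide_distrib)
qed

text \<open>A real-linear map of the plane is the sum of a complex-linear and an antilinear part;
  \<open>del\<close> and \<open>delbar\<close> are their coefficients.\<close>

lemma frechet_complex:
  assumes "f differentiable (at z)"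
  shows "frechet_derivative f (at z) v = del f z * v + delbar f z * cnj v"
proof -
  interpret linear "frechet_derivative f (at z)"
    using has_derivative_linear[OF differentiable_works[OF assms]] .
  have "frechet_derivative f (at z) v = frechet_derivative f (at z) (Re v *\<^sub>R 1 + Im v *\<^sub>R \<i>)"
    by (rule arg_cong[where f="frechet_derivative f (at z)"]) (simp add: complex_eq_iff)
  also have "\<dots> = Re v *\<^sub>R frechet_derivative f (at z) 1 + Im v *\<^sub>R frechet_derivative f (at z) \<i>"
    by (simp only: add scale)
  also have "\<dots> = del f z * v + delbar f z * cnj v"
    by (simp add: del_def delbar_def complex_eq_iff field_simps)
  finally show ?thesis .
qed

lemma del_cnj:
  assumes "f differentiable (at z)"
  shows "del (\<lambda>z. cnj (f z)) z = cnj (delbar f z)" "delbar (\<lambda>z. cnj (f z)) z = cnj (del f z)"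
  using has_derivative_cnj[OF differentiable_works[OF assms]]
  by (simp_all add: del_eqI delbar_eqI del_def[of f] delbar_def[of f])

lemma del_holomorphic:
  assumes "(f has_field_derivative f') (at z)"
  shows "del f z = f'" "delbar f z = 0"
  using assms unfolding has_field_derivative_def
  by (simp_all add: del_eqI delbar_eqI algebra_simps)

text \<open>For holomorphic T the mixed terms of the chain rule vanish, so neither derivative of f
  leaks into the other.\<close>

lemma del_compose_holomorphic:
  assumes "f differentiable (at (T z))" "(T has_field_derivative T') (at z)"
  shows "del (\<lambda>z. f (T z)) z = del f (T z) * T'" "delbar (\<lambda>z. f (T z)) z = delbar f (T z) * cnj T'"
proof -
  have "((\<lambda>z. f (T z)) has_derivative (\<lambda>v. del f (T z) * (T' * v) + delbar f (T z) * cnj (T' * v))) (at z)"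
    using has_derivative_compose[OF assms(2)[unfolded has_field_derivative_def] differentiable_works[OF assms(1)]]
    by (simp add: frechet_complex[OF assms(1)])
  from del_eqI[OF this] delbar_eqI[OF this]
  show "del (\<lambda>z. f (T z)) z = del f (T z) * T'" "delbar (\<lambda>z. f (T z)) z = delbar f (T z) * cnj T'"
    by (simp_all add: algebra_simps)
qed

lemma smooth_on_del:
  assumes "open S" "smooth_on S f"
  shows "smooth_on S (del f)" "smooth_on S (delbar f)"
proof -
  have "smooth_on S (\<lambda>z. 1 / 2 * (frechet_derivative f (at z) 1 - \<i> * frechet_derivative f (at z) \<i>))"
    "smooth_on S (\<lambda>z. 1 / 2 * (frechet_derivative f (at z) 1 + \<i> * frechet_derivative f (at z) \<i>))"
    by (intro smooth_on_mult smooth_on_add smooth_on_diff smooth_on_const smooth_on_frechet assms)+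
  then show "smooth_on S (del f)" "smooth_on S (delbar f)"
    by (simp_all add: del_def[abs_def] delbar_def[abs_def])
qed

section \<open>Wirtinger derivatives in base and fibre variables\<close>

text \<open>The directions u, v span one complex coordinate line and s is -i or i. Thus the four
  partial derivatives on the product of base and fibre are instances of one operator, and one
  commutation lemma serves all of them.\<close>

definition wirtinger :: "complex \<Rightarrow> 'a \<Rightarrow> 'a \<Rightarrow> ('a::real_normed_vector \<Rightarrow> complex) \<Rightarrow> 'a \<Rightarrow> complex" where
  "wirtinger s u v f x = 1 / 2 * (frechet_derivative f (at x) u + s * frechet_derivative f (at x) v)"

lemma smooth_on_wirtinger: "open S \<Longrightarrow> smooth_on S f \<Longrightarrow> smooth_on S (wirtinger s u v f)"
  unfolding wirtinger_def[abs_def]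
  by (intro smooth_on_mult smooth_on_add smooth_on_const smooth_on_frechet)

lemma wirtinger_cong:
  "open S \<Longrightarrow> x \<in> S \<Longrightarrow> (\<And>y. y \<in> S \<Longrightarrow> f y = g y) \<Longrightarrow> wirtinger s u v f x = wirtinger s u v g x"
  using frechet_cong_open[of S x f g] by (simp add: wirtinger_def)

lemma wirtinger_commute:
  assumes "open S" "smooth_on S f" "x \<in> S"
  shows "wirtinger s u v (wirtinger s' u' v' f) x = wirtinger s' u' v' (wirtinger s u v f) x"
proof -
  let ?d = "\<lambda>u y. frechet_derivative f (at y) u"
  have *: "frechet_derivative (wirtinger s u v f) (at x) w =
      1 / 2 * (frechet_derivative (?d u) (at x) w + s * frechet_derivative (?d v) (at x) w)" for s u v w
  proof -
    have "(?d a has_derivative frechet_derivative (?d a) (at x)) (at x)" for a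
      by (rule smooth_on_has_derivative[OF smooth_on_frechet[OF assms(2)] assms(3)])
    then have "(wirtinger s u v f has_derivative
        (\<lambda>w. 1 / 2 * (frechet_derivative (?d u) (at x) w + s * frechet_derivative (?d v) (at x) w))) (at x)"
      unfolding wirtinger_def[abs_def] by (intro has_derivative_mult_right has_derivative_add)
    then show ?thesis by (simp only: frechet_eqI)
  qed
  show ?thesis
    unfolding wirtinger_def[of _ _ _ "wirtinger s' u' v' f"] wirtinger_def[of _ _ _ "wirtinger s u v f"] *
      frechet_symmetric[OF assms, of u u'] frechet_symmetric[OF assms, of u v']
      frechet_symmetric[OF assms, of v u'] frechet_symmetric[OF assms, of v v']
    by (simp add: algebra_simps)
qed

abbreviation "del1 \<equiv> wirtinger (- \<i>) (1 :: complex, 0 :: complex) (\<i>, 0)"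
abbreviation "delbar1 \<equiv> wirtinger \<i> (1 :: complex, 0 :: complex) (\<i>, 0)"
abbreviation "del2 \<equiv> wirtinger (- \<i>) (0 :: complex, 1 :: complex) (0, \<i>)"
abbreviation "delbar2 \<equiv> wirtinger \<i> (0 :: complex, 1 :: complex) (0, \<i>)"

text \<open>Links the one-variable derivatives in the Poisson bracket and in \<open>taylor\<close>
  to operators on the product, where they commute.\<close>

lemma partial_wirtinger:
  assumes "F differentiable (at (z, p))"
  shows "del (\<lambda>w. F (w, p)) z = del1 F (z, p)" "delbar (\<lambda>w. F (w, p)) z = delbar1 F (z, p)"
    and "del (\<lambda>q. F (z, q)) p = del2 F (z, p)" "delbar (\<lambda>q. F (z, q)) p = delbar2 F (z, p)"
proof -
  note D = differentiable_works[OF assms]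
  have 1: "((\<lambda>w. F (w, p)) has_derivative (\<lambda>v. frechet_derivative F (at (z, p)) (v, 0))) (at z)"
    by (rule has_derivative_compose[where f="\<lambda>w. (w, p)", OF _ D]) (auto intro!: derivative_eq_intros)
  have 2: "((\<lambda>q. F (z, q)) has_derivative (\<lambda>v. frechet_derivative F (at (z, p)) (0, v))) (at p)"
    by (rule has_derivative_compose[where f="\<lambda>q. (z, q)", OF _ D]) (auto intro!: derivative_eq_intros)
  show "del (\<lambda>w. F (w, p)) z = del1 F (z, p)" "delbar (\<lambda>w. F (w, p)) z = delbar1 F (z, p)"
    "del (\<lambda>q. F (z, q)) p = del2 F (z, p)" "delbar (\<lambda>q. F (z, q)) p = delbar2 F (z, p)"
    by (simp_all add: wirtinger_def del_eqI[OF 1] del_eqI[OF 2] delbar_eqI[OF 1] delbar_eqI[OF 2])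
qed

lemma smooth_on_slice:
  assumes "smooth_on (U \<times> UNIV) F" "open U" "z \<in> U"
  shows "smooth_on UNIV (\<lambda>p :: complex. F (z :: complex, p))"
proof (rule smooth_on_compose[OF assms(1)])
  show "smooth_on UNIV (\<lambda>p :: complex. (z, p))"
    by (intro smooth_on_Pair smooth_on_const smooth_on_ident) auto
qed (use assms in \<open>auto intro: open_Times\<close>)

lemma smooth_on_slice':
  assumes "smooth_on (U \<times> UNIV) F" "open U"
  shows "smooth_on U (\<lambda>z :: complex. F (z, p :: complex))"
proof (rule smooth_on_compose[OF assms(1)])
  show "smooth_on U (\<lambda>z :: complex. (z, p))"
    using assms by (intro smooth_on_Pair smooth_on_const smooth_on_ident) auto
qed (use assms in \<open>auto intro: open_Times\<close>)

unbundle no fps_syntax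

section \<open>Change of variables in the plane\<close>

text \<open>The change of variables theorem applied below speaks of vector-valued functions of
  vectors, so complex arguments and values are both passed through this isometry.\<close>

definition vec2c :: "real ^ 2 \<Rightarrow> complex" where "vec2c v = Complex (v $ 1) (v $ 2)"
definition c2vec :: "complex \<Rightarrow> real ^ 2" where "c2vec z = (\<chi> i. if i = 1 then Re z else Im z)"

lemma vec2c_c2vec [simp]: "vec2c (c2vec z) = z"
  by (simp add: vec2c_def c2vec_def)

lemma c2vec_vec2c [simp]: "c2vec (vec2c v) = v"
  by (auto simp: vec2c_def c2vec_def vec_eq_iff) (metis exhaust_2)

lemma bounded_linear_vec2c: "bounded_linear vec2c"
  by (rule linear_conv_bounded_linear[THEN iffD1], rule linearI) (simp_all add: vec2c_def complex_eq_iff)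

lemma bounded_linear_c2vec: "bounded_linear c2vec"
  by (rule linear_conv_bounded_linear[THEN iffD1], rule linearI) (simp_all add: c2vec_def vec_eq_iff)

lemma c2vec_image: "c2vec ` S = vec2c -` S"
  by (auto intro: image_eqI[where x="vec2c _"])

text \<open>Lebesgue measure is determined by its values on boxes, and the isometry carries boxes to
  boxes of equal size.\<close>

lemma distr_vec2c: "distr lborel borel vec2c = (lborel :: complex measure)"
proof (rule lborel_eqI[symmetric])
  have m: "vec2c \<in> borel_measurable borel"
    by (intro borel_measurable_continuous_onI bounded_linear.continuous_on[OF bounded_linear_vec2c] continuous_on_id)
  fix l u :: complex assume lu: "\<And>b. b \<in> Basis \<Longrightarrow> l \<bullet> b \<le> u \<bullet> b"
  have le: "Re l \<le> Re u" "Im l \<le> Im u"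
    using lu[of 1] lu[of \<i>] by (auto simp: Basis_complex_def)
  have B: "Basis = {axis 1 1, axis 2 1 :: real ^ 2}"
    by (auto simp: Basis_vec_def UNIV_2)
  have "vec2c -` box l u = box (c2vec l) (c2vec u)"
    by (auto simp: box_def B Basis_complex_def vec2c_def c2vec_def inner_axis)
  then have "emeasure (distr lborel borel vec2c) (box l u) = emeasure lborel (box (c2vec l) (c2vec u))"
    using m by (simp add: emeasure_distr)
  also have "\<dots> = (\<Prod>b\<in>Basis. (c2vec u - c2vec l) \<bullet> b)"
    using le by (intro emeasure_lborel_box) (auto simp: B c2vec_def inner_axis)
  also have "(\<Prod>b\<in>Basis. (c2vec u - c2vec l) \<bullet> b) = (Re u - Re l) * (Im u - Im l)"
    by (simp add: B c2vec_def inner_axis axis_eq_axis)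
  also have "\<dots> = (\<Prod>b\<in>Basis. (u - l) \<bullet> b)"
    by (simp add: Basis_complex_def)
  finally show "emeasure (distr lborel borel vec2c) (box l u) = (\<Prod>b\<in>Basis. (u - l) \<bullet> b)" .
qed simp

lemma integral_c2vec:
  fixes F :: "complex \<Rightarrow> complex"
  assumes F: "set_integrable lborel Q F"
  shows "(\<lambda>v. c2vec (F (vec2c v))) absolutely_integrable_on c2vec ` Q"
    and "integral (c2vec ` Q) (\<lambda>v. c2vec (F (vec2c v))) = c2vec (integral Q F)"
proof -
  let ?G = "\<lambda>z. indicator Q z *\<^sub>R F z"
  have m: "vec2c \<in> measurable lborel borel"
    by (simp add: borel_measurable_continuous_onI bounded_linear.continuous_on[OF bounded_linear_vec2c])
  have G: "integrable lborel ?G" using F by (simp add: set_integrable_def)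
  then have Gm: "?G \<in> borel_measurable borel" by (simp add: integrable_iff_bounded)
  have ind: "?G (vec2c v) = indicator (c2vec ` Q) v *\<^sub>R F (vec2c v)" for v
    by (simp add: c2vec_image indicator_def)
  have 1: "integrable lborel (\<lambda>v. ?G (vec2c v))"
    using integrable_distr_eq[OF m Gm] G by (simp add: distr_vec2c)
  have 2: "integral\<^sup>L lborel (\<lambda>v. ?G (vec2c v)) = integral\<^sup>L lborel ?G"
    using integral_distr[OF m Gm] by (simp add: distr_vec2c)
  have s: "set_integrable lborel (c2vec ` Q) (\<lambda>v. F (vec2c v))"
    using 1 by (simp add: set_integrable_def ind)
  have ai: "(\<lambda>v. F (vec2c v)) absolutely_integrable_on c2vec ` Q"
    using s unfolding set_integrable_def
    by (subst integrable_completion) (auto simp: integrable_iff_bounded)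
  from absolutely_integrable_linear[OF this bounded_linear_c2vec]
  show "(\<lambda>v. c2vec (F (vec2c v))) absolutely_integrable_on c2vec ` Q" by (simp add: o_def)
  have "integral (c2vec ` Q) (\<lambda>v. F (vec2c v)) = integral Q F"
    using set_borel_integral_eq_integral(2)[OF s] set_borel_integral_eq_integral(2)[OF F] 2
    by (simp add: set_lebesgue_integral_def ind)
  with integral_linear[OF set_borel_integral_eq_integral(1)[OF s] bounded_linear_c2vec]
  show "integral (c2vec ` Q) (\<lambda>v. c2vec (F (vec2c v))) = c2vec (integral Q F)" by (simp add: o_def)
qed

text \<open>The real Jacobian determinant of multiplication by T' is the squared modulus of T',
  which is exactly the factor dz dz-bar picks up.\<close>

lemma integral_holomorphic_substitution:
  fixes f :: "complex \<Rightarrow> complex"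
  assumes S: "open S" and T: "T holomorphic_on S" "inj_on T S"
    and f: "set_integrable lborel (T ` S) f"
    and fT: "set_integrable lborel S (\<lambda>z. of_real ((cmod (deriv T z))\<^sup>2) * f (T z))"
  shows "integral S (\<lambda>z. of_real ((cmod (deriv T z))\<^sup>2) * f (T z)) = integral (T ` S) f"
proof -
  define g where "g = (\<lambda>v. c2vec (T (vec2c v)))"
  define g' where "g' = (\<lambda>v h. c2vec (deriv T (vec2c v) * vec2c h))"
  have "open (c2vec ` S)"
    unfolding c2vec_image using S bounded_linear.continuous_on[OF bounded_linear_vec2c continuous_on_id]
    by (intro open_vimage) auto
  then have Sl: "c2vec ` S \<in> sets lebesgue" by auto
  have der: "(g has_derivative g' x) (at x within c2vec ` S)" if "x \<in> c2vec ` S" for x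
  proof -
    have x: "vec2c x \<in> S" using that by (simp add: c2vec_image)
    have "(T has_derivative (*) (deriv T (vec2c x))) (at (vec2c x))"
      using holomorphic_derivI[OF T(1) S x] by (simp add: has_field_derivative_def)
    from has_derivative_compose[OF bounded_linear_imp_has_derivative[OF bounded_linear_vec2c] this]
    have "(g has_derivative g' x) (at x)"
      unfolding g_def g'_def by (rule bounded_linear.has_derivative[OF bounded_linear_c2vec])
    then show ?thesis by (rule has_derivative_at_withinI)
  qed
  have inj: "inj_on g (c2vec ` S)"
    using T(2) unfolding g_def inj_on_def by (metis c2vec_vec2c vec2c_c2vec c2vec_image vimageE)
  have img: "g ` c2vec ` S = c2vec ` T ` S" by (simp add: g_def image_image)
  have det: "det (matrix (g' x)) = (cmod (deriv T (vec2c x)))\<^sup>2" for x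
    by (simp add: det_2 matrix_def g'_def c2vec_def vec2c_def axis_def cmod_power2 flip: power2_eq_square)
  have c2vec_scale: "c2vec (of_real r * w) = r *\<^sub>R c2vec w" for r w
    by (simp add: c2vec_def vec_eq_iff)
  have "integral (c2vec ` S) (\<lambda>x. \<bar>det (matrix (g' x))\<bar> *\<^sub>R c2vec (f (vec2c (g x)))) =
      integral (g ` c2vec ` S) (\<lambda>v. c2vec (f (vec2c v)))"
    using has_absolute_integral_change_of_variables[OF Sl der inj, of "\<lambda>v. c2vec (f (vec2c v))"]
      integral_c2vec(1)[OF f] unfolding img by blast
  also have "\<dots> = c2vec (integral (T ` S) f)" unfolding img by (rule integral_c2vec(2)[OF f])
  also have "(\<lambda>x. \<bar>det (matrix (g' x))\<bar> *\<^sub>R c2vec (f (vec2c (g x)))) =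
      (\<lambda>x. c2vec (of_real ((cmod (deriv T (vec2c x)))\<^sup>2) * f (T (vec2c x))))"
    by (simp add: det g_def c2vec_scale del: of_real_power)
  also have "integral (c2vec ` S) \<dots> = c2vec (integral S (\<lambda>z. of_real ((cmod (deriv T z))\<^sup>2) * f (T z)))"
    by (rule integral_c2vec(2)[OF fT])
  finally show ?thesis by (metis vec2c_c2vec)
qed

section \<open>Integrals of compactly supported functions\<close>

text \<open>On U the function agrees with its restriction to S, and a continuous function on a
  compact set is integrable.\<close>

lemma set_integrable_compact_support:
  fixes f :: "complex \<Rightarrow> complex"
  assumes U: "open U" "continuous_on U f" and S: "compact S" "S \<subseteq> U"
    and z: "\<And>z. z \<in> U \<Longrightarrow> f z \<noteq> 0 \<Longrightarrow> z \<in> S"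
  shows "set_integrable lborel U f"
proof -
  have "integrable lborel (\<lambda>x. indicator S x *\<^sub>R f x)"
    using S U(2) by (intro borel_integrable_compact continuous_on_subset[OF U(2)]) auto
  also have "(\<lambda>x. indicator S x *\<^sub>R f x) = (\<lambda>x. indicator U x *\<^sub>R f x)"
    using S z by (auto simp: indicator_def fun_eq_iff)
  finally show ?thesis by (simp add: set_integrable_def)
qed

lemma integral_support:
  fixes f :: "complex \<Rightarrow> complex"
  assumes "V \<subseteq> U" "\<And>z. z \<in> U \<Longrightarrow> z \<notin> V \<Longrightarrow> f z = 0"
  shows "integral U f = integral V f"
proof -
  have "(\<lambda>z. if z \<in> U then f z else 0) = (\<lambda>z. if z \<in> V then f z else 0)"
    using assms by (auto simp: fun_eq_iff)
  then show ?thesis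
    by (metis (no_types) Henstock_Kurzweil_Integration.integral_restrict_UNIV)
qed

text \<open>By translation invariance every difference quotient has integral zero. The quotients are
  uniformly bounded with a common compact support, so dominated convergence carries this to the
  derivative.\<close>

lemma integral_directional_derivative:
  fixes f :: "complex \<Rightarrow> complex"
  assumes f: "smooth_on UNIV f" and S: "compact S" "\<And>z. f z \<noteq> 0 \<Longrightarrow> z \<in> S"
  shows "integrable lborel (\<lambda>z. frechet_derivative f (at z) v)"
    and "integral\<^sup>L lborel (\<lambda>z. frechet_derivative f (at z) v) = 0"
proof -
  let ?D = "\<lambda>z. frechet_derivative f (at z) v"
  have cont: "continuous_on UNIV ?D" by (rule smooth_on_imp_continuous_on[OF smooth_on_frechet[OF f]])
  have fc: "continuous_on UNIV f" by (rule smooth_on_imp_continuous_on[OF f])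
  have fint: "integrable lborel f"
    using set_integrable_compact_support[of UNIV f S] fc S by (simp add: set_integrable_def)
  have Dz: "?D z = 0" if "z \<notin> S" for z
  proof -
    have "frechet_derivative f (at z) = frechet_derivative (\<lambda>_. 0) (at z)"
      using that S by (intro frechet_cong_open[of "- S"]) (auto simp: compact_imp_closed)
    then show ?thesis by simp
  qed
  have "set_integrable lborel UNIV ?D"
    by (rule set_integrable_compact_support[OF open_UNIV cont S(1)]) (simp, metis Dz)
  then show "integrable lborel ?D" by (simp add: set_integrable_def)
  have "bounded (?D ` S)"
    using compact_continuous_image[OF continuous_on_subset[OF cont] S(1)] compact_imp_bounded by auto
  then obtain B where "\<And>z. z \<in> S \<Longrightarrow> norm (?D z) \<le> B" and B0: "B > 0"
    unfolding bounded_pos by auto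
  then have B: "norm (?D z) \<le> B" for z using Dz[of z] by (cases "z \<in> S") auto
  obtain R where R: "\<And>z. z \<in> S \<Longrightarrow> norm z \<le> R" "R > 0"
    using compact_imp_bounded[OF S(1)] unfolding bounded_pos by auto
  \<comment> \<open>Difference quotient along v with step 1/(n+1); the shift is written on the left
    to match the translation \<open>(+) c\<close> of Lebesgue measure.\<close>
  define q where "q = (\<lambda>n z. of_nat (Suc n) * (f (inverse (of_nat (Suc n)) * v + z) - f z))"
  have ld: "((\<lambda>t. f (z + t *\<^sub>R v)) has_derivative (\<lambda>h. h *\<^sub>R ?D (z + t *\<^sub>R v))) (at t)" for z t
    by (rule frechet_line) (rule smooth_on_has_derivative[OF f], simp)
  have sh: "inverse (of_nat (Suc n)) * v + z = z + (inverse (real (Suc n))) *\<^sub>R v" for n z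
    by (simp add: scaleR_conv_of_real)
  \<comment> \<open>Mean value inequality along the segment, with the bound B of the directional
    derivative.\<close>
  have qb: "norm (q n z) \<le> B" for n z
  proof -
    let ?h = "inverse (real (Suc n))"
    have "norm (f (z + ?h *\<^sub>R v) - f (z + 0 *\<^sub>R v)) \<le> B * norm (?h - 0)"
    proof (rule differentiable_bound[of UNIV "\<lambda>t. f (z + t *\<^sub>R v)" "\<lambda>t h. h *\<^sub>R ?D (z + t *\<^sub>R v)"])
      show "((\<lambda>t. f (z + t *\<^sub>R v)) has_derivative (\<lambda>h. h *\<^sub>R ?D (z + t *\<^sub>R v))) (at t within UNIV)" for t
        using ld by simp
      show "onorm (\<lambda>h. h *\<^sub>R ?D (z + t *\<^sub>R v)) \<le> B" for t
        by (intro onorm_le) (use mult_right_mono[OF B abs_ge_zero] in \<open>simp add: mult.commute\<close>)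
    qed auto
    then have "norm (f (z + ?h *\<^sub>R v) - f z) \<le> B * ?h" by simp
    then have "real (Suc n) * norm (f (z + ?h *\<^sub>R v) - f z) \<le> real (Suc n) * (B * ?h)"
      by (intro mult_left_mono) auto
    also have "real (Suc n) * (B * ?h) = B" by simp
    finally show ?thesis unfolding q_def sh norm_mult norm_of_nat .
  qed
  \<comment> \<open>All shifts have length at most \<open>norm v\<close>, so enlarging the radius R
    of the support by that amount covers every n.\<close>
  have q0: "q n z = 0" if "norm z > R + norm v" for n z
  proof -
    have "norm (inverse (real (Suc n)) *\<^sub>R v) \<le> norm v"
      by (simp add: mult_left_le_one_le inverse_le_1_iff)
    then have "norm (z + inverse (real (Suc n)) *\<^sub>R v) > R"
      using that norm_diff_ineq[of z "inverse (real (Suc n)) *\<^sub>R v"] by linarith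
    moreover have "norm z > R" using that norm_ge_zero[of v] by linarith
    ultimately have "f (z + inverse (real (Suc n)) *\<^sub>R v) = 0" "f z = 0"
      using R(1) S(2) by (meson not_less)+
    then show ?thesis by (simp add: q_def sh del: of_nat_Suc)
  qed
  have tr: "integrable lborel (\<lambda>z. f (c + z))" "integral\<^sup>L lborel (\<lambda>z. f (c + z)) = integral\<^sup>L lborel f" for c
  proof -
    have m: "(+) c \<in> measurable lborel borel" "f \<in> borel_measurable borel"
      using fc by (auto intro: borel_measurable_continuous_onI)
    show "integrable lborel (\<lambda>z. f (c + z))" "integral\<^sup>L lborel (\<lambda>z. f (c + z)) = integral\<^sup>L lborel f"
      using integrable_distr_eq[OF m] integral_distr[OF m] fint by (simp_all add: lborel_distr_plus)
  qed
  have qi: "integral\<^sup>L lborel (q n) = 0" for n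
    unfolding q_def using tr fint by simp
  have lim: "(\<lambda>n. q n z) \<longlonglongrightarrow> ?D z" for z
  proof -
    have "((\<lambda>h. norm (f (z + h *\<^sub>R v) - f z - h *\<^sub>R ?D z) / norm h) \<longlongrightarrow> 0) (at 0)"
      using ld[of z 0] by (simp add: has_derivative_at)
    then have "((\<lambda>h. norm ((f (z + h *\<^sub>R v) - f z) /\<^sub>R h - ?D z)) \<longlongrightarrow> 0) (at 0)"
    proof (rule Lim_transform_eventually)
      have "norm (w - h *\<^sub>R d) / norm h = norm (w /\<^sub>R h - d)" if "h \<noteq> 0" for h and w d :: complex
      proof -
        have "w /\<^sub>R h - d = (w - h *\<^sub>R d) /\<^sub>R h" using that by (simp add: scaleR_diff_right)
        then show ?thesis by (simp add: divide_inverse mult.commute)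
      qed
      then show "\<forall>\<^sub>F h in at 0. norm (f (z + h *\<^sub>R v) - f z - h *\<^sub>R ?D z) / norm h =
          norm ((f (z + h *\<^sub>R v) - f z) /\<^sub>R h - ?D z)"
        by (auto simp: eventually_at_filter)
    qed
    then have "((\<lambda>h. (f (z + h *\<^sub>R v) - f z) /\<^sub>R h) \<longlongrightarrow> ?D z) (at 0)"
      by (rule LIM_zero_cancel[OF tendsto_norm_zero_cancel])
    moreover have "filterlim (\<lambda>n. inverse (real (Suc n))) (at 0) sequentially"
      by (intro filterlim_atI LIMSEQ_inverse_real_of_nat) auto
    ultimately have "(\<lambda>n. (f (z + inverse (real (Suc n)) *\<^sub>R v) - f z) /\<^sub>R inverse (real (Suc n))) \<longlonglongrightarrow> ?D z"
      by (rule filterlim_compose)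
    then show ?thesis by (simp add: q_def scaleR_conv_of_real add.commute[of _ z])
  qed
  have "(\<lambda>n. integral\<^sup>L lborel (q n)) \<longlonglongrightarrow> integral\<^sup>L lborel ?D"
  proof (rule integral_dominated_convergence[where w="\<lambda>z. indicator (cball 0 (R + norm v)) z *\<^sub>R B"])
    show "?D \<in> borel_measurable lborel" using cont by (auto intro: borel_measurable_continuous_onI)
    show "q n \<in> borel_measurable lborel" for n
      unfolding q_def using tr(1) fint by (intro borel_measurable_times borel_measurable_diff) (auto simp: integrable_iff_bounded)
    show "integrable lborel (\<lambda>z :: complex. indicator (cball 0 (R + norm v)) z *\<^sub>R B)"
      by (intro borel_integrable_compact) auto
    show "AE z in lborel. (\<lambda>n. q n z) \<longlonglongrightarrow> ?D z" using lim by simp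
    show "AE z in lborel. norm (q n z) \<le> indicator (cball 0 (R + norm v)) z *\<^sub>R B" for n
    proof (rule AE_I2)
      fix z show "norm (q n z) \<le> indicator (cball 0 (R + norm v)) z *\<^sub>R B"
        using qb[of n z] q0[of z n] by (cases "norm z > R + norm v") (auto simp: indicator_def)
    qed
  qed
  then show "integral\<^sup>L lborel ?D = 0" by (simp add: qi LIMSEQ_const_iff)
qed

text \<open>Extended by zero the function is smooth on the whole plane, because U and the complement
  of S form an open cover; then the previous lemma applies.\<close>

lemma integral_del_compact_support:
  assumes U: "open U" "smooth_on U f" and S: "compact S" "S \<subseteq> U"
    and z: "\<And>z. z \<in> U \<Longrightarrow> f z \<noteq> 0 \<Longrightarrow> z \<in> S"
  shows "integral U (del f) = 0" "integral U (delbar f) = 0"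
proof -
  define g where "g = (\<lambda>z. if z \<in> U then f z else 0)"
  have gz: "g z \<noteq> 0 \<Longrightarrow> z \<in> S" for z using z by (auto simp: g_def split: if_splits)
  have "smooth_on UNIV g"
  proof (rule smooth_on_local)
    fix x :: complex
    show "\<exists>V. open V \<and> x \<in> V \<and> smooth_on V g"
    proof (cases "x \<in> U")
      case True
      have "smooth_on U g" using U(2) by (subst smooth_on_cong[OF U(1), where g=f]) (auto simp: g_def)
      then show ?thesis using True U(1) by blast
    next
      case False
      have o: "open (- S)" using S(1) by (simp add: compact_imp_closed open_Compl)
      then have "smooth_on (- S) g" using gz by (intro smooth_on_eq_const[where c=0]) auto
      then show ?thesis using False S(2) o by blast
    qed
  qed
  note D = integral_directional_derivative[OF this S(1) gz]
  have eq: "del f z = del g z" "delbar f z = delbar g z" if "z \<in> U" for z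
    using del_cong[OF U(1) that, of f g] by (auto simp: g_def)
  have gS: "del g z = 0" "delbar g z = 0" if "z \<notin> U" for z
  proof -
    have "open (- S)" "z \<in> - S" using S that by (auto simp: compact_imp_closed open_Compl)
    then show "del g z = 0" "delbar g z = 0"
      using del_cong[of "- S" z g "\<lambda>_. 0"] gz by auto
  qed
  \<comment> \<open>The values -i and i of s give \<open>del\<close> and \<open>delbar\<close>
    respectively.\<close>
  have int: "integrable lborel (\<lambda>z. 1 / 2 * (frechet_derivative g (at z) 1 + s * frechet_derivative g (at z) \<i>))"
    "integral\<^sup>L lborel (\<lambda>z. 1 / 2 * (frechet_derivative g (at z) 1 + s * frechet_derivative g (at z) \<i>)) = 0" for s
    using D by simp_all
  have "integral UNIV (del g) = 0" "integral UNIV (delbar g) = 0"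
    using integral_lborel[OF int(1), of "- \<i>"] int(2)[of "- \<i>"] integral_lborel[OF int(1), of "\<i>"] int(2)[of "\<i>"]
    by (simp_all add: del_def[abs_def] delbar_def[abs_def])
  moreover have "integral U (del f) = integral U (del g)" "integral U (delbar f) = integral U (delbar g)"
    using eq by (auto intro!: integral_cong)
  moreover have "integral UNIV (del g) = integral U (del g)" "integral UNIV (delbar g) = integral U (delbar g)"
    using gS by (auto intro!: integral_support)
  ultimately show "integral U (del f) = 0" "integral U (delbar f) = 0" by simp_all
qed

unbundle fps_syntax

unbundle no vec_syntax

section \<open>Reduction modulo the ideal\<close>

text \<open>Substitution of the series \<open>M\<close> for the outer variable \<open>p\<close>-bar.\<close>

definition reduce :: "complex fps \<Rightarrow> fpoly \<Rightarrow> complex fps" where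
  "reduce M f = poly (map_poly fps_of_poly f) M"

lemma reduce_0 [simp]: "reduce M 0 = 0"
  by (simp add: reduce_def)

lemma reduce_pCons: "reduce M (pCons a f) = fps_of_poly a + M * reduce M f"
  by (simp add: reduce_def map_poly_pCons)

lemma reduce_add: "reduce M (f + g) = reduce M f + reduce M g"
  by (induction f g rule: poly_induct2) (simp_all add: reduce_pCons fps_of_poly_add algebra_simps)

lemma reduce_smult: "reduce M (smult a f) = fps_of_poly a * reduce M f"
  by (induction f) (simp_all add: reduce_pCons fps_of_poly_mult algebra_simps)

lemma reduce_mult: "reduce M (f * g) = reduce M f * reduce M g"
  by (induction f) (simp_all add: reduce_pCons reduce_add reduce_smult algebra_simps)

lemma reduce_minus: "reduce M (- f) = - reduce M f"
  using reduce_smult[of M "-1" f] by (simp add: fps_of_poly_uminus)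

lemma reduce_diff: "reduce M (f - g) = reduce M f - reduce M g"
  using reduce_add[of M f "- g"] by (simp add: reduce_minus)

lemma reduce_sum: "reduce M (sum f I) = (\<Sum>i\<in>I. reduce M (f i))"
  by (induction I rule: infinite_finite_induct) (simp_all add: reduce_add)

lemma reduce_monom: "reduce M (monom b j) = fps_of_poly b * M ^ j"
  by (induction j) (simp_all add: reduce_pCons monom_0 monom_Suc)

lemma reduce_fmonom: "reduce M (fmonom a i j) = fps_const a * fps_X ^ i * M ^ j"
  by (simp add: fmonom_def reduce_monom fps_of_poly_monom)

lemma reduce_altdef:
  assumes "degree f \<le> N"
  shows "reduce M f = (\<Sum>j\<le>N. fps_of_poly (coeff f j) * M ^ j)"
  by (subst poly_as_sum_of_monoms'[OF assms, symmetric]) (simp add: reduce_sum reduce_monom)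

lemma coeff_fmonom:
  "coeff (coeff (fmonom a i j) v) u = (if u = i \<and> v = j then a else 0)"
  by (simp add: fmonom_def)

lemma fpoly_eqI:
  "(\<And>u v. coeff (coeff f v) u = coeff (coeff g v) u) \<Longrightarrow> f = (g :: fpoly)"
  by (intro poly_eqI) auto

lemma fmonom_mult: "fmonom a i j * fmonom b k l = fmonom (a * b) (i + k) (j + l)"
  by (simp add: fmonom_def mult_monom)

interpretation fpoly_module: Modules.module "(*) :: fpoly \<Rightarrow> fpoly \<Rightarrow> fpoly"
  by unfold_locales (simp_all add: algebra_simps)

definition structure_gen :: "nat \<Rightarrow> (nat \<Rightarrow> complex) \<Rightarrow> fpoly" where
  "structure_gen n a = - fmonom 1 0 1 + (\<Sum>k=2..n. fmonom (a k) (k - 1) 0)"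

definition structure_ideal :: "nat \<Rightarrow> (nat \<Rightarrow> complex) \<Rightarrow> fpoly set" where
  "structure_ideal n a = ideal_gen {fmonom 1 n 0, structure_gen n a}"

lemma structure_of_eq: "structure_of n \<mu> c z = structure_ideal n (\<lambda>k. \<mu> k c z)"
  by (simp add: structure_of_def structure_ideal_def structure_gen_def)

text \<open>M(p) of the overview; as a formal power series rather than a polynomial it lives in a
  ring where series with nonzero constant term can be inverted.\<close>

definition structure_series :: "nat \<Rightarrow> (nat \<Rightarrow> complex) \<Rightarrow> complex fps" where
  "structure_series n a = Abs_fps (\<lambda>m. if 1 \<le> m \<and> m < n then a (m + 1) else 0)"

lemma structure_series_nth: "structure_series n a $ m = (if 1 \<le> m \<and> m < n then a (m + 1) else 0)"
  by (simp add: structure_series_def)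

lemma sum_shift_2: "(\<Sum>k=2..n. f k (k - 1)) = (\<Sum>m\<in>{m. 1 \<le> m \<and> m < n}. f (m + 1) m)" for n :: nat
  by (rule sum.reindex_bij_witness[of _ "\<lambda>m. m + 1" "\<lambda>k. k - 1"]) auto

lemma fps_of_structure_poly:
  "fps_of_poly (\<Sum>k=2..n. monom (a k) (k - 1)) = structure_series n a"
proof (rule fps_ext)
  fix m
  have "fps_of_poly (\<Sum>k=2..n. monom (a k) (k - 1)) $ m =
        (\<Sum>k=2..n. if k - 1 = m then a k else 0)"
    by (simp add: coeff_sum)
  also have "\<dots> = (\<Sum>i\<in>{m. 1 \<le> m \<and> m < n}. if i = m then a (i + 1) else 0)"
    by (rule sum_shift_2[of "\<lambda>k i. if i = m then a k else 0"])
  also have "\<dots> = structure_series n a $ m"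
    by (simp add: structure_series_nth sum.If_cases)
  finally show "fps_of_poly (\<Sum>k=2..n. monom (a k) (k - 1)) $ m = structure_series n a $ m" .
qed

text \<open>Up to sign the second generator is a monic linear polynomial in p-bar with root M(p), so
  division by it is synthetic division.\<close>

lemma structure_gen_altdef:
  "structure_gen n a = - [:- (\<Sum>k=2..n. monom (a k) (k - 1)), 1:]"
proof -
  have "(\<Sum>k=2..n. fmonom (a k) (k - 1) 0) = [:\<Sum>k=2..n. monom (a k) (k - 1):]"
    by (rule poly_eqI) (simp add: coeff_sum fmonom_def monom_0 coeff_pCons split: nat.splits)
  then show ?thesis
    by (simp add: structure_gen_def fmonom_def monom_Suc monom_0 one_pCons)
qed

lemma reduce_structure_gen: "reduce (structure_series n a) (structure_gen n a) = 0"
  by (simp only: structure_gen_altdef reduce_minus reduce_pCons fps_of_poly_uminus fps_of_structure_poly reduce_0)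
     simp

text \<open>The ideal is the kernel of the substitution p-bar = M(p) followed by truncation at p^n.
  Both generators lie in that kernel; conversely, division by the linear generator leaves a
  remainder in p alone.\<close>

lemma structure_ideal_iff:
  "f \<in> structure_ideal n a \<longleftrightarrow> (\<forall>m<n. reduce (structure_series n a) f $ m = 0)"
proof
  let ?M = "structure_series n a"
  let ?S = "{f. \<forall>m<n. reduce ?M f $ m = 0}"
  have "fpoly_module.subspace ?S"
    by (auto simp: fpoly_module.subspace_def reduce_add reduce_mult fps_mult_nth)
  moreover have "{fmonom 1 n 0, structure_gen n a} \<subseteq> ?S"
    by (auto simp: reduce_fmonom reduce_structure_gen)
  ultimately have "structure_ideal n a \<subseteq> ?S"
    unfolding structure_ideal_def ideal_gen_def by (intro fpoly_module.span_minimal)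
  then show "f \<in> structure_ideal n a \<Longrightarrow> \<forall>m<n. reduce ?M f $ m = 0" by auto
next
  let ?M = "structure_series n a"
  let ?P = "\<Sum>k=2..n. monom (a k) (k - 1)"
  assume *: "\<forall>m<n. reduce ?M f $ m = 0"
  define r where "r = poly f ?P"
  define q where "q = synthetic_div f ?P"
  have f: "f = (- q) * structure_gen n a + [:r:]"
    using synthetic_div_correct'[of ?P f] by (simp add: structure_gen_altdef q_def r_def mult.commute)
  have "reduce ?M f = fps_of_poly r"
    by (subst f) (simp add: reduce_add reduce_diff reduce_mult reduce_structure_gen reduce_pCons)
  \<comment> \<open>The remainder is its own reduction, so its coefficients below n vanish and the
    first generator divides it.\<close>
  with * have "\<forall>m<n. coeff r m = 0" by simp
  then have "monom 1 n dvd r" by (simp add: monom_1_dvd_iff')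
  then obtain s where "r = monom 1 n * s" by blast
  then have "[:r:] = [:s:] * fmonom 1 n 0"
    by (simp add: fmonom_def monom_0 mult.commute)
  with f have "f = (- q) * structure_gen n a + [:s:] * fmonom 1 n 0" by simp
  also have "\<dots> \<in> structure_ideal n a" unfolding structure_ideal_def ideal_gen_def
    by (rule fpoly_module.span_add; rule fpoly_module.span_scale; rule fpoly_module.span_base; simp)
  finally show "f \<in> structure_ideal n a" .
qed

lemma is_ideal_ideal_gen: "is_ideal (ideal_gen B)"
  by (simp add: is_ideal_def ideal_gen_def)

lemma reduce_const_coeff:
  assumes "M $ 0 = 0"
  shows "reduce M f $ 0 = coeff (coeff f 0) 0"
  using assms by (cases f) (simp add: reduce_pCons)

lemma structure_series_0 [simp]: "structure_series n a $ 0 = 0"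
  by (simp add: structure_series_nth)

lemma reduce_trunc:
  assumes "m < n"
  shows "reduce M (\<Sum>i<n. fmonom (G i) i 0) $ m = G m"
proof -
  have "reduce M (\<Sum>i<n. fmonom (G i) i 0) $ m = (\<Sum>i<n. if i = m then G i else 0)"
    unfolding reduce_sum reduce_fmonom fps_sum_nth by (rule sum.cong) (auto simp: fps_X_power_nth)
  then show ?thesis using assms by simp
qed

text \<open>Reduction identifies the quotient with polynomials in p modulo p^n, so 1, p, ...,
  p^(n-1) form a basis. At a common zero the first generator forces p = 0, and then the second one
  forces p-bar = 0.\<close>

lemma structure_ideal_Hilb0:
  assumes "n \<ge> 1"
  shows "structure_ideal n a \<in> Hilb0 n"
proof -
  let ?M = "structure_series n a"
  have "codimension (structure_ideal n a) n"
    unfolding codimension_def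
  proof (intro exI[of _ "\<lambda>i. fmonom 1 i 0"] allI)
    fix f
    have eq: "f - (\<Sum>i<n. fmonom (b i) 0 0 * fmonom 1 i 0) \<in> structure_ideal n a \<longleftrightarrow>
        (\<forall>m<n. reduce ?M f $ m = b m)" for b
      by (simp add: structure_ideal_iff reduce_diff fmonom_mult reduce_trunc)
    show "\<exists>!b. b \<in> {..<n} \<rightarrow>\<^sub>E UNIV \<and> f - (\<Sum>i<n. fmonom (b i) 0 0 * fmonom 1 i 0) \<in> structure_ideal n a"
      unfolding eq
    proof (rule ex1I[of _ "restrict (\<lambda>m. reduce ?M f $ m) {..<n}"])
      fix b assume b: "b \<in> {..<n} \<rightarrow>\<^sub>E UNIV \<and> (\<forall>m<n. reduce ?M f $ m = b m)"
      show "b = restrict (\<lambda>m. reduce ?M f $ m) {..<n}"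
        using b by (intro ext) (auto simp: PiE_def extensional_def)
    qed auto
  qed
  moreover have "zero_locus (structure_ideal n a) = {(0, 0)}"
  proof -
    have A: "poly (poly f [:0:]) 0 = 0" if "f \<in> structure_ideal n a" for f
      using that assms reduce_const_coeff[of ?M f] by (auto simp: structure_ideal_iff poly_0_coeff_0)
    have B: "u = 0 \<and> v = 0" if *: "\<And>f. f \<in> structure_ideal n a \<Longrightarrow> poly (poly f [:v:]) u = 0" for u v
    proof -
      have g: "fmonom 1 n 0 \<in> structure_ideal n a" "structure_gen n a \<in> structure_ideal n a"
        unfolding structure_ideal_def ideal_gen_def by (auto intro: fpoly_module.span_base)
      from *[OF g(1)] have u: "u = 0"
        using assms by (auto simp: fmonom_def monom_0 poly_monom)
      have "poly (monom (a k) (k - 1)) 0 = 0" if "k \<in> {2..n}" for k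
        using that by (simp add: poly_monom)
      with *[OF g(2)] u show ?thesis by (simp add: structure_gen_altdef poly_sum)
    qed
    have "(u, v) \<in> zero_locus (structure_ideal n a) \<longleftrightarrow> (u, v) = (0, 0)" for u v
      unfolding zero_locus_def using A B[of v u] by auto
    then show ?thesis by auto
  qed
  ultimately show ?thesis unfolding Hilb0_def
    by (simp add: structure_ideal_def is_ideal_ideal_gen)
qed

section \<open>Conjugation\<close>

lemma coeff_fconj:
  "coeff (coeff (fconj f) v) u = cnj (coeff (coeff f u) v)"
proof -
  have "coeff (coeff (fconj f) v) u =
     (\<Sum>j\<le>degree f. \<Sum>i\<le>degree (coeff f j).
        if u = j \<and> v = i then cnj (coeff (coeff f j) i) else 0)"
    by (simp add: fconj_def coeff_sum coeff_fmonom)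
  also have "\<dots> = (\<Sum>j\<le>degree f. if j = u then cnj (coeff (coeff f j) v) else 0)"
  proof (rule sum.cong[OF refl])
    fix j
    show "(\<Sum>i\<le>degree (coeff f j).
        if u = j \<and> v = i then cnj (coeff (coeff f j) i) else 0) =
        (if j = u then cnj (coeff (coeff f j) v) else 0)"
      by (cases "u = j") (auto simp: coeff_eq_0)
  qed
  also have "\<dots> = cnj (coeff (coeff f u) v)"
    by (auto simp: coeff_eq_0)
  finally show ?thesis .
qed

lemma fconj_fconj: "fconj (fconj f) = f"
  by (rule fpoly_eqI) (simp add: coeff_fconj)

lemma fconj_mult: "fconj (f * g) = fconj f * fconj g"
proof (rule fpoly_eqI)
  fix u v
  show "coeff (coeff (fconj (f * g)) v) u =
        coeff (coeff (fconj f * fconj g) v) u"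
    by (simp add: coeff_fconj coeff_mult coeff_sum cnj_sum) (rule sum.swap)
qed

text \<open>The right-hand side is the maximal ideal of the origin; splitting off the p-bar-free
  part and then the constant displays an element as a combination of the generators.\<close>

lemma ideal_gen_origin:
  "ideal_gen {fmonom 1 1 0, fmonom 1 0 1} = {f. coeff (coeff f 0) 0 = 0}"
proof
  have "fpoly_module.subspace {f. coeff (coeff f 0) 0 = 0}"
    by (auto simp: fpoly_module.subspace_def coeff_mult_0)
  then show "ideal_gen {fmonom 1 1 0, fmonom 1 0 1} \<subseteq> {f. coeff (coeff f 0) 0 = 0}"
    unfolding ideal_gen_def by (rule fpoly_module.span_minimal[rotated]) (auto simp: coeff_fmonom)
next
  show "{f. coeff (coeff f 0) 0 = 0} \<subseteq> ideal_gen {fmonom 1 1 0, fmonom 1 0 1}"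
  proof
    fix f :: fpoly assume "f \<in> {f. coeff (coeff f 0) 0 = 0}"
    moreover obtain b g where f: "f = pCons b g" by (cases f)
    moreover obtain b0 h where b: "b = pCons b0 h" by (cases b)
    ultimately have "f = [:h:] * fmonom 1 1 0 + g * fmonom 1 0 1"
      by (simp add: fmonom_def monom_Suc monom_0 flip: one_pCons)
    also have "\<dots> \<in> ideal_gen {fmonom 1 1 0, fmonom 1 0 1}"
      unfolding ideal_gen_def
      by (rule fpoly_module.span_add; rule fpoly_module.span_scale; rule fpoly_module.span_base; simp)
    finally show "f \<in> ideal_gen {fmonom 1 1 0, fmonom 1 0 1}" .
  qed
qed

text \<open>Given f vanishing at the origin, let B be the conjugate of the second generator. Then B
  g lies in the conjugate ideal for every g, and g is found such that f - B g reduces to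
  zero.\<close>

lemma structure_ideal_conj:
  assumes n: "n \<ge> 2" and a: "(cmod (a 2))\<^sup>2 < 1"
  shows "{f + fconj h | f h. f \<in> structure_ideal n a \<and> h \<in> structure_ideal n a} =
         ideal_gen {fmonom 1 1 0, fmonom 1 0 1}"
proof -
  let ?M = "structure_series n a"
  have "coeff (coeff f 0) 0 = 0" if "f \<in> structure_ideal n a" for f
    using that n reduce_const_coeff[of ?M f] by (auto simp: structure_ideal_iff)
  then have 1: "coeff (coeff (f + fconj h) 0) 0 = 0"
    if "f \<in> structure_ideal n a" "h \<in> structure_ideal n a" for f h
    using that by (simp add: coeff_fconj)
  have 2: "\<exists>f' h. f = f' + fconj h \<and> f' \<in> structure_ideal n a \<and> h \<in> structure_ideal n a"
    if f: "coeff (coeff f 0) 0 = 0" for f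
  proof -
    define B where "B = fconj (structure_gen n a)"
    define N where "N = reduce ?M B"
    have "B = - fmonom 1 1 0 + (\<Sum>k=2..n. fmonom (cnj (a k)) 0 (k - 1))"
      by (rule fpoly_eqI)
        (auto simp: B_def coeff_fconj structure_gen_def coeff_sum coeff_fmonom cnj_sum intro!: sum.cong)
    then have N: "N = - fps_X + (\<Sum>k=2..n. fps_const (cnj (a k)) * ?M ^ (k - 1))"
      by (simp add: N_def reduce_add reduce_diff reduce_minus reduce_sum reduce_fmonom)
    have pw: "(?M ^ i) $ m = 0" if "m < i" for i m
      using that startsby_zero_power_prefix[of ?M] by simp
    have N0: "N $ 0 = 0" using pw[of 0] by (auto simp: N fps_sum_nth intro!: sum.neutral)
    \<comment> \<open>In degree 1 only the first power of M contributes; together with the term -X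
      the linear coefficient of N is |\<mu>_2|^2 - 1.\<close>
    have "(fps_const (cnj (a k)) * ?M ^ (k - 1)) $ 1 = (if k = 2 then cnj (a 2) * a 2 else 0)"
      if "k \<in> {2..n}" for k
    proof (cases "k = 2")
      case True
      then show ?thesis using n by (simp add: structure_series_nth numeral_2_eq_2)
    next
      case False
      with that have "1 < k - 1" by auto
      with pw[of 1 "k - 1"] False show ?thesis by simp
    qed
    then have "N $ 1 = - 1 + (\<Sum>k=2..n. if k = 2 then cnj (a 2) * a 2 else 0)"
      unfolding N fps_add_nth fps_sum_nth by simp
    also have "\<dots> = - 1 + cnj (a 2) * a 2" using n by simp
    also have "\<dots> = complex_of_real ((cmod (a 2))\<^sup>2 - 1)"
      unfolding of_real_diff complex_norm_square by simp
    finally have N1: "N $ 1 = complex_of_real ((cmod (a 2))\<^sup>2 - 1)" .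
    have "(cmod (a 2))\<^sup>2 - 1 \<noteq> 0" using a by simp
    then have N1: "N $ 1 \<noteq> 0" unfolding N1 of_real_eq_0_iff .
    \<comment> \<open>The conjugate generator reduces to a unit times \<open>X\<close> because of \<open>|\<mu>\<^sub>2| < 1\<close>, so every
      polynomial vanishing at the origin is a multiple of it modulo the ideal.\<close>
    define R where "R = reduce ?M f"
    have R0: "R $ 0 = 0" using f by (simp add: R_def reduce_const_coeff)
    define G where "G = inverse (fps_shift 1 N) * fps_shift 1 R"
    have "fps_shift 1 N * G = fps_shift 1 R"
      using N1 unfolding G_def by (simp flip: mult.assoc add: inverse_mult_eq_1')
    moreover have "N = fps_X * fps_shift 1 N" "R = fps_X * fps_shift 1 R"
      using N0 R0 by (auto simp: fps_eq_iff)
    ultimately have NG: "N * G = R" by (metis mult.assoc)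
    \<comment> \<open>The quotient G is an infinite series; its truncation below degree n suffices
      because membership in the ideal sees only these degrees.\<close>
    define g where "g = (\<Sum>i<n. fmonom (G $ i) i 0)"
    have "f - B * g \<in> structure_ideal n a"
    proof -
      have "(N * reduce ?M g) $ m = (N * G) $ m" if "m < n" for m
        using that unfolding fps_mult_nth by (intro sum.cong) (auto simp: g_def reduce_trunc)
      then show ?thesis
        by (simp add: structure_ideal_iff reduce_diff reduce_mult N_def[symmetric] NG R_def[symmetric])
    qed
    moreover have "structure_gen n a * fconj g \<in> structure_ideal n a"
      by (simp add: structure_ideal_iff reduce_mult reduce_structure_gen)
    moreover have "fconj (structure_gen n a * fconj g) = B * g"
      by (simp add: fconj_mult fconj_fconj B_def)
    ultimately show ?thesis
      by (intro exI[of _ "f - B * g"] exI[of _ "structure_gen n a * fconj g"]) simp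
  qed
  show ?thesis unfolding ideal_gen_origin using 1 2 by blast
qed

section \<open>Change of coordinates\<close>

lemma coeff_fscale:
  "coeff (coeff (fscale a f) v) u =
   a ^ u * cnj a ^ v * coeff (coeff f v) u"
  by (simp add: fscale_def coeff_pcompose_linear coeff_map_poly poly_const_pow)

text \<open>The hypothesis says M(aX) = b N(X); taking j-th powers gives the claim.\<close>

lemma scaled_power:
  assumes "\<And>m. a ^ m * (M $ m) = b * (N $ m :: complex)"
  shows "a ^ m * ((M ^ j) $ m) = b ^ j * ((N ^ j) $ m :: complex)"
proof (induction j arbitrary: m)
  case 0 then show ?case by (cases m) auto
next
  case (Suc j)
  have "a ^ m * ((M ^ Suc j) $ m) = (\<Sum>i=0..m. (a ^ i * (M $ i)) * (a ^ (m - i) * ((M ^ j) $ (m - i))))"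
    by (auto simp: fps_mult_nth sum_distrib_left power_add[symmetric] intro!: sum.cong)
  also have "\<dots> = (\<Sum>i=0..m. (b * (N $ i)) * (b ^ j * ((N ^ j) $ (m - i))))"
    by (simp add: assms Suc)
  also have "\<dots> = b ^ Suc j * ((N ^ Suc j) $ m)"
    by (simp add: fps_mult_nth sum_distrib_left mult_ac)
  finally show ?case .
qed

text \<open>Rescaling p and p-bar and then substituting N is the same as substituting M and then
  rescaling p, provided M(aX) equals a-bar N(X).\<close>

lemma reduce_fscale:
  assumes "\<And>m. a ^ m * (M $ m) = cnj a * (N $ m)"
  shows "reduce N (fscale a f) $ m = a ^ m * (reduce M f $ m)"
proof -
  let ?d = "degree f"
  have "degree (fscale a f) \<le> ?d"
  proof (rule degree_le, intro allI impI poly_eqI)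
    fix v u assume "?d < v"
    then have "coeff f v = 0" by (rule coeff_eq_0)
    then show "coeff (coeff (fscale a f) v) u = coeff 0 u"
      by (simp add: coeff_fscale)
  qed
  then have "reduce N (fscale a f) $ m = (\<Sum>j\<le>?d. \<Sum>i=0..m.
     (a ^ i * cnj a ^ j * coeff (coeff f j) i) * ((N ^ j) $ (m - i)))"
    by (simp add: reduce_altdef fps_sum_nth fps_mult_nth coeff_fscale)
  also have "\<dots> = (\<Sum>j\<le>?d. \<Sum>i=0..m.
     a ^ m * (coeff (coeff f j) i * ((M ^ j) $ (m - i))))"
  proof (intro sum.cong refl)
    fix j i assume "i \<in> {0..m}"
    then have "a ^ m = a ^ i * a ^ (m - i)" by (simp flip: power_add)
    then show "(a ^ i * cnj a ^ j * coeff (coeff f j) i) * ((N ^ j) $ (m - i)) =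
      a ^ m * (coeff (coeff f j) i * ((M ^ j) $ (m - i)))"
      using scaled_power[of a M "cnj a" N "m - i" j, OF assms] by simp
  qed
  also have "\<dots> = a ^ m * (reduce M f $ m)"
    by (simp add: reduce_altdef[OF order_refl] fps_sum_nth fps_mult_nth sum_distrib_left)
  finally show ?thesis .
qed

lemma structure_series_scale:
  assumes "\<And>k. k \<in> {2..n} \<Longrightarrow> a ^ (k - 1) * c k = cnj a * d k"
  shows "a ^ m * (structure_series n c $ m) = cnj a * (structure_series n d $ m)"
  using assms[of "m + 1"] by (auto simp: structure_series_nth)

text \<open>With a the derivative of a transition map, the right-hand side is the transformation law
  of a section of K^(1-k) tensor K-bar. For the converse direction the second generator is
  transported; the coefficient of p^(k-1) in its reduction is the law for k.\<close>

lemma structure_ideal_fscale_iff: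
  assumes a: "a \<noteq> 0"
  shows "(\<forall>f. f \<in> structure_ideal n c \<longleftrightarrow> fscale a f \<in> structure_ideal n d) \<longleftrightarrow>
    (\<forall>k\<in>{2..n}. a ^ (k - 1) * c k = cnj a * d k)" (is "?L \<longleftrightarrow> ?R")
proof
  assume ?R
  then have "reduce (structure_series n d) (fscale a f) $ m = a ^ m * (reduce (structure_series n c) f $ m)" for f m
    by (intro reduce_fscale structure_series_scale) auto
  then show ?L using a by (simp add: structure_ideal_iff)
next
  assume L: ?L
  have "structure_gen n c \<in> structure_ideal n c"
    by (simp add: structure_ideal_iff reduce_structure_gen)
  with L have *: "fscale a (structure_gen n c) \<in> structure_ideal n d" by blast
  have "fscale a (structure_gen n c) = - fmonom (cnj a) 0 1 + (\<Sum>k=2..n. fmonom (a ^ (k - 1) * c k) (k - 1) 0)"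
    by (rule fpoly_eqI)
      (auto simp: coeff_fscale structure_gen_def coeff_sum coeff_fmonom sum_distrib_left intro!: sum.cong)
  then have r: "reduce (structure_series n d) (fscale a (structure_gen n c)) =
      - (fps_const (cnj a) * structure_series n d) +
      (\<Sum>k=2..n. fps_const (a ^ (k - 1) * c k) * fps_X ^ (k - 1))"
    by (simp add: reduce_add reduce_diff reduce_minus reduce_sum reduce_fmonom)
  show ?R
  proof
    fix k assume k: "k \<in> {2..n}"
    have "(\<Sum>i=2..n. fps_const (a ^ (i - 1) * c i) * fps_X ^ (i - 1)) $ (k - 1) =
          (\<Sum>i=2..n. if i = k then a ^ (i - 1) * c i else 0)"
      unfolding fps_sum_nth using k by (intro sum.cong) (auto simp: fps_X_power_nth)
    also have "\<dots> = a ^ (k - 1) * c k" using k by simp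
    finally have "reduce (structure_series n d) (fscale a (structure_gen n c)) $ (k - 1) =
        - (cnj a * d k) + a ^ (k - 1) * c k"
      using k by (subst r) (auto simp: structure_series_nth)
    moreover have "k - 1 < n" using k by auto
    ultimately show "a ^ (k - 1) * c k = cnj a * d k"
      using * by (simp add: structure_ideal_iff)
  qed
qed

section \<open>Charts\<close>

locale riemann_surface =
  fixes X :: "'a topology" and A :: "'a chart set"
  assumes hausdorff: "Hausdorff_space X" and compact_X: "compact_space X"
    and atlas: "holomorphic_atlas X A"
begin

lemma openin_chart: "c \<in> A \<Longrightarrow> openin X (fst c)"
  and open_chart_image: "c \<in> A \<Longrightarrow> open (chart_image c)"
  and chart_homeo: "c \<in> A \<Longrightarrow>
     homeomorphic_map (subtopology X (fst c)) (top_of_set (chart_image c)) (snd c)"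
  and charts_cover: "(\<Union>c\<in>A. fst c) = topspace X"
  and transition_holomorphic: "c \<in> A \<Longrightarrow> d \<in> A \<Longrightarrow> transition c d holomorphic_on overlap c d"
  using atlas unfolding holomorphic_atlas_def by blast+

lemma topspace_chart: "c \<in> A \<Longrightarrow> topspace (subtopology X (fst c)) = fst c"
  by (rule topspace_subtopology_subset) (rule openin_subset[OF openin_chart])

lemma chart_inj: "c \<in> A \<Longrightarrow> inj_on (snd c) (fst c)"
  using homeomorphic_imp_injective_map[OF chart_homeo, of c] topspace_chart[of c] by simp

lemma chart_point_in: "z \<in> chart_image c \<Longrightarrow> chart_point c z \<in> fst c"
  and snd_chart_point: "z \<in> chart_image c \<Longrightarrow> snd c (chart_point c z) = z"
  unfolding chart_point_def chart_image_def by (rule inv_into_into, assumption) (rule f_inv_into_f, assumption)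

lemma chart_point_snd: "c \<in> A \<Longrightarrow> x \<in> fst c \<Longrightarrow> chart_point c (snd c x) = x"
  unfolding chart_point_def by (simp add: chart_inj)

lemma snd_in_chart_image: "x \<in> fst c \<Longrightarrow> snd c x \<in> chart_image c"
  unfolding chart_image_def by auto

lemma overlap_iff: "c \<in> A \<Longrightarrow> z \<in> overlap c d \<longleftrightarrow> z \<in> chart_image c \<and> chart_point c z \<in> fst d"
proof
  assume "z \<in> overlap c d" and c: "c \<in> A"
  then obtain x where "x \<in> fst c" "x \<in> fst d" "z = snd c x" unfolding overlap_def by blast
  then show "z \<in> chart_image c \<and> chart_point c z \<in> fst d"
    using c by (simp add: chart_point_snd snd_in_chart_image)
next
  assume z: "z \<in> chart_image c \<and> chart_point c z \<in> fst d"
  then have "z = snd c (chart_point c z)" "chart_point c z \<in> fst c \<inter> fst d"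
    by (simp_all add: snd_chart_point chart_point_in)
  then show "z \<in> overlap c d" unfolding overlap_def by (rule image_eqI)
qed

lemma overlap_self: "overlap c c = chart_image c"
  by (simp add: overlap_def chart_image_def)

lemma overlap_subset: "overlap c d \<subseteq> chart_image c"
  by (auto simp: overlap_def chart_image_def)

lemma overlapD: "z \<in> overlap c d \<Longrightarrow> z \<in> chart_image c"
  using overlap_subset by blast

text \<open>Transfers openness from the abstract surface to the plane, using that a chart is an open
  map onto its image.\<close>

lemma open_preimage:
  assumes "c \<in> A" "openin X V"
  shows "open {z \<in> chart_image c. chart_point c z \<in> V}"
proof -
  have V: "openin (subtopology X (fst c)) (V \<inter> fst c)"
    using assms(2) unfolding openin_subtopology by blast
  then have "openin (top_of_set (chart_image c)) (snd c ` (V \<inter> fst c))"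
    using homeomorphic_map_openness[OF chart_homeo[OF assms(1)] openin_subset[OF V]] by simp
  then have "open (snd c ` (V \<inter> fst c))"
    using open_chart_image[OF assms(1)] openin_open_trans by blast
  also have "snd c ` (V \<inter> fst c) = {z \<in> chart_image c. chart_point c z \<in> V}"
  proof (intro equalityI subsetI)
    fix z assume "z \<in> snd c ` (V \<inter> fst c)"
    then obtain x where "x \<in> V" "x \<in> fst c" "z = snd c x" by blast
    then show "z \<in> {z \<in> chart_image c. chart_point c z \<in> V}"
      using assms(1) by (simp add: chart_point_snd snd_in_chart_image)
  next
    fix z assume z: "z \<in> {z \<in> chart_image c. chart_point c z \<in> V}"
    then have "z = snd c (chart_point c z)" "chart_point c z \<in> V \<inter> fst c"
      by (simp_all add: snd_chart_point chart_point_in)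
    then show "z \<in> snd c ` (V \<inter> fst c)" by (rule image_eqI)
  qed
  finally show ?thesis .
qed

lemma open_overlap: "c \<in> A \<Longrightarrow> d \<in> A \<Longrightarrow> open (overlap c d)"
proof -
  assume "c \<in> A" "d \<in> A"
  moreover have "overlap c d = {z \<in> chart_image c. chart_point c z \<in> fst d}"
    using overlap_iff[OF \<open>c \<in> A\<close>] by blast
  ultimately show ?thesis using open_preimage[of c "fst d"] openin_chart[of d] by simp
qed

text \<open>Here the Hausdorff property enters: a compact subset of one chart is closed in the whole
  surface, so functions supported in it extend by zero.\<close>

lemma closedin_chart_compact:
  assumes c: "c \<in> A" and K: "compact K" "K \<subseteq> chart_image c"
  shows "closedin X (chart_point c ` K)"
proof -
  have "compactin (top_of_set (chart_image c)) K"
    using K by (simp add: compactin_subtopology)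
  moreover have "continuous_map (top_of_set (chart_image c)) X (chart_point c)"
    unfolding continuous_map
  proof (intro conjI allI impI)
    show "chart_point c ` topspace (top_of_set (chart_image c)) \<subseteq> topspace X"
      using chart_point_in[of _ c] openin_subset[OF openin_chart[OF c]] by auto
    fix V assume "openin X V"
    from open_preimage[OF c this]
    show "openin (top_of_set (chart_image c)) {x \<in> topspace (top_of_set (chart_image c)). chart_point c x \<in> V}"
      by (simp add: open_subset)
  qed
  ultimately have "compactin X (chart_point c ` K)" by (rule image_compactin)
  then show ?thesis using hausdorff compactin_imp_closedin by blast
qed

text \<open>The region, seen in the chart d, where a function supported in K vanishes.\<close>

lemma open_avoid_compact:
  assumes "c \<in> A" "compact K" "K \<subseteq> chart_image c" "d \<in> A"
  shows "open {z \<in> chart_image d. chart_point d z \<notin> chart_point c ` K}"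
proof -
  have o: "openin X (topspace X - chart_point c ` K)"
    by (rule openin_diff[OF openin_topspace closedin_chart_compact[OF assms(1-3)]])
  have "chart_point d z \<in> topspace X" if "z \<in> chart_image d" for z
    using chart_point_in[OF that] openin_subset[OF openin_chart[OF assms(4)]] by auto
  then have "{z \<in> chart_image d. chart_point d z \<in> topspace X - chart_point c ` K} =
      {z \<in> chart_image d. chart_point d z \<notin> chart_point c ` K}" by auto
  with open_preimage[OF assms(4) o] show ?thesis by simp
qed

lemma in_chart_point_image_iff:
  assumes "c \<in> A" "K \<subseteq> chart_image c"
  shows "x \<in> chart_point c ` K \<longleftrightarrow> x \<in> fst c \<and> snd c x \<in> K"
proof
  assume "x \<in> chart_point c ` K"
  then obtain z where "z \<in> K" "x = chart_point c z" by blast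
  moreover from this have "z \<in> chart_image c" using assms(2) by auto
  ultimately show "x \<in> fst c \<and> snd c x \<in> K" by (simp add: chart_point_in snd_chart_point)
next
  assume "x \<in> fst c \<and> snd c x \<in> K"
  then show "x \<in> chart_point c ` K" by (intro image_eqI[where x="snd c x"]) (simp_all add: chart_point_snd[OF assms(1)])
qed

section \<open>Transition maps and the cocycle identity of their derivatives\<close>

lemma transition_in: "c \<in> A \<Longrightarrow> d \<in> A \<Longrightarrow> z \<in> overlap c d \<Longrightarrow> transition c d z \<in> overlap d c"
  and chart_point_transition: "c \<in> A \<Longrightarrow> d \<in> A \<Longrightarrow> z \<in> overlap c d \<Longrightarrow> chart_point d (transition c d z) = chart_point c z"
  and transition_transition: "c \<in> A \<Longrightarrow> d \<in> A \<Longrightarrow> z \<in> overlap c d \<Longrightarrow> transition d c (transition c d z) = z"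
  by (auto simp: overlap_iff transition_def chart_point_snd chart_point_in snd_in_chart_image snd_chart_point)

lemma transition_image: "c \<in> A \<Longrightarrow> d \<in> A \<Longrightarrow> transition c d ` overlap c d = overlap d c"
proof -
  assume cd: "c \<in> A" "d \<in> A"
  have "w \<in> transition c d ` overlap c d" if "w \<in> overlap d c" for w
    by (rule image_eqI[where x="transition d c w"])
      (simp_all add: transition_in[OF cd(2,1) that] transition_transition[OF cd(2,1) that])
  then show ?thesis using transition_in[OF cd] by blast
qed

lemma transition_inj: "c \<in> A \<Longrightarrow> d \<in> A \<Longrightarrow> inj_on (transition c d) (overlap c d)"
  by (rule inj_on_inverseI[where g="transition d c"]) (rule transition_transition)

lemma transition_self: "c \<in> A \<Longrightarrow> z \<in> chart_image c \<Longrightarrow> transition c c z = z"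
  by (simp add: transition_def snd_chart_point)

lemma transition_has_derivative:
  "c \<in> A \<Longrightarrow> d \<in> A \<Longrightarrow> z \<in> overlap c d \<Longrightarrow>
   (transition c d has_field_derivative deriv (transition c d) z) (at z)"
  using holomorphic_derivI[OF transition_holomorphic open_overlap] by blast

lemma overlap3:
  "c \<in> A \<Longrightarrow> d \<in> A \<Longrightarrow> e \<in> A \<Longrightarrow> z \<in> overlap c d \<Longrightarrow> z \<in> overlap c e \<Longrightarrow> transition c d z \<in> overlap d e"
  using transition_in[of c d z] chart_point_transition[of c d z] by (simp add: overlap_iff)

lemma transition_cocycle:
  "c \<in> A \<Longrightarrow> d \<in> A \<Longrightarrow> z \<in> overlap c d \<Longrightarrow> transition d e (transition c d z) = transition c e z"
  by (simp add: transition_def[of d e] transition_def[of c e] chart_point_transition)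

lemma deriv_transition_cocycle:
  assumes "c \<in> A" "d \<in> A" "e \<in> A" "z \<in> overlap c d" "z \<in> overlap c e"
  shows "deriv (transition c e) z = deriv (transition d e) (transition c d z) * deriv (transition c d) z"
proof -
  have "((\<lambda>w. transition d e (transition c d w)) has_field_derivative
      deriv (transition d e) (transition c d z) * deriv (transition c d) z) (at z)"
    by (rule DERIV_chain2[OF transition_has_derivative[OF assms(2,3) overlap3[OF assms]]
          transition_has_derivative[OF assms(1,2,4)]])
  then have "(transition c e has_field_derivative
      deriv (transition d e) (transition c d z) * deriv (transition c d) z) (at z)"
    by (rule has_field_derivative_transform_within_open[OF _ open_overlap[OF assms(1,2)] assms(4)])
       (simp add: transition_cocycle assms)
  then show ?thesis by (rule DERIV_imp_deriv)
qed

lemma deriv_transition_self: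
  assumes "c \<in> A" "z \<in> chart_image c" shows "deriv (transition c c) z = 1"
proof (rule DERIV_imp_deriv)
  show "(transition c c has_field_derivative 1) (at z)"
    by (rule has_field_derivative_transform_within_open[OF DERIV_ident open_chart_image[OF assms(1)] assms(2)])
       (simp add: transition_self assms)
qed

lemma deriv_transition_inverse:
  assumes "c \<in> A" "d \<in> A" "z \<in> overlap c d"
  shows "deriv (transition d c) (transition c d z) * deriv (transition c d) z = 1"
  using deriv_transition_cocycle[of c d c z] deriv_transition_self[of c z] assms overlapD[OF assms(3)]
  by (simp add: overlap_self)

lemma deriv_transition_nz: "c \<in> A \<Longrightarrow> d \<in> A \<Longrightarrow> z \<in> overlap c d \<Longrightarrow> deriv (transition c d) z \<noteq> 0"
  using deriv_transition_inverse[of c d z] by auto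

lemma smooth_transition: "c \<in> A \<Longrightarrow> d \<in> A \<Longrightarrow> smooth_on (overlap c d) (transition c d)"
  by (auto intro!: holomorphic_imp_smooth_on open_overlap transition_holomorphic)

section \<open>Compatible structures in coordinates\<close>

text \<open>Clears the negative exponent of type (1-k,1), giving the form in which the ideals yield
  the law.\<close>

lemma powi_differential:
  assumes "k \<ge> 1" "a \<noteq> 0"
  shows "x = y * a powi (1 - int k) * cnj a powi 1 \<longleftrightarrow> a ^ (k - 1) * x = cnj a * y"
proof -
  have "1 - int k = - int (k - 1)" using assms by simp
  then have "a powi (1 - int k) = inverse (a ^ (k - 1))" by (simp only: power_int_minus power_int_of_nat)
  moreover have "x = y * inverse b * c \<longleftrightarrow> b * x = c * y" if "b \<noteq> 0" for b c :: complex
    using that by (auto simp: field_simps)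
  ultimately show ?thesis using assms(2) by simp
qed

text \<open>Each ideal lies in \<open>Hilb0 n\<close> by its shape, the section property becomes the
  transformation law, and the bound on \<mu>_2 supplies the conjugation condition.\<close>

lemma compatible_iff:
  assumes n: "n \<ge> 2"
  shows "compatible A n \<mu> \<longleftrightarrow> \<mu> \<in> (\<Pi>\<^sub>E k\<in>{2..n}. differentials A (1 - int k) 1) \<and>
    (\<forall>c\<in>A. \<forall>z\<in>chart_image c. (cmod (\<mu> 2 c z))\<^sup>2 < 1)"
proof -
  have eq: "(\<forall>f. f \<in> structure_of n \<mu> c z \<longleftrightarrow>
        fscale (deriv (transition c d) z) f \<in> structure_of n \<mu> d (transition c d z)) \<longleftrightarrow>
      (\<forall>k\<in>{2..n}. \<mu> k c z = \<mu> k d (transition c d z) * deriv (transition c d) z powi (1 - int k)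
          * cnj (deriv (transition c d) z) powi 1)" if "c \<in> A" "d \<in> A" "z \<in> overlap c d" for c d z
    unfolding structure_of_eq structure_ideal_fscale_iff[OF deriv_transition_nz[OF that]]
  proof (rule ball_cong[OF refl])
    fix k assume "k \<in> {2..n}"
    then show "deriv (transition c d) z ^ (k - 1) * \<mu> k c z = cnj (deriv (transition c d) z) * \<mu> k d (transition c d z) \<longleftrightarrow>
        \<mu> k c z = \<mu> k d (transition c d z) * deriv (transition c d) z powi (1 - int k)
          * cnj (deriv (transition c d) z) powi 1"
      using powi_differential[of k, OF _ deriv_transition_nz[OF that]] by auto
  qed
  have hs: "Hilb_section A n (structure_of n \<mu>) \<longleftrightarrow> (\<forall>c\<in>A. \<forall>d\<in>A. \<forall>z\<in>overlap c d. \<forall>k\<in>{2..n}.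
       \<mu> k c z = \<mu> k d (transition c d z) * deriv (transition c d) z powi (1 - int k)
          * cnj (deriv (transition c d) z) powi 1)"
  proof -
    have "\<forall>c\<in>A. \<forall>z\<in>chart_image c. structure_of n \<mu> c z \<in> Hilb0 n"
      using n by (simp add: structure_of_eq structure_ideal_Hilb0)
    then show ?thesis unfolding Hilb_section_def
      by (simp only: eq simp_thms ball_triv cong: ball_cong)
  qed
  have conj: "\<forall>c\<in>A. \<forall>z\<in>chart_image c. {f + fconj h | f h. f \<in> structure_of n \<mu> c z \<and> h \<in> structure_of n \<mu> c z} =
      ideal_gen {fmonom 1 1 0, fmonom 1 0 1}"
    if "\<forall>c\<in>A. \<forall>z\<in>chart_image c. (cmod (\<mu> 2 c z))\<^sup>2 < 1"
    using that by (simp add: structure_of_eq structure_ideal_conj[OF n])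
  have pi: "\<mu> \<in> (\<Pi>\<^sub>E k\<in>{2..n}. differentials A (1 - int k) 1) \<longleftrightarrow>
      \<mu> \<in> {2..n} \<rightarrow>\<^sub>E Collect (smooth_family A) \<and>
      (\<forall>c\<in>A. \<forall>d\<in>A. \<forall>z\<in>overlap c d. \<forall>k\<in>{2..n}.
       \<mu> k c z = \<mu> k d (transition c d z) * deriv (transition c d) z powi (1 - int k)
          * cnj (deriv (transition c d) z) powi 1)"
    unfolding differentials_def PiE_iff mem_Collect_eq by metis
  show ?thesis
  proof (cases "\<forall>c\<in>A. \<forall>z\<in>chart_image c. (cmod (\<mu> 2 c z))\<^sup>2 < 1")
    case True
    show ?thesis unfolding compatible_def n_complex_structure_def hs pi
      using conj[OF True] True by argo
  next
    case False
    then show ?thesis unfolding compatible_def by argo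
  qed
qed

end

section \<open>Bump functions\<close>

text \<open>These functions contain \<open>exp (-1/x)\<close> and their span is closed under differentiation.\<close>

definition flat_exp :: "nat \<Rightarrow> real \<Rightarrow> real" where
  "flat_exp k x = (if x > 0 then exp (- inverse x) * inverse x ^ k else 0)"

text \<open>With y = 1/x this says that exp y outgrows y^k.\<close>

lemma flat_exp_tendsto_0: "(flat_exp k \<longlongrightarrow> 0) (at_right 0)"
proof -
  have "((\<lambda>x::real. inverse x ^ k / exp (inverse x)) \<longlongrightarrow> 0) (at_right 0)"
    by (rule filterlim_compose[OF tendsto_power_div_exp_0 filterlim_inverse_at_top_right])
  then show ?thesis
  proof (rule Lim_transform_eventually)
    show "\<forall>\<^sub>F x in at_right 0. inverse x ^ k / exp (inverse x) = flat_exp k x"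
      unfolding eventually_at_right_field
      by (intro exI[of _ 1]) (simp add: flat_exp_def exp_minus field_simps)
  qed
qed

lemma flat_exp_DERIV: "(flat_exp k has_real_derivative flat_exp (k + 2) x - real k * flat_exp (k + 1) x) (at x)"
proof -
  consider "x > 0" | "x < 0" | "x = 0" by linarith
  then show ?thesis
  proof cases
    case 1
    have i: "(inverse has_real_derivative - (inverse x * inverse x)) (at x)"
      using DERIV_inverse[of x UNIV] 1 by (simp add: power2_eq_square)
    have e: "((\<lambda>x. exp (- inverse x)) has_real_derivative exp (- inverse x) * - (- (inverse x * inverse x))) (at x)"
      by (rule DERIV_fun_exp[OF DERIV_minus[OF i]])
    have "((\<lambda>x. exp (- inverse x) * inverse x ^ k) has_real_derivative
        flat_exp (k + 2) x - real k * flat_exp (k + 1) x) (at x)"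
      by (rule DERIV_cong[OF DERIV_mult[OF e DERIV_power[OF i]]], cases k)
        (use 1 in \<open>simp_all add: flat_exp_def power2_eq_square algebra_simps\<close>)
    then show ?thesis
      by (rule has_field_derivative_transform_within_open[of _ _ _ "{0<..}"]) (use 1 in \<open>auto simp: flat_exp_def\<close>)
  next
    case 2
    have "((\<lambda>_. 0) has_real_derivative 0) (at x)" by simp
    then have "(flat_exp k has_real_derivative 0) (at x)"
      by (rule has_field_derivative_transform_within_open[of _ _ _ "{..<0}"]) (use 2 in \<open>auto simp: flat_exp_def\<close>)
    then show ?thesis using 2 by (simp add: flat_exp_def)
  next
    case 3
    have l: "((\<lambda>h. (flat_exp k (0 + h) - flat_exp k 0) / h) \<longlongrightarrow> 0) (at_left 0)"
    proof (rule tendsto_eventually)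
      show "\<forall>\<^sub>F h in at_left 0. (flat_exp k (0 + h) - flat_exp k 0) / h = 0"
        unfolding eventually_at_left_field by (intro exI[of _ "-1"]) (auto simp: flat_exp_def)
    qed
    \<comment> \<open>From the right the difference quotient at 0 is
      \<open>flat_exp (Suc k)\<close>, whose limit is already known.\<close>
    have r: "((\<lambda>h. (flat_exp k (0 + h) - flat_exp k 0) / h) \<longlongrightarrow> 0) (at_right 0)"
      using flat_exp_tendsto_0[of "Suc k"]
    proof (rule Lim_transform_eventually)
      show "\<forall>\<^sub>F h in at_right 0. flat_exp (Suc k) h = (flat_exp k (0 + h) - flat_exp k 0) / h"
        unfolding eventually_at_right_field
        by (intro exI[of _ 1]) (auto simp: flat_exp_def field_simps)
    qed
    have "(flat_exp k has_real_derivative 0) (at 0)"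
      unfolding DERIV_def using filterlim_split_at[OF l r] .
    then show ?thesis using 3 by (simp add: flat_exp_def)
  qed
qed

text \<open>The derivative raises the index k, so the induction on the order runs for all k at
  once.\<close>

lemma smooth_flat_exp: "smooth_on UNIV (flat_exp k)"
proof -
  have fd: "frechet_derivative (flat_exp k) (at x) v = v * (flat_exp (k + 2) x + (- real k) * flat_exp (k + 1) x)" for k x v
    using frechet_eqI[OF flat_exp_DERIV[unfolded has_field_derivative_def]] by (simp add: mult.commute)
  have "times_differentiable_on m UNIV (flat_exp k)" for m
  proof (induction m arbitrary: k)
    case 0 show ?case
      unfolding times_differentiable_on.simps
      by (intro continuous_at_imp_continuous_on ballI DERIV_isCont[OF flat_exp_DERIV])
  next
    case (Suc m)
    have "times_differentiable_on m UNIV (\<lambda>x. v * (flat_exp (k + 2) x + (- real k) * flat_exp (k + 1) x))" for v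
      by (intro times_differentiable_on_bilinear[OF open_UNIV bounded_bilinear_mult]
          times_differentiable_on_add[OF open_UNIV] times_differentiable_on_const Suc)
    then show ?case
      using flat_exp_DERIV real_differentiable_def real_differentiableE
      by (auto simp: fd differentiable_def has_field_derivative_def)
  qed
  then show ?thesis by (simp add: smooth_on_def)
qed

text \<open>The squared distance keeps the function smooth at the centre; the argument is positive
  exactly on the open ball.\<close>

definition bump :: "complex \<Rightarrow> real \<Rightarrow> complex \<Rightarrow> real" where
  "bump a r z = flat_exp 0 (r\<^sup>2 - (cmod (z - a))\<^sup>2)"

lemma smooth_bump: "smooth_on UNIV (bump a r)"
proof -
  have "smooth_on UNIV (\<lambda>z. r\<^sup>2 - ((Re (z - a))\<^sup>2 + (Im (z - a))\<^sup>2))"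
    by (intro smooth_on_diff smooth_on_add smooth_on_power smooth_on_const smooth_on_Re smooth_on_Im
        smooth_on_ident open_UNIV)
  then show ?thesis unfolding bump_def[abs_def] cmod_power2
    by (intro smooth_on_compose[OF smooth_flat_exp]) auto
qed

lemma bump_nonneg: "bump a r z \<ge> 0"
  by (simp add: bump_def flat_exp_def)

lemma bump_pos_iff: "r > 0 \<Longrightarrow> bump a r z > 0 \<longleftrightarrow> z \<in> ball a r"
  by (auto simp: bump_def flat_exp_def dist_norm norm_minus_commute intro: power_strict_mono power_less_imp_less_base)

lemma bump_nonzero: "r > 0 \<Longrightarrow> bump a r z \<noteq> 0 \<Longrightarrow> z \<in> ball a r"
  using bump_nonneg[of a r z] bump_pos_iff[of r a z] by linarith

section \<open>Partitions of unity\<close>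

context riemann_surface begin

definition extend :: "'a chart \<Rightarrow> (complex \<Rightarrow> 'b::zero) \<Rightarrow> 'a \<Rightarrow> 'b" where
  "extend c f x = (if x \<in> fst c then f (snd c x) else 0)"

text \<open>Near a point of the chart c the extension is a pull-back by a transition map. A point
  outside that chart has a neighbourhood missing the closed image of S, where the extension
  vanishes.\<close>

lemma smooth_extend:
  fixes f :: "complex \<Rightarrow> 'b::real_normed_vector"
  assumes c: "c \<in> A" and d: "d \<in> A" and f: "smooth_on (chart_image c) f"
    and S: "compact S" "S \<subseteq> chart_image c" "\<And>z. z \<in> chart_image c \<Longrightarrow> f z \<noteq> 0 \<Longrightarrow> z \<in> S"
  shows "smooth_on (chart_image d) (\<lambda>z. extend c f (chart_point d z))"
proof (rule smooth_on_local)
  fix z assume z: "z \<in> chart_image d"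
  show "\<exists>U. open U \<and> z \<in> U \<and> smooth_on U (\<lambda>z. extend c f (chart_point d z))"
  proof (cases "chart_point d z \<in> fst c")
    case True
    have sm: "smooth_on (overlap d c) (\<lambda>z. f (transition d c z))"
      using transition_in[OF d c] overlapD[of _ c d]
      by (intro smooth_on_compose[OF f smooth_transition[OF d c] open_overlap[OF d c] open_chart_image[OF c]]) auto
    moreover have "extend c f (chart_point d w) = f (transition d c w)" if "w \<in> overlap d c" for w
      using that by (simp add: overlap_iff[OF d] extend_def transition_def)
    ultimately have "smooth_on (overlap d c) (\<lambda>z. extend c f (chart_point d z))"
      by (subst smooth_on_cong[OF open_overlap[OF d c]]) auto
    then show ?thesis using z True by (intro exI[of _ "overlap d c"]) (simp add: open_overlap d c overlap_iff)
  next
    case False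
    let ?U = "{z \<in> chart_image d. chart_point d z \<notin> chart_point c ` S}"
    have o: "open ?U" by (rule open_avoid_compact[OF c S(1,2) d])
    have "extend c f (chart_point d w) = 0" if "w \<in> ?U" for w
    proof (cases "chart_point d w \<in> fst c")
      case True
      with that have "snd c (chart_point d w) \<notin> S"
        by (simp add: in_chart_point_image_iff[OF c S(2)])
      then show ?thesis using S(3) snd_in_chart_image[OF True] by (auto simp: extend_def)
    qed (simp add: extend_def)
    then have "smooth_on ?U (\<lambda>z. extend c f (chart_point d z))"
      using o by (intro smooth_on_eq_const)
    moreover have "z \<in> ?U" using z False by (simp add: in_chart_point_image_iff[OF c S(2)])
    ultimately show ?thesis using o by blast
  qed
qed

lemma open_chart_ball:
  assumes c: "c \<in> A" and b: "open B" "B \<subseteq> chart_image c"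
  shows "openin X {y \<in> fst c. snd c y \<in> B}"
proof -
  have "continuous_map (subtopology X (fst c)) (top_of_set (chart_image c)) (snd c)"
    using chart_homeo[OF c] by (rule homeomorphic_imp_continuous_map)
  moreover have "openin (top_of_set (chart_image c)) B" using b by (simp add: open_subset)
  ultimately have "openin (subtopology X (fst c)) {y \<in> topspace (subtopology X (fst c)). snd c y \<in> B}"
    by (rule openin_continuous_map_preimage)
  then have "openin (subtopology X (fst c)) {y \<in> fst c. snd c y \<in> B}"
    unfolding topspace_chart[OF c] .
  then show ?thesis by (rule openin_trans_full[OF _ openin_chart[OF c]])
qed

text \<open>Compactness yields finitely many coordinate balls covering the surface; their bump
  functions have a positive sum, by which they are divided.\<close>

lemma partition_of_unity_exists: "\<exists>F \<rho>. partition_of_unity A F \<rho>"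
proof -
  have "\<forall>x\<in>topspace X. \<exists>c r. c \<in> A \<and> x \<in> fst c \<and> r > 0 \<and> cball (snd c x) r \<subseteq> chart_image c"
  proof
    fix x assume "x \<in> topspace X"
    then obtain c where c: "c \<in> A" "x \<in> fst c" using charts_cover by blast
    then obtain r where "r > 0" "cball (snd c x) r \<subseteq> chart_image c"
      using open_contains_cball[THEN iffD1, OF open_chart_image[OF c(1)]] snd_in_chart_image[OF c(2)] by blast
    with c show "\<exists>c r. c \<in> A \<and> x \<in> fst c \<and> r > 0 \<and> cball (snd c x) r \<subseteq> chart_image c" by blast
  qed
  then obtain C R where CR: "\<And>x. x \<in> topspace X \<Longrightarrow> C x \<in> A \<and> x \<in> fst (C x) \<and> R x > 0 \<and>
      cball (snd (C x) x) (R x) \<subseteq> chart_image (C x)"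
    by (simp only: bchoice_iff) metis
  define V where "V = (\<lambda>x. {y \<in> fst (C x). snd (C x) y \<in> ball (snd (C x) x) (R x)})"
  have V: "openin X (V x)" "x \<in> V x" if "x \<in> topspace X" for x
  proof -
    have "ball (snd (C x) x) (R x) \<subseteq> chart_image (C x)" using CR[OF that] ball_subset_cball by blast
    then show "openin X (V x)" unfolding V_def using CR[OF that] by (intro open_chart_ball) auto
    show "x \<in> V x" using CR[OF that] by (simp add: V_def)
  qed
  have "\<exists>\<F>. finite \<F> \<and> \<F> \<subseteq> V ` topspace X \<and> topspace X \<subseteq> \<Union>\<F>"
    using compact_X V unfolding compact_space_alt by (elim allE[of _ "V ` topspace X"]) blast
  then obtain T where T: "finite T" "T \<subseteq> topspace X" "topspace X \<subseteq> (\<Union>x\<in>T. V x)"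
    by (metis finite_subset_image)
  define b where "b = (\<lambda>x. extend (C x) (bump (snd (C x) x) (R x)))"
  have CRT: "C x \<in> A" "x \<in> fst (C x)" "R x > 0" "cball (snd (C x) x) (R x) \<subseteq> chart_image (C x)" if "x \<in> T" for x
    using CR[of x] T that by auto
  have b_nonneg: "b x y \<ge> 0" for x y by (simp add: b_def extend_def bump_nonneg)
  have b_nz: "y \<in> fst (C x) \<and> snd (C x) y \<in> cball (snd (C x) x) (R x)" if "x \<in> T" "b x y \<noteq> 0" for x y
    using that bump_nonzero[OF CRT(3)[OF that(1)]] unfolding b_def extend_def
    by (auto split: if_splits simp: less_imp_le)
  have b_pos: "b x y > 0" if "x \<in> T" "y \<in> V x" for x y
    using that bump_pos_iff[OF CRT(3)[OF that(1)]] by (simp add: b_def extend_def V_def)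
  have b_smooth: "smooth_on (chart_image d) (\<lambda>z. b x (chart_point d z))" if "x \<in> T" "d \<in> A" for x d
    unfolding b_def
  proof (rule smooth_extend[OF CRT(1)[OF that(1)] that(2) _ compact_cball CRT(4)[OF that(1)]])
    show "smooth_on (chart_image (C x)) (bump (snd (C x) x) (R x))"
      by (rule smooth_on_subset[OF smooth_bump]) simp
    show "z \<in> cball (snd (C x) x) (R x)" if "bump (snd (C x) x) (R x) z \<noteq> 0" for z
      using bump_nonzero[OF CRT(3)[OF \<open>x \<in> T\<close>] that] by (simp add: less_imp_le)
  qed
  define tot where "tot = (\<lambda>y. \<Sum>x\<in>T. b x y)"
  have tot_pos: "tot y > 0" if y: "y \<in> topspace X" for y
  proof -
    obtain x where x: "x \<in> T" "y \<in> V x" using T(3) y by blast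
    show ?thesis unfolding tot_def
      by (rule sum_pos2[where i=x]) (use T(1) x(1) b_pos[OF x] b_nonneg in auto)
  qed
  \<comment> \<open>Functions are indexed by charts and several balls may share one chart, so the
    bumps of equal chart are added up.\<close>
  define \<rho> where "\<rho> = (\<lambda>c y. (\<Sum>x\<in>{x\<in>T. C x = c}. b x y) * inverse (tot y))"
  have tot_nonneg: "tot y \<ge> 0" for y unfolding tot_def by (simp add: sum_nonneg b_nonneg)
  have chart_top: "chart_point d z \<in> topspace X" if "d \<in> A" "z \<in> chart_image d" for d z
    using chart_point_in[OF that(2)] openin_subset[OF openin_chart[OF that(1)]] by auto
  have "partition_of_unity A (C ` T) \<rho>"
    unfolding partition_of_unity_def
  proof (intro conjI ballI allI)
    show "finite (C ` T)" "C ` T \<subseteq> A" using T CRT by auto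
  next
    fix c x show "0 \<le> \<rho> c x"
      unfolding \<rho>_def by (intro mult_nonneg_nonneg sum_nonneg b_nonneg) (simp add: tot_nonneg)
  next
    fix c d assume d: "d \<in> A"
    have o: "open (chart_image d)" by (rule open_chart_image[OF d])
    have "smooth_on (chart_image d) (\<lambda>z. inverse (tot (chart_point d z)))"
    proof (rule smooth_on_compose[OF smooth_on_inverse_real _ o])
      show "smooth_on (chart_image d) (\<lambda>z. tot (chart_point d z))"
        unfolding tot_def by (intro smooth_on_sum o b_smooth d)
      show "(\<lambda>z. tot (chart_point d z)) ` chart_image d \<subseteq> - {0}"
        using tot_pos[OF chart_top[OF d]] by force
    qed auto
    then show "smooth_on (chart_image d) (\<lambda>z. \<rho> c (chart_point d z))"
      unfolding \<rho>_def by (intro smooth_on_mult smooth_on_sum o b_smooth d) auto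
  next
    fix c assume "c \<in> C ` T"
    \<comment> \<open>The support condition asks for one compact set per chart: the union of the
      finitely many closed balls in it.\<close>
    let ?S = "\<Union>x\<in>{x\<in>T. C x = c}. cball (snd (C x) x) (R x)"
    have "compact ?S" using T(1) by (intro compact_UN) auto
    moreover have "?S \<subseteq> chart_image c" using CRT(4) by blast
    moreover have "y \<in> fst c \<and> snd c y \<in> ?S" if "\<rho> c y \<noteq> 0" for y
    proof -
      have "(\<Sum>x\<in>{x\<in>T. C x = c}. b x y) \<noteq> 0" using that by (auto simp: \<rho>_def)
      then obtain x where "x \<in> T" "C x = c" "b x y \<noteq> 0" by (auto elim: sum.not_neutral_contains_not_neutral)
      then show ?thesis using b_nz[of x y] by auto
    qed
    ultimately show "\<exists>S. compact S \<and> S \<subseteq> chart_image c \<and>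
           (\<forall>d\<in>A. \<forall>x\<in>fst d. \<rho> c x \<noteq> 0 \<longrightarrow> x \<in> fst c \<and> snd c x \<in> S)" by blast
  next
    fix d x assume "d \<in> A" "x \<in> fst d"
    then have "x \<in> topspace X" using charts_cover by blast
    have "(\<Sum>c\<in>C ` T. \<rho> c x) = (\<Sum>c\<in>C ` T. \<Sum>y\<in>{y\<in>T. C y = c}. b y x) * inverse (tot x)"
      unfolding \<rho>_def by (rule sum_distrib_right[symmetric])
    also have "(\<Sum>c\<in>C ` T. \<Sum>y\<in>{y\<in>T. C y = c}. b y x) = tot x"
      unfolding tot_def using T(1) by (intro sum.group) auto
    finally show "(\<Sum>c\<in>C ` T. \<rho> c x) = 1" using tot_pos[OF \<open>x \<in> topspace X\<close>] by simp
  qed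
  then show ?thesis by blast
qed

end

section \<open>Integrals over the surface\<close>

context riemann_surface begin

text \<open>The sum inside \<open>surface_integral\<close> for one given partition of unity, without
  the constant factor.\<close>

definition chart_sum :: "'a chart set \<Rightarrow> ('a chart \<Rightarrow> 'a \<Rightarrow> real) \<Rightarrow> 'a local_family \<Rightarrow> complex" where
  "chart_sum F \<rho> \<omega> = (\<Sum>c\<in>F. integral (chart_image c) (\<lambda>z. of_real (\<rho> c (chart_point c z)) * \<omega> c z))"

text \<open>The choice in \<open>surface_integral\<close> satisfies its defining property because
  partitions of unity exist; later results hold for whichever one it uses.\<close>

lemma surface_integral_chart_sum:
  "\<exists>F \<rho>. partition_of_unity A F \<rho> \<and> surface_integral A \<omega> = - 2 * \<i> * chart_sum F \<rho> \<omega>"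
proof -
  have "\<exists>J F \<rho>. partition_of_unity A F \<rho> \<and>
     J = (\<Sum>c\<in>F. - 2 * \<i> * integral (chart_image c) (\<lambda>z. of_real (\<rho> c (chart_point c z)) * \<omega> c z))"
    using partition_of_unity_exists by blast
  from someI_ex[OF this] show ?thesis
    unfolding surface_integral_def[symmetric] chart_sum_def sum_distrib_left .
qed

definition covariant11 :: "'a local_family \<Rightarrow> bool" where
  "covariant11 \<omega> \<longleftrightarrow> (\<forall>c\<in>A. continuous_on (chart_image c) (\<omega> c)) \<and>
     (\<forall>c\<in>A. \<forall>d\<in>A. \<forall>z\<in>overlap c d. \<omega> c z =
        \<omega> d (transition c d z) * deriv (transition c d) z * cnj (deriv (transition c d) z))"

lemma differentiable_transition_pullback:
  assumes "c \<in> A" "d \<in> A" "z \<in> overlap c d" "smooth_on (chart_image d) f"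
  shows "(\<lambda>z. f (transition c d z)) differentiable (at z)"
proof -
  have "smooth_on (overlap c d) (\<lambda>z. f (transition c d z))"
    using assms transition_in[OF assms(1,2)] overlapD[of _ d c]
    by (intro smooth_on_compose[OF assms(4) smooth_transition] open_overlap open_chart_image) auto
  then show ?thesis using assms(3) by (rule smooth_on_imp_differentiable)
qed

lemma deriv_transition_differentiable:
  assumes "c \<in> A" "d \<in> A" "z \<in> overlap c d"
  shows "(deriv (transition c d) has_field_derivative deriv (deriv (transition c d)) z) (at z)"
    and "deriv (transition c d) differentiable (at z)"
proof -
  show D: "(deriv (transition c d) has_field_derivative deriv (deriv (transition c d)) z) (at z)"
    by (rule holomorphic_derivI[OF holomorphic_deriv[OF transition_holomorphic[OF assms(1,2)]
            open_overlap[OF assms(1,2)]] open_overlap[OF assms(1,2)] assms(3)])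
  then show "deriv (transition c d) differentiable (at z)"
    unfolding has_field_derivative_def differentiable_def by blast
qed

text \<open>The conjugate of T' is antiholomorphic and hence killed by \<open>del\<close>, so no
  derivative of the transition factor remains and a (0,1)-form yields a (1,1)-form.\<close>

lemma del_covariant:
  assumes cd: "c \<in> A" "d \<in> A" and z: "z \<in> overlap c d"
    and b: "smooth_on (chart_image d) b"
    and cov: "\<And>w. w \<in> overlap c d \<Longrightarrow> a w = b (transition c d w) * cnj (deriv (transition c d) w)"
  shows "del a z = del b (transition c d z) * deriv (transition c d) z * cnj (deriv (transition c d) z)"
proof -
  let ?T = "transition c d"
  have bd: "b differentiable (at (?T z))"
    by (rule smooth_on_imp_differentiable[OF b]) (rule overlapD[OF transition_in[OF cd z]])
  note T' = deriv_transition_differentiable[OF cd z]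
  have T'cnj: "(\<lambda>z. cnj (deriv ?T z)) differentiable (at z)"
    using has_derivative_cnj[OF differentiable_works[OF T'(2)]] differentiable_def by blast
  have "del a z = del (\<lambda>z. b (?T z) * cnj (deriv ?T z)) z"
    by (rule del_cong(1)[OF open_overlap[OF cd] z cov])
  also have "\<dots> = del (\<lambda>z. b (?T z)) z * cnj (deriv ?T z) + b (?T z) * del (\<lambda>z. cnj (deriv ?T z)) z"
    by (rule del_mult(1)[OF differentiable_transition_pullback[OF cd z b] T'cnj])
  also have "\<dots> = del b (?T z) * deriv ?T z * cnj (deriv ?T z)"
    using del_compose_holomorphic(1)[OF bd transition_has_derivative[OF cd z]]
    by (simp add: del_cnj(1)[OF T'(2)] del_holomorphic(2)[OF T'(1)])
  finally show ?thesis .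
qed

text \<open>Mirror image for (1,0)-forms: now the factor T' is holomorphic and killed by
  \<open>delbar\<close>.\<close>

lemma delbar_covariant:
  assumes cd: "c \<in> A" "d \<in> A" and z: "z \<in> overlap c d"
    and b: "smooth_on (chart_image d) b"
    and cov: "\<And>w. w \<in> overlap c d \<Longrightarrow> a w = b (transition c d w) * deriv (transition c d) w"
  shows "delbar a z = delbar b (transition c d z) * deriv (transition c d) z * cnj (deriv (transition c d) z)"
proof -
  let ?T = "transition c d"
  have bd: "b differentiable (at (?T z))"
    by (rule smooth_on_imp_differentiable[OF b]) (rule overlapD[OF transition_in[OF cd z]])
  note T' = deriv_transition_differentiable[OF cd z]
  have "delbar a z = delbar (\<lambda>z. b (?T z) * deriv ?T z) z"
    by (rule del_cong(2)[OF open_overlap[OF cd] z cov])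
  also have "\<dots> = delbar (\<lambda>z. b (?T z)) z * deriv ?T z + b (?T z) * delbar (deriv ?T) z"
    by (rule del_mult(2)[OF differentiable_transition_pullback[OF cd z b] T'(2)])
  also have "\<dots> = delbar b (?T z) * deriv ?T z * cnj (deriv ?T z)"
    using del_compose_holomorphic(2)[OF bd transition_has_derivative[OF cd z]]
    by (simp add: del_holomorphic(2)[OF T'(1)])
  finally show ?thesis .
qed

section \<open>Localization and Stokes' theorem for a fixed partition of unity\<close>

context
  fixes F \<rho> assumes pou: "partition_of_unity A F \<rho>"
begin

lemma pou_in: "c \<in> F \<Longrightarrow> c \<in> A" and pou_finite: "finite F"
  and pou_smooth: "c \<in> F \<Longrightarrow> d \<in> A \<Longrightarrow> smooth_on (chart_image d) (\<lambda>z. \<rho> c (chart_point d z))"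
  and pou_sum: "d \<in> A \<Longrightarrow> x \<in> fst d \<Longrightarrow> (\<Sum>c\<in>F. \<rho> c x) = 1"
  using pou unfolding partition_of_unity_def by blast+

lemma pou_support:
  assumes "c \<in> F"
  obtains S where "compact S" "S \<subseteq> chart_image c"
    "\<And>d z. d \<in> A \<Longrightarrow> z \<in> chart_image d \<Longrightarrow> \<rho> c (chart_point d z) \<noteq> 0 \<Longrightarrow> chart_point d z \<in> chart_point c ` S"
proof -
  obtain S where S: "compact S" "S \<subseteq> chart_image c"
     "\<And>d x. d \<in> A \<Longrightarrow> x \<in> fst d \<Longrightarrow> \<rho> c x \<noteq> 0 \<Longrightarrow> x \<in> fst c \<and> snd c x \<in> S"
    using pou assms unfolding partition_of_unity_def by meson
  show ?thesis
    by (rule that[OF S(1,2)]) (simp add: in_chart_point_image_iff[OF pou_in[OF assms] S(2)] S(3) chart_point_in)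
qed

lemma pou_set_integrable:
  fixes f :: "complex \<Rightarrow> complex"
  assumes c: "c \<in> F" and f: "continuous_on (chart_image c) f"
  shows "set_integrable lborel (chart_image c) (\<lambda>z. of_real (\<rho> c (chart_point c z)) * f z)"
proof -
  obtain S where S: "compact S" "S \<subseteq> chart_image c"
    "\<And>d z. d \<in> A \<Longrightarrow> z \<in> chart_image d \<Longrightarrow> \<rho> c (chart_point d z) \<noteq> 0 \<Longrightarrow> chart_point d z \<in> chart_point c ` S"
    using pou_support[OF c] by blast
  show ?thesis
  proof (rule set_integrable_compact_support[OF open_chart_image[OF pou_in[OF c]] _ S(1,2)])
    show "continuous_on (chart_image c) (\<lambda>z. complex_of_real (\<rho> c (chart_point c z)) * f z)"
      by (intro continuous_intros f smooth_on_imp_continuous_on[OF pou_smooth[OF c pou_in[OF c]]])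
    fix z assume z: "z \<in> chart_image c" "complex_of_real (\<rho> c (chart_point c z)) * f z \<noteq> 0"
    then have "chart_point c z \<in> chart_point c ` S" using S(3)[OF pou_in[OF c] z(1)] by auto
    then show "z \<in> S" using z(1) by (simp add: in_chart_point_image_iff[OF pou_in[OF c] S(2)] snd_chart_point)
  qed
qed

lemma chart_sum_sum:
  assumes "finite I" "\<And>i c. i \<in> I \<Longrightarrow> c \<in> A \<Longrightarrow> continuous_on (chart_image c) (\<omega> i c)"
  shows "chart_sum F \<rho> (\<lambda>c z. \<Sum>i\<in>I. \<omega> i c z) = (\<Sum>i\<in>I. chart_sum F \<rho> (\<omega> i))"
proof -
  have "chart_sum F \<rho> (\<lambda>c z. \<Sum>i\<in>I. \<omega> i c z) =
    (\<Sum>c\<in>F. \<Sum>i\<in>I. integral (chart_image c) (\<lambda>z. of_real (\<rho> c (chart_point c z)) * \<omega> i c z))"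
    unfolding chart_sum_def sum_distrib_left
    by (intro sum.cong refl integral_sum assms(1) set_borel_integral_eq_integral(1) pou_set_integrable assms(2) pou_in)
  then show ?thesis unfolding chart_sum_def by (subst (asm) sum.swap)
qed

lemma chart_sum_add:
  assumes "\<And>c. c \<in> A \<Longrightarrow> continuous_on (chart_image c) (\<omega>1 c)" "\<And>c. c \<in> A \<Longrightarrow> continuous_on (chart_image c) (\<omega>2 c)"
  shows "chart_sum F \<rho> (\<lambda>c z. \<omega>1 c z + \<omega>2 c z) = chart_sum F \<rho> \<omega>1 + chart_sum F \<rho> \<omega>2"
  using chart_sum_sum[of "{True, False}" "\<lambda>b. if b then \<omega>1 else \<omega>2"] assms by simp

lemma chart_sum_cong:
  assumes "\<And>c z. c \<in> A \<Longrightarrow> z \<in> chart_image c \<Longrightarrow> \<omega> c z = \<omega>' c z"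
  shows "chart_sum F \<rho> \<omega> = chart_sum F \<rho> \<omega>'"
  unfolding chart_sum_def by (intro sum.cong refl integral_cong) (simp add: assms pou_in)

text \<open>Each summand, computed in its own chart d, is moved to the chart c by the holomorphic
  substitution; there the weights add up to 1.\<close>

lemma chart_sum_localize:
  assumes \<omega>: "covariant11 \<omega>" and c: "c \<in> A" and S: "compact S" "S \<subseteq> chart_image c"
    and supp: "\<And>d z. d \<in> A \<Longrightarrow> z \<in> chart_image d \<Longrightarrow> \<omega> d z \<noteq> 0 \<Longrightarrow> chart_point d z \<in> chart_point c ` S"
  shows "chart_sum F \<rho> \<omega> = integral (chart_image c) (\<omega> c)"
proof -
  have cont: "continuous_on (chart_image d) (\<omega> d)" if "d \<in> A" for d
    using \<omega> that by (simp add: covariant11_def)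
  have int_c: "set_integrable lborel (chart_image c) (\<lambda>z. of_real (\<rho> d (chart_point c z)) * \<omega> c z)" if d: "d \<in> F" for d
  proof (rule set_integrable_compact_support[OF open_chart_image[OF c] _ S])
    show "continuous_on (chart_image c) (\<lambda>z. complex_of_real (\<rho> d (chart_point c z)) * \<omega> c z)"
      by (intro continuous_intros cont c smooth_on_imp_continuous_on[OF pou_smooth[OF d c]])
    fix z assume z: "z \<in> chart_image c" "complex_of_real (\<rho> d (chart_point c z)) * \<omega> c z \<noteq> 0"
    then have "chart_point c z \<in> chart_point c ` S" using supp[OF c z(1)] by auto
    then show "z \<in> S" using z(1) by (simp add: in_chart_point_image_iff[OF c S(2)] snd_chart_point)
  qed
  have "integral (chart_image d) (\<lambda>z. of_real (\<rho> d (chart_point d z)) * \<omega> d z) =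
      integral (chart_image c) (\<lambda>z. of_real (\<rho> d (chart_point c z)) * \<omega> c z)" if d: "d \<in> F" for d
  proof -
    note dA = pou_in[OF d]
    let ?T = "transition c d"
    let ?f = "\<lambda>z. of_real (\<rho> d (chart_point d z)) * \<omega> d z"
    let ?h = "\<lambda>z. of_real (\<rho> d (chart_point c z)) * \<omega> c z"
    have fT: "of_real ((cmod (deriv ?T z))\<^sup>2) * ?f (?T z) = ?h z" if z: "z \<in> overlap c d" for z
    proof -
      have "\<omega> c z = \<omega> d (?T z) * deriv ?T z * cnj (deriv ?T z)"
        using \<omega> c dA z by (simp add: covariant11_def)
      then show ?thesis unfolding complex_norm_square
        by (simp add: chart_point_transition[OF c dA z] mult_ac)
    qed
    obtain S' where S': "compact S'" "S' \<subseteq> chart_image d"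
      "\<And>e z. e \<in> A \<Longrightarrow> z \<in> chart_image e \<Longrightarrow> \<rho> d (chart_point e z) \<noteq> 0 \<Longrightarrow> chart_point e z \<in> chart_point d ` S'"
      using pou_support[OF d] by blast
    \<comment> \<open>Outside the overlap the integrand vanishes by the support of
      \<open>\<omega>\<close>.\<close>
    have "integral (chart_image d) ?f = integral (overlap d c) ?f"
    proof (rule integral_support[OF overlap_subset])
      fix z assume z: "z \<in> chart_image d" "z \<notin> overlap d c"
      then have "chart_point d z \<notin> fst c" by (simp add: overlap_iff[OF dA])
      then show "?f z = 0" using supp[OF dA z(1)] by (auto simp: in_chart_point_image_iff[OF c S(2)])
    qed
    also have "\<dots> = integral (?T ` overlap c d) ?f" by (simp add: transition_image[OF c dA])
    also have "\<dots> = integral (overlap c d) (\<lambda>z. of_real ((cmod (deriv ?T z))\<^sup>2) * ?f (?T z))"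
    proof (rule integral_holomorphic_substitution[symmetric, OF open_overlap[OF c dA] transition_holomorphic[OF c dA] transition_inj[OF c dA]])
      show "set_integrable lborel (?T ` overlap c d) ?f"
        unfolding transition_image[OF c dA]
        by (rule set_integrable_subset[OF pou_set_integrable[OF d cont[OF dA]]])
           (simp_all add: overlap_subset open_overlap[OF dA c])
      have "set_integrable lborel (overlap c d) ?h"
        by (rule set_integrable_subset[OF int_c[OF d]]) (simp_all add: overlap_subset open_overlap[OF c dA])
      then show "set_integrable lborel (overlap c d) (\<lambda>z. of_real ((cmod (deriv ?T z))\<^sup>2) * ?f (?T z))"
        by (subst set_integrable_cong[OF refl refl fT]) auto
    qed
    also have "\<dots> = integral (overlap c d) ?h" by (rule integral_cong[OF fT])
    \<comment> \<open>On this side it is the weight of the chart d that vanishes outside the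
      overlap.\<close>
    also have "\<dots> = integral (chart_image c) ?h"
    proof (rule integral_support[OF overlap_subset, symmetric])
      fix z assume z: "z \<in> chart_image c" "z \<notin> overlap c d"
      then have "chart_point c z \<notin> fst d" by (simp add: overlap_iff[OF c])
      then show "?h z = 0" using S'(3)[OF c z(1)] by (auto simp: in_chart_point_image_iff[OF dA S'(2)])
    qed
    finally show ?thesis .
  qed
  then have "chart_sum F \<rho> \<omega> = (\<Sum>d\<in>F. integral (chart_image c) (\<lambda>z. of_real (\<rho> d (chart_point c z)) * \<omega> c z))"
    unfolding chart_sum_def by (rule sum.cong[OF refl])
  also have "\<dots> = integral (chart_image c) (\<lambda>z. \<Sum>d\<in>F. of_real (\<rho> d (chart_point c z)) * \<omega> c z)"
    by (intro integral_sum[symmetric] pou_finite set_borel_integral_eq_integral(1) int_c)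
  also have "\<dots> = integral (chart_image c) (\<omega> c)"
  proof (rule integral_cong)
    fix z assume "z \<in> chart_image c"
    then have "(\<Sum>d\<in>F. \<rho> d (chart_point c z)) = 1" using pou_sum[OF c chart_point_in] by blast
    then show "(\<Sum>d\<in>F. of_real (\<rho> d (chart_point c z)) * \<omega> c z) = \<omega> c z"
      by (metis mult_1 of_real_1 of_real_sum sum_distrib_right)
  qed
  finally show ?thesis .
qed

text \<open>The primitive a, not its derivative, is cut into pieces by the partition of unity. Each
  piece has compact support in one chart, so localization applies and the integral of its derivative
  there is zero. The covariance hypothesis allows a real factor f so that it covers the single
  pieces.\<close>

lemma chart_sum_exact:
  assumes D: "D = del \<or> D = delbar"
    and a: "\<And>c. c \<in> A \<Longrightarrow> smooth_on (chart_image c) (a c)"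
    and cov: "\<And>f c d z. \<lbrakk>\<And>c. c \<in> A \<Longrightarrow> smooth_on (chart_image c) (\<lambda>z. f (chart_point c z) :: real);
        c \<in> A; d \<in> A; z \<in> overlap c d\<rbrakk> \<Longrightarrow>
        D (\<lambda>z. of_real (f (chart_point c z)) * a c z) z = D (\<lambda>z. of_real (f (chart_point d z)) * a d z) (transition c d z)
          * deriv (transition c d) z * cnj (deriv (transition c d) z)"
  shows "chart_sum F \<rho> (\<lambda>c. D (a c)) = 0"
proof -
  define P where "P = (\<lambda>e c z. of_real (\<rho> e (chart_point c z)) * a c z)"
  have Psm: "smooth_on (chart_image c) (P e c)" if "e \<in> F" "c \<in> A" for e c
    unfolding P_def using that
    by (intro smooth_on_mult smooth_on_of_real pou_smooth a open_chart_image)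
  have Dsm: "smooth_on (chart_image c) (D (P e c))" if "e \<in> F" "c \<in> A" for e c
    using D smooth_on_del[OF open_chart_image[OF that(2)] Psm[OF that]] by auto
  \<comment> \<open>The weights sum to 1 before differentiation, so the derivatives of the weights
    cancel in total.\<close>
  have "D (a c) z = (\<Sum>e\<in>F. D (P e c) z)" if c: "c \<in> A" and z: "z \<in> chart_image c" for c z
  proof -
    have "a c w = (\<Sum>e\<in>F. P e c w)" if w: "w \<in> chart_image c" for w
    proof -
      have "(\<Sum>e\<in>F. P e c w) = of_real (\<Sum>e\<in>F. \<rho> e (chart_point c w)) * a c w"
        by (simp add: P_def sum_distrib_right)
      then show ?thesis using pou_sum[OF c chart_point_in[OF w]] by simp
    qed
    from del_cong[OF open_chart_image[OF c] z this] have "D (a c) z = D (\<lambda>w. \<Sum>e\<in>F. P e c w) z"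
      using D by auto
    also have "\<dots> = (\<Sum>e\<in>F. D (P e c) z)"
      using D del_sum[of F "\<lambda>e. P e c" z] smooth_on_imp_differentiable[OF Psm[OF _ c] z] by auto
    finally show ?thesis .
  qed
  then have "chart_sum F \<rho> (\<lambda>c. D (a c)) = chart_sum F \<rho> (\<lambda>c z. \<Sum>e\<in>F. D (P e c) z)"
    by (rule chart_sum_cong)
  also have "\<dots> = (\<Sum>e\<in>F. chart_sum F \<rho> (\<lambda>c. D (P e c)))"
    by (rule chart_sum_sum[OF pou_finite]) (rule smooth_on_imp_continuous_on[OF Dsm])
  also have "\<dots> = (\<Sum>e\<in>F. 0)"
  proof (rule sum.cong[OF refl])
    fix e assume e: "e \<in> F"
    note eA = pou_in[OF e]
    obtain S where S: "compact S" "S \<subseteq> chart_image e"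
      "\<And>d z. d \<in> A \<Longrightarrow> z \<in> chart_image d \<Longrightarrow> \<rho> e (chart_point d z) \<noteq> 0 \<Longrightarrow> chart_point d z \<in> chart_point e ` S"
      using pou_support[OF e] by blast
    have "chart_sum F \<rho> (\<lambda>c. D (P e c)) = integral (chart_image e) (D (P e e))"
    proof (rule chart_sum_localize[OF _ eA S(1,2)])
      show "covariant11 (\<lambda>c. D (P e c))"
        unfolding covariant11_def P_def
        using smooth_on_imp_continuous_on[OF Dsm[OF e]] cov[of "\<rho> e"] pou_smooth[OF e]
        by (simp add: P_def)
    next
      fix d z assume d: "d \<in> A" and z: "z \<in> chart_image d" "D (P e d) z \<noteq> 0"
      show "chart_point d z \<in> chart_point e ` S"
      proof (rule ccontr)
        assume n: "chart_point d z \<notin> chart_point e ` S"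
        let ?U = "{z \<in> chart_image d. chart_point d z \<notin> chart_point e ` S}"
        have "P e d w = 0" if "w \<in> ?U" for w using that S(3)[OF d, of w] by (auto simp: P_def)
        then have "D (P e d) z = D (\<lambda>_. 0) z"
          using D del_cong[OF open_avoid_compact[OF eA S(1,2) d], of z "P e d" "\<lambda>_. 0"] n z(1) by auto
        then show False using D z(2) by auto
      qed
    qed
    also have "\<dots> = 0"
    proof -
      have "z \<in> S" if z: "z \<in> chart_image e" "P e e z \<noteq> 0" for z
      proof -
        have "chart_point e z \<in> chart_point e ` S" using S(3)[OF eA z(1)] z(2) by (auto simp: P_def)
        then show ?thesis using z(1) by (simp add: in_chart_point_image_iff[OF eA S(2)] snd_chart_point)
      qed
      then show ?thesis
        using D integral_del_compact_support[OF open_chart_image[OF eA] Psm[OF e eA] S(1,2)] by auto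
    qed
    finally show "chart_sum F \<rho> (\<lambda>c. D (P e c)) = 0" .
  qed
  finally show ?thesis by simp
qed

text \<open>Stokes' theorem for a (0,1)-form; multiplication by a function on the surface preserves
  its transformation law.\<close>

lemma chart_sum_del:
  assumes a: "\<And>c. c \<in> A \<Longrightarrow> smooth_on (chart_image c) (a c)"
    and cov: "\<And>c d z. c \<in> A \<Longrightarrow> d \<in> A \<Longrightarrow> z \<in> overlap c d \<Longrightarrow>
        a c z = a d (transition c d z) * cnj (deriv (transition c d) z)"
  shows "chart_sum F \<rho> (\<lambda>c. del (a c)) = 0"
proof (rule chart_sum_exact[OF disjI1[OF refl] a])
  fix f :: "'a \<Rightarrow> real" and c d z
  assume f: "\<And>c. c \<in> A \<Longrightarrow> smooth_on (chart_image c) (\<lambda>z. f (chart_point c z))"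
    and cd: "c \<in> A" "d \<in> A" and z: "z \<in> overlap c d"
  let ?P = "\<lambda>c z. of_real (f (chart_point c z)) * a c z"
  show "del (?P c) z = del (?P d) (transition c d z) * deriv (transition c d) z * cnj (deriv (transition c d) z)"
  proof (rule del_covariant[OF cd z])
    show "smooth_on (chart_image d) (?P d)"
      by (intro smooth_on_mult smooth_on_of_real f a open_chart_image cd)
  qed (simp add: cov[OF cd] chart_point_transition[OF cd])
qed

lemma chart_sum_delbar:
  assumes a: "\<And>c. c \<in> A \<Longrightarrow> smooth_on (chart_image c) (a c)"
    and cov: "\<And>c d z. c \<in> A \<Longrightarrow> d \<in> A \<Longrightarrow> z \<in> overlap c d \<Longrightarrow>
        a c z = a d (transition c d z) * deriv (transition c d) z"
  shows "chart_sum F \<rho> (\<lambda>c. delbar (a c)) = 0"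
proof (rule chart_sum_exact[OF disjI2[OF refl] a])
  fix f :: "'a \<Rightarrow> real" and c d z
  assume f: "\<And>c. c \<in> A \<Longrightarrow> smooth_on (chart_image c) (\<lambda>z. f (chart_point c z))"
    and cd: "c \<in> A" "d \<in> A" and z: "z \<in> overlap c d"
  let ?P = "\<lambda>c z. of_real (f (chart_point c z)) * a c z"
  show "delbar (?P c) z = delbar (?P d) (transition c d z) * deriv (transition c d) z * cnj (deriv (transition c d) z)"
  proof (rule delbar_covariant[OF cd z])
    show "smooth_on (chart_image d) (?P d)"
      by (intro smooth_on_mult smooth_on_of_real f a open_chart_image cd)
  qed (simp add: cov[OF cd] chart_point_transition[OF cd])
qed

end
end

section \<open>Taylor coefficients along the fibres\<close>

definition taylor_coeff :: "nat \<Rightarrow> nat \<Rightarrow> (complex \<Rightarrow> complex) \<Rightarrow> complex" where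
  "taylor_coeff i j f = (del ^^ i) ((delbar ^^ j) f) 0 / (fact i * fact j)"

lemma taylor_altdef: "taylor n f = (\<Sum>i<n. \<Sum>j<n - i. fmonom (taylor_coeff i j f) i j)"
  by (simp add: taylor_def taylor_coeff_def)

lemma smooth_iter:
  assumes "smooth_on UNIV f"
  shows "smooth_on UNIV ((del ^^ i) f)" "smooth_on UNIV ((delbar ^^ j) f)"
proof -
  show "smooth_on UNIV ((del ^^ i) f)" by (induction i) (simp_all add: assms smooth_on_del(1)[OF open_UNIV])
  show "smooth_on UNIV ((delbar ^^ j) f)" by (induction j) (simp_all add: assms smooth_on_del(2)[OF open_UNIV])
qed

lemma smooth_imp_differentiable: "smooth_on UNIV f \<Longrightarrow> f differentiable (at x)"
  by (rule smooth_on_imp_differentiable) auto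

lemma iter_add:
  assumes "smooth_on UNIV f" "smooth_on UNIV g"
  shows "(del ^^ i) (\<lambda>p. f p + g p) = (\<lambda>p. (del ^^ i) f p + (del ^^ i) g p)"
    and "(delbar ^^ i) (\<lambda>p. f p + g p) = (\<lambda>p. (delbar ^^ i) f p + (delbar ^^ i) g p)"
  by (induction i; simp; rule ext; simp add: del_add smooth_imp_differentiable smooth_iter assms)+

lemma iter_cmult:
  assumes "smooth_on UNIV f"
  shows "(del ^^ i) (\<lambda>p. c * f p) = (\<lambda>p. c * (del ^^ i) f p)"
    and "(delbar ^^ i) (\<lambda>p. c * f p) = (\<lambda>p. c * (delbar ^^ i) f p)"
  by (induction i; simp; rule ext; simp add: del_cmult smooth_imp_differentiable smooth_iter assms)+

lemma iter_zero: "(del ^^ i) (\<lambda>p. 0) = (\<lambda>p. 0)" "(delbar ^^ i) (\<lambda>p. 0) = (\<lambda>p. 0)"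
  by (induction i; simp; rule ext; simp)+

lemma taylor_coeff_add:
  "smooth_on UNIV f \<Longrightarrow> smooth_on UNIV g \<Longrightarrow>
    taylor_coeff i j (\<lambda>p. f p + g p) = taylor_coeff i j f + taylor_coeff i j g"
  by (simp add: taylor_coeff_def iter_add smooth_iter add_divide_distrib)

lemma taylor_coeff_cmult:
  "smooth_on UNIV f \<Longrightarrow> taylor_coeff i j (\<lambda>p. c * f p) = c * taylor_coeff i j f"
  by (simp add: taylor_coeff_def iter_cmult smooth_iter)

lemma taylor_coeff_diff:
  assumes "smooth_on UNIV f" "smooth_on UNIV g"
  shows "taylor_coeff i j (\<lambda>p. f p - g p) = taylor_coeff i j f - taylor_coeff i j g"
proof -
  have "smooth_on UNIV (\<lambda>p. -1 * g p)"
    by (intro smooth_on_mult smooth_on_const assms open_UNIV)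
  then show ?thesis
    using taylor_coeff_add[OF assms(1), of "\<lambda>p. -1 * g p" i j] taylor_coeff_cmult[OF assms(2), of i j "-1"] by simp
qed

lemma taylor_coeff_zero [simp]: "taylor_coeff i j (\<lambda>p. 0) = 0"
  by (simp add: taylor_coeff_def iter_zero)

lemma taylor_coeff_sum:
  assumes "finite I" "\<And>k. k \<in> I \<Longrightarrow> smooth_on UNIV (f k)"
  shows "taylor_coeff i j (\<lambda>p. \<Sum>k\<in>I. f k p) = (\<Sum>k\<in>I. taylor_coeff i j (f k))"
  using assms by (induction I) (simp_all add: taylor_coeff_add smooth_on_sum)

lemma del_ident: "del (\<lambda>p. p) p = 1" "delbar (\<lambda>p. p) p = 0" "del cnj p = 0" "delbar cnj p = 1"
proof -
  have "((\<lambda>p. p) has_derivative (\<lambda>v :: complex. v)) (at p)" by (rule has_derivative_ident)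
  from del_eqI[OF this] delbar_eqI[OF this] show "del (\<lambda>p. p) p = 1" "delbar (\<lambda>p. p) p = 0" by simp_all
  have "(cnj has_derivative cnj) (at p)" by (rule bounded_linear_imp_has_derivative[OF bounded_linear_cnj])
  from del_eqI[OF this] delbar_eqI[OF this] show "del cnj p = 0" "delbar cnj p = 1" by simp_all
qed

lemma smooth_cnj: "smooth_on UNIV cnj"
  by (rule smooth_on_linear_self[OF bounded_linear_cnj])

text \<open>Leibniz rule in which only one derivative can fall on p. For i = 0 the truncated index i
  - 1 is harmless because of the factor i.\<close>

lemma iter_mult_ident:
  assumes f: "smooth_on UNIV f"
  shows "(delbar ^^ j) (\<lambda>p. p * f p) = (\<lambda>p. p * (delbar ^^ j) f p)"
    and "(del ^^ i) (\<lambda>p. p * f p) = (\<lambda>p. p * (del ^^ i) f p + of_nat i * (del ^^ (i - 1)) f p)"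
proof -
  show "(delbar ^^ j) (\<lambda>p. p * f p) = (\<lambda>p. p * (delbar ^^ j) f p)"
    by (induction j; simp; rule ext; simp add: del_mult del_ident smooth_imp_differentiable smooth_iter f smooth_on_ident)
  show "(del ^^ i) (\<lambda>p. p * f p) = (\<lambda>p. p * (del ^^ i) f p + of_nat i * (del ^^ (i - 1)) f p)"
  proof (induction i)
    case (Suc i)
    have "del (\<lambda>p. p * (del ^^ i) f p + of_nat i * (del ^^ (i - 1)) f p) p =
        p * del ((del ^^ i) f) p + (del ^^ i) f p + of_nat i * del ((del ^^ (i - 1)) f) p" for p
    proof -
      have s: "smooth_on UNIV (\<lambda>p. p * (del ^^ i) f p)" "smooth_on UNIV (\<lambda>p. of_nat i * (del ^^ (i - 1)) f p)"
        by (intro smooth_on_mult smooth_on_ident smooth_on_const smooth_iter f open_UNIV)+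
      show ?thesis unfolding del_add(1)[OF s[THEN smooth_imp_differentiable]]
        by (simp add: del_cmult del_mult del_ident smooth_imp_differentiable smooth_iter f smooth_on_ident)
    qed
    then show ?case unfolding funpow.simps o_apply Suc.IH
      by (intro ext) (cases i; simp add: algebra_simps)
  qed simp
qed

lemma iter_mult_cnj:
  assumes f: "smooth_on UNIV f"
  shows "(del ^^ j) (\<lambda>p. cnj p * f p) = (\<lambda>p. cnj p * (del ^^ j) f p)"
    and "(delbar ^^ i) (\<lambda>p. cnj p * f p) = (\<lambda>p. cnj p * (delbar ^^ i) f p + of_nat i * (delbar ^^ (i - 1)) f p)"
proof -
  show "(del ^^ j) (\<lambda>p. cnj p * f p) = (\<lambda>p. cnj p * (del ^^ j) f p)"
    by (induction j; simp; rule ext; simp add: del_mult del_ident smooth_imp_differentiable smooth_iter f smooth_cnj)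
  show "(delbar ^^ i) (\<lambda>p. cnj p * f p) = (\<lambda>p. cnj p * (delbar ^^ i) f p + of_nat i * (delbar ^^ (i - 1)) f p)"
  proof (induction i)
    case (Suc i)
    have "delbar (\<lambda>p. cnj p * (delbar ^^ i) f p + of_nat i * (delbar ^^ (i - 1)) f p) p =
        cnj p * delbar ((delbar ^^ i) f) p + (delbar ^^ i) f p + of_nat i * delbar ((delbar ^^ (i - 1)) f) p" for p
    proof -
      have s: "smooth_on UNIV (\<lambda>p. cnj p * (delbar ^^ i) f p)" "smooth_on UNIV (\<lambda>p. of_nat i * (delbar ^^ (i - 1)) f p)"
        by (intro smooth_on_mult smooth_cnj smooth_on_const smooth_iter f open_UNIV)+
      show ?thesis unfolding del_add(2)[OF s[THEN smooth_imp_differentiable]]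
        by (simp add: del_cmult del_mult del_ident smooth_imp_differentiable smooth_iter f smooth_cnj)
    qed
    then show ?case unfolding funpow.simps o_apply Suc.IH
      by (intro ext) (cases i; simp add: algebra_simps)
  qed simp
qed

lemma taylor_coeff_mult_ident:
  assumes "smooth_on UNIV f"
  shows "taylor_coeff i j (\<lambda>p. p * f p) = (if i = 0 then 0 else taylor_coeff (i - 1) j f)"
  by (cases i) (simp_all add: taylor_coeff_def iter_mult_ident(1)[OF assms] iter_mult_ident(2)[OF smooth_iter(2)[OF assms]] del: funpow.simps of_nat_Suc)

lemma taylor_coeff_mult_cnj:
  assumes "smooth_on UNIV f"
  shows "taylor_coeff i j (\<lambda>p. cnj p * f p) = (if j = 0 then 0 else taylor_coeff i (j - 1) f)"
proof (cases j)
  case (Suc l)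
  have s: "smooth_on UNIV (\<lambda>p. cnj p * (delbar ^^ Suc l) f p)" "smooth_on UNIV (\<lambda>p. of_nat (Suc l) * (delbar ^^ l) f p)"
    by (intro smooth_on_mult smooth_cnj smooth_on_const smooth_iter assms open_UNIV)+
  have "(del ^^ i) (\<lambda>p. cnj p * (delbar ^^ Suc l) f p + of_nat (Suc l) * (delbar ^^ l) f p) 0 =
      of_nat (Suc l) * (del ^^ i) ((delbar ^^ l) f) 0"
    unfolding iter_add(1)[OF s] iter_mult_cnj(1)[OF smooth_iter(2)[OF assms]]
      iter_cmult(1)[OF smooth_iter(2)[OF assms]] by simp
  then show ?thesis
    by (simp add: Suc taylor_coeff_def iter_mult_cnj(2)[OF assms] del: funpow.simps of_nat_Suc)
qed (simp add: taylor_coeff_def iter_mult_cnj(1)[OF assms])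

lemma taylor_coeff_mult_power:
  assumes "smooth_on UNIV f"
  shows "taylor_coeff i j (\<lambda>p. p ^ k * f p) = (if i < k then 0 else taylor_coeff (i - k) j f)"
proof (induction k arbitrary: i)
  case (Suc k)
  have "smooth_on UNIV (\<lambda>p. p ^ k * f p)"
    by (intro smooth_on_mult smooth_on_power smooth_on_ident assms open_UNIV)
  from taylor_coeff_mult_ident[OF this, of i j] Suc[of "i - 1"]
  show ?case by (cases i) (auto simp: mult.assoc)
qed simp

lemma taylor_coeff_mult_cnj_power:
  assumes "smooth_on UNIV f"
  shows "taylor_coeff i j (\<lambda>p. cnj p ^ k * f p) = (if j < k then 0 else taylor_coeff i (j - k) f)"
proof (induction k arbitrary: j)
  case (Suc k)
  have "smooth_on UNIV (\<lambda>p. cnj p ^ k * f p)"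
    by (intro smooth_on_mult smooth_on_power smooth_cnj assms open_UNIV)
  from taylor_coeff_mult_cnj[OF this, of i j] Suc[of "j - 1"]
  show ?case by (cases j) (auto simp: mult.assoc)
qed simp

lemma taylor_coeff_const: "taylor_coeff i j (\<lambda>p. c) = (if i = 0 \<and> j = 0 then c else 0)"
proof -
  have "del (\<lambda>p. b) = (\<lambda>p. 0)" "delbar (\<lambda>p. b) = (\<lambda>p. 0)" for b by auto
  then show ?thesis
    by (cases i; cases j) (simp_all add: taylor_coeff_def funpow_Suc_right iter_zero del: funpow.simps)
qed

text \<open>Effect of a change of the fibre coordinate, which is linear: del produces factors b,
  delbar factors b-bar.\<close>

lemma taylor_coeff_scale:
  assumes f: "smooth_on UNIV f"
  shows "taylor_coeff i j (\<lambda>p. f (b * p)) = b ^ i * cnj b ^ j * taylor_coeff i j f"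
proof -
  have d: "((\<lambda>p. b * p) has_field_derivative b) (at p)" for p
    by (rule DERIV_cmult_Id)
  have s: "smooth_on UNIV (\<lambda>p. g (b * p))" if "smooth_on UNIV g" for g :: "complex \<Rightarrow> complex"
    by (rule smooth_on_compose[OF that]) (auto intro: smooth_on_mult smooth_on_ident)
  have 1: "(delbar ^^ j) (\<lambda>p. g (b * p)) = (\<lambda>p. cnj b ^ j * (delbar ^^ j) g (b * p))"
    if g: "smooth_on UNIV g" for g
  proof (induction j)
    case (Suc j)
    show ?case
      unfolding funpow.simps o_apply Suc
      by (rule ext) (simp add: del_cmult(2)[OF smooth_imp_differentiable[OF s[OF smooth_iter(2)[OF g]]]]
          del_compose_holomorphic(2)[where T="\<lambda>p. b * p", OF smooth_imp_differentiable[OF smooth_iter(2)[OF g]] d])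
  qed simp
  have 2: "(del ^^ i) (\<lambda>p. g (b * p)) = (\<lambda>p. b ^ i * (del ^^ i) g (b * p))"
    if g: "smooth_on UNIV g" for g
  proof (induction i)
    case (Suc i)
    show ?case
      unfolding funpow.simps o_apply Suc
      by (rule ext) (simp add: del_cmult(1)[OF smooth_imp_differentiable[OF s[OF smooth_iter(1)[OF g]]]]
          del_compose_holomorphic(1)[where T="\<lambda>p. b * p", OF smooth_imp_differentiable[OF smooth_iter(1)[OF g]] d])
  qed simp
  have "(del ^^ i) ((delbar ^^ j) (\<lambda>p. f (b * p))) 0 = cnj b ^ j * (b ^ i * (del ^^ i) ((delbar ^^ j) f) 0)"
    by (simp add: 1[OF f] iter_cmult(1)[OF s[OF smooth_iter(2)[OF f]]] 2[OF smooth_iter(2)[OF f]])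
  then show ?thesis by (simp add: taylor_coeff_def)
qed

section \<open>Fibre Taylor coefficients as functions of the base point\<close>

context
  fixes U :: "complex set" and F :: "complex \<times> complex \<Rightarrow> complex"
  assumes U: "open U" and F: "smooth_on (U \<times> UNIV) F"
begin

lemma open_slab: "open (U \<times> (UNIV :: complex set))"
  using U by (simp add: open_Times)

lemma smooth_del2_iter: "smooth_on (U \<times> UNIV) ((del2 ^^ i) ((delbar2 ^^ j) F))"
proof -
  have "smooth_on (U \<times> UNIV) ((delbar2 ^^ j) F)"
    by (induction j) (simp_all add: F smooth_on_wirtinger open_slab)
  then show ?thesis by (induction i) (simp_all add: smooth_on_wirtinger open_slab)
qed

text \<open>Fibre derivatives at a fixed base point become partial derivatives of the joint
  function, which can be differentiated in the base direction as well.\<close>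

lemma iter_slice:
  assumes z: "z \<in> U"
  shows "(del ^^ i) ((delbar ^^ j) (\<lambda>p. F (z, p))) = (\<lambda>p. (del2 ^^ i) ((delbar2 ^^ j) F) (z, p))"
proof -
  have d: "(del2 ^^ i) ((delbar2 ^^ j) F) differentiable (at (z, p))" for i j p
    using smooth_on_imp_differentiable[OF smooth_del2_iter] z by auto
  have 1: "(delbar ^^ j) (\<lambda>p. F (z, p)) = (\<lambda>p. (delbar2 ^^ j) F (z, p))"
  proof (induction j)
    case (Suc j) show ?case unfolding funpow.simps o_apply Suc
      using partial_wirtinger(4)[OF d[of 0 j]] by simp
  qed simp
  show ?thesis unfolding 1
  proof (induction i)
    case (Suc i) show ?case unfolding funpow.simps o_apply Suc
      using partial_wirtinger(3)[OF d[of i j]] by simp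
  qed simp
qed

lemma taylor_coeff_slice:
  "z \<in> U \<Longrightarrow> taylor_coeff i j (\<lambda>p. F (z, p)) = (del2 ^^ i) ((delbar2 ^^ j) F) (z, 0) / (fact i * fact j)"
  by (simp add: taylor_coeff_def iter_slice)

lemma smooth_taylor_coeff: "smooth_on U (\<lambda>z. taylor_coeff i j (\<lambda>p. F (z, p)))"
proof -
  have "smooth_on U (\<lambda>z. 1 / (fact i * fact j) * (del2 ^^ i) ((delbar2 ^^ j) F) (z, 0))"
    by (intro smooth_on_mult smooth_on_const smooth_on_slice' smooth_del2_iter U)
  then show ?thesis by (subst smooth_on_cong[OF U]) (auto simp: taylor_coeff_slice)
qed

text \<open>Repeated use of the symmetry of second derivatives; it is stated pointwise on the slab
  because smoothness is known only there.\<close>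

lemma wirtinger_iter:
  assumes "x \<in> U \<times> UNIV"
  shows "(del2 ^^ i) ((delbar2 ^^ j) (wirtinger s u v F)) x = wirtinger s u v ((del2 ^^ i) ((delbar2 ^^ j) F)) x"
proof -
  have 1: "(delbar2 ^^ j) (wirtinger s u v F) x = wirtinger s u v ((delbar2 ^^ j) F) x" if "x \<in> U \<times> UNIV" for x
    using that
  proof (induction j arbitrary: x)
    case (Suc j)
    have "delbar2 ((delbar2 ^^ j) (wirtinger s u v F)) x = delbar2 (wirtinger s u v ((delbar2 ^^ j) F)) x"
      by (rule wirtinger_cong[OF open_slab Suc.prems Suc.IH])
    also have "\<dots> = wirtinger s u v (delbar2 ((delbar2 ^^ j) F)) x"
      using smooth_del2_iter[of 0 j] by (intro wirtinger_commute[OF open_slab _ Suc.prems]) simp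
    finally show ?case by simp
  qed simp
  show ?thesis
    using assms
  proof (induction i arbitrary: x)
    case (Suc i)
    have "del2 ((del2 ^^ i) ((delbar2 ^^ j) (wirtinger s u v F))) x = del2 (wirtinger s u v ((del2 ^^ i) ((delbar2 ^^ j) F))) x"
      by (rule wirtinger_cong[OF open_slab Suc.prems Suc.IH])
    also have "\<dots> = wirtinger s u v (del2 ((del2 ^^ i) ((delbar2 ^^ j) F))) x"
      by (rule wirtinger_commute[OF open_slab smooth_del2_iter Suc.prems])
    finally show ?case by simp
  qed (simp add: 1)
qed

end

text \<open>Base derivatives pass through the fibre derivatives; a fibre derivative raises one
  index, and the factor i + 1 or j + 1 is the quotient of the factorials.\<close>

lemma taylor_coeff_partials:
  fixes F :: "complex \<times> complex \<Rightarrow> complex"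
  assumes U: "open U" and F: "smooth_on (U \<times> UNIV) F" and z: "z \<in> U"
  shows "taylor_coeff i j (\<lambda>p. del1 F (z, p)) = del (\<lambda>z. taylor_coeff i j (\<lambda>p. F (z, p))) z"
    and "taylor_coeff i j (\<lambda>p. delbar1 F (z, p)) = delbar (\<lambda>z. taylor_coeff i j (\<lambda>p. F (z, p))) z"
    and "taylor_coeff i j (\<lambda>p. del2 F (z, p)) = of_nat (i + 1) * taylor_coeff (i + 1) j (\<lambda>p. F (z, p))"
    and "taylor_coeff i j (\<lambda>p. delbar2 F (z, p)) = of_nat (j + 1) * taylor_coeff i (j + 1) (\<lambda>p. F (z, p))"
proof -
  let ?E = "(del2 ^^ i) ((delbar2 ^^ j) F)"
  have x: "(z, 0) \<in> U \<times> UNIV" using z by simp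
  have W: "taylor_coeff i j (\<lambda>p. wirtinger s u v F (z, p)) = wirtinger s u v ?E (z, 0) / (fact i * fact j)" for s u v
    unfolding wirtinger_iter[OF U F x, symmetric]
    by (rule taylor_coeff_slice[OF U smooth_on_wirtinger[OF open_slab[OF U F] F] z])
  have E: "?E differentiable (at (z, 0))"
    using smooth_on_imp_differentiable[OF smooth_del2_iter[OF U F] x] .
  have Ed: "(\<lambda>w. ?E (w, 0)) differentiable (at z)"
    by (rule smooth_on_imp_differentiable[OF smooth_on_slice'[OF smooth_del2_iter[OF U F] U] z])
  have r: "del (\<lambda>z. taylor_coeff i j (\<lambda>p. F (z, p))) z = del (\<lambda>z. 1 / (fact i * fact j) * ?E (z, 0)) z"
     "delbar (\<lambda>z. taylor_coeff i j (\<lambda>p. F (z, p))) z = delbar (\<lambda>z. 1 / (fact i * fact j) * ?E (z, 0)) z"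
    by (intro del_cong[OF U z]; simp add: taylor_coeff_slice[OF U F])+
  show "taylor_coeff i j (\<lambda>p. del1 F (z, p)) = del (\<lambda>z. taylor_coeff i j (\<lambda>p. F (z, p))) z"
    "taylor_coeff i j (\<lambda>p. delbar1 F (z, p)) = delbar (\<lambda>z. taylor_coeff i j (\<lambda>p. F (z, p))) z"
    unfolding r W using partial_wirtinger(1,2)[OF E] by (simp_all add: del_cmult[OF Ed, of "1 / (fact i * fact j)", simplified])
  show "taylor_coeff i j (\<lambda>p. del2 F (z, p)) = of_nat (i + 1) * taylor_coeff (i + 1) j (\<lambda>p. F (z, p))"
    unfolding W taylor_coeff_slice[OF U F z] by (simp del: of_nat_Suc)
  \<comment> \<open>The additional \<open>delbar2\<close> stands outside the \<open>del2\<close>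
    iterates and must be moved inside them.\<close>
  have "delbar2 ?E (z, 0) = (del2 ^^ i) ((delbar2 ^^ Suc j) F) (z, 0)"
    unfolding wirtinger_iter[OF U F x, symmetric] by (simp add: funpow_swap1)
  then show "taylor_coeff i j (\<lambda>p. delbar2 F (z, p)) = of_nat (j + 1) * taylor_coeff i (j + 1) (\<lambda>p. F (z, p))"
    unfolding W taylor_coeff_slice[OF U F z] by (simp del: of_nat_Suc funpow.simps)
qed

section \<open>Substitution of a power series for the conjugate variable\<close>

definition subst_sum :: "nat \<Rightarrow> complex fps \<Rightarrow> (nat \<Rightarrow> nat \<Rightarrow> complex) \<Rightarrow> complex fps" where
  "subst_sum N M a = (\<Sum>i\<le>N. \<Sum>j\<le>N. fps_const (a i j) * (fps_X ^ i * M ^ j))"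

text \<open>Substitution of M for the second variable in an infinite double series. If M has no
  constant term, X^i M^j begins in degree at least i + j, so the m-th coefficient is already
  determined by the indices up to m.\<close>

definition subst_series :: "complex fps \<Rightarrow> (nat \<Rightarrow> nat \<Rightarrow> complex) \<Rightarrow> complex fps" where
  "subst_series M a = Abs_fps (\<lambda>m. subst_sum m M a $ m)"

lemma fps_power_nth_less: "M $ 0 = 0 \<Longrightarrow> m < j \<Longrightarrow> (M ^ j) $ m = (0 :: complex)"
  using startsby_zero_power_prefix[of M j] by simp

lemma XM_nth_less:
  assumes "M $ 0 = 0" "m < i + j"
  shows "(fps_X ^ i * M ^ j) $ m = (0 :: complex)"
  using assms by (simp add: fps_X_power_mult_nth fps_power_nth_less)

lemma subst_sum_nth:
  "subst_sum N M a $ m = (\<Sum>i\<le>N. \<Sum>j\<le>N. a i j * (fps_X ^ i * M ^ j) $ m)"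
  by (simp add: subst_sum_def fps_sum_nth)

lemma sum_extend_zero:
  fixes m N :: nat
  assumes "m \<le> N" "\<And>i. m < i \<Longrightarrow> f i = 0"
  shows "(\<Sum>i\<le>N. f i) = (\<Sum>i\<le>m. f i :: complex)"
  using assms by (intro sum.mono_neutral_right) auto

text \<open>Any larger truncation gives the same coefficient; differentiation requires this freedom
  because it consumes one degree.\<close>

lemma subst_series_nth:
  assumes M: "M $ 0 = 0" and "m \<le> N"
  shows "subst_series M a $ m = subst_sum N M a $ m"
proof -
  have z: "(fps_X ^ i * M ^ j) $ m = 0" if "m < i \<or> m < j" for i j
    by (rule XM_nth_less[OF M]) (use that in auto)
  have "subst_sum N M a $ m = (\<Sum>i\<le>m. \<Sum>j\<le>N. a i j * (fps_X ^ i * M ^ j) $ m)"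
    unfolding subst_sum_nth by (rule sum_extend_zero[OF assms(2)]) (simp add: z)
  also have "\<dots> = (\<Sum>i\<le>m. \<Sum>j\<le>m. a i j * (fps_X ^ i * M ^ j) $ m)"
    by (intro sum.cong refl sum_extend_zero[OF assms(2)]) (simp add: z)
  finally show ?thesis by (simp add: subst_series_def subst_sum_nth)
qed

lemma subst_series_mult_nth:
  assumes "M $ 0 = 0" "m \<le> N"
  shows "(subst_series M a * K) $ m = (subst_sum N M a * K) $ m"
  unfolding fps_mult_nth using assms by (intro sum.cong refl) (simp add: subst_series_nth[of M _ N])

lemma subst_series_linear:
  "subst_series M (\<lambda>i j. a i j + b i j) = subst_series M a + subst_series M b"
  "subst_series M (\<lambda>i j. a i j - b i j) = subst_series M a - subst_series M b"
  "subst_series M (\<lambda>i j. c * a i j) = fps_const c * subst_series M a"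
  "subst_series M (\<lambda>i j. 0) = 0"
  by (rule fps_ext, simp add: subst_series_def subst_sum_nth
      distrib_right left_diff_distrib sum.distrib sum_subtractf sum_distrib_left mult.assoc)+

lemma subst_series_sum:
  assumes "finite I"
  shows "subst_series M (\<lambda>i j. \<Sum>k\<in>I. a k i j) = (\<Sum>k\<in>I. subst_series M (a k))"
  using assms by (induction I) (simp_all add: subst_series_linear)

text \<open>Shifting the first index by k is multiplication of the double series by p^k.\<close>

lemma subst_series_shift:
  assumes M: "M $ 0 = 0"
  shows "subst_series M (\<lambda>i j. if i < k then 0 else a (i - k) j) = fps_X ^ k * subst_series M a"
proof (rule fps_ext)
  fix m
  show "subst_series M (\<lambda>i j. if i < k then 0 else a (i - k) j) $ m = (fps_X ^ k * subst_series M a) $ m"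
  proof (cases "m < k")
    case True
    then show ?thesis
      by (auto simp: subst_series_nth[OF M order_refl] subst_sum_nth fps_X_power_mult_nth intro!: sum.neutral)
  next
    case False
    have "subst_series M (\<lambda>i j. if i < k then 0 else a (i - k) j) $ m =
        (\<Sum>i\<in>{k..m}. \<Sum>j\<le>m. a (i - k) j * (fps_X ^ i * M ^ j) $ m)"
      unfolding subst_series_nth[OF M order_refl] subst_sum_nth
      by (rule sum.mono_neutral_cong_right) auto
    also have "\<dots> = (\<Sum>i\<le>m - k. \<Sum>j\<le>m. a i j * (fps_X ^ (i + k) * M ^ j) $ m)"
      by (rule sum.reindex_bij_witness[of _ "\<lambda>i. i + k" "\<lambda>i. i - k"]) (use False in auto)
    also have "\<dots> = (\<Sum>i\<le>m - k. \<Sum>j\<le>m. a i j * (fps_X ^ i * M ^ j) $ (m - k))"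
      using False by (intro sum.cong refl) (auto simp: fps_X_power_mult_nth add.commute)
    also have "\<dots> = (\<Sum>i\<le>m - k. \<Sum>j\<le>m - k. a i j * (fps_X ^ i * M ^ j) $ (m - k))"
    proof (rule sum.cong[OF refl], rule sum_extend_zero)
      fix i j assume "m - k < j"
      then have "(fps_X ^ i * M ^ j) $ (m - k) = 0" by (intro XM_nth_less[OF M]) auto
      then show "a i j * (fps_X ^ i * M ^ j) $ (m - k) = 0" by simp
    qed auto
    also have "\<dots> = (fps_X ^ k * subst_series M a) $ m"
      using False by (simp add: fps_X_power_mult_nth subst_series_nth[OF M order_refl] subst_sum_nth)
    finally show ?thesis .
  qed
qed

text \<open>Formal partial derivatives of the double series in p and in p-bar.\<close>

abbreviation "shift1 a \<equiv> \<lambda>i j. of_nat (i + 1) * a (i + 1) j :: complex"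
abbreviation "shift2 a \<equiv> \<lambda>i j. of_nat (j + 1) * a i (j + 1) :: complex"

lemma sum_shift_index:
  "(\<Sum>i\<le>Suc N. of_nat i * f i (i - 1)) = (\<Sum>i\<le>N. of_nat (i + 1) * f (i + 1) i :: complex)"
  by (subst sum.atMost_Suc_shift) simp

lemma of_nat_fps_nth: "(of_nat k * f) $ m = of_nat k * (f $ m :: complex)"
  by (simp add: fps_of_nat[symmetric])

text \<open>The factor j M^(j-1) K is the derivative of M^j along K. The row i = N + 1 contributes
  only from degree N + 1 on, and j = 0 drops out, so shifting j by one leaves a square of size
  N.\<close>

lemma subst_sum_shift2:
  assumes M: "M $ 0 = 0" and m: "m \<le> N"
  shows "(\<Sum>i\<le>Suc N. \<Sum>j\<le>Suc N. a i j * (fps_X ^ i * (of_nat j * M ^ (j - 1) * K)) $ m) =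
    (subst_series M (shift2 a) * K) $ m"
proof -
  have c: "a i j * (fps_X ^ i * (of_nat j * M ^ (j - 1) * K)) $ m =
      of_nat j * (a i j * (fps_X ^ i * M ^ (j - 1) * K) $ m)" for i j
  proof -
    have "fps_X ^ i * (of_nat j * M ^ (j - 1) * K) = of_nat j * (fps_X ^ i * M ^ (j - 1) * K)"
      by (simp add: algebra_simps)
    then show ?thesis by (simp only: of_nat_fps_nth mult.left_commute)
  qed
  have "(\<Sum>i\<le>Suc N. \<Sum>j\<le>Suc N. a i j * (fps_X ^ i * (of_nat j * M ^ (j - 1) * K)) $ m) =
      (\<Sum>i\<le>N. \<Sum>j\<le>Suc N. of_nat j * (a i j * (fps_X ^ i * M ^ (j - 1) * K) $ m))"
    unfolding c using m by (subst sum.atMost_Suc) (simp add: mult.assoc fps_X_power_mult_nth del: sum.atMost_Suc of_nat_Suc power_Suc)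
  also have "\<dots> = (\<Sum>i\<le>N. \<Sum>j\<le>N. of_nat (j + 1) * (a i (j + 1) * (fps_X ^ i * M ^ j * K) $ m))"
    by (intro sum.cong refl sum_shift_index[of "\<lambda>j j'. a _ j * (fps_X ^ _ * M ^ j' * K) $ m"])
  also have "\<dots> = (subst_sum N M (shift2 a) * K) $ m"
    unfolding subst_sum_def
    by (simp only: sum_distrib_right fps_sum_nth mult.assoc fps_mult_left_const_nth)
  finally show ?thesis by (simp only: subst_series_mult_nth[OF M m])
qed

lemma subst_sum_shift1:
  assumes M: "M $ 0 = 0" and m: "m \<le> N"
  shows "(\<Sum>i\<le>Suc N. \<Sum>j\<le>Suc N. a i j * (of_nat i * fps_X ^ (i - 1) * M ^ j) $ m) =
    subst_series M (shift1 a) $ m"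
proof -
  have "(\<Sum>i\<le>Suc N. \<Sum>j\<le>Suc N. a i j * (of_nat i * fps_X ^ (i - 1) * M ^ j) $ m) =
      (\<Sum>j\<le>Suc N. \<Sum>i\<le>Suc N. of_nat i * (a i j * (fps_X ^ (i - 1) * M ^ j) $ m))"
    by (subst sum.swap) (simp add: mult.assoc of_nat_fps_nth mult.left_commute del: sum.atMost_Suc power_Suc)
  also have "\<dots> = (\<Sum>j\<le>N. \<Sum>i\<le>Suc N. of_nat i * (a i j * (fps_X ^ (i - 1) * M ^ j) $ m))"
  proof -
    have "(fps_X ^ (i - 1) * M ^ Suc N) $ m = 0" for i
      by (rule XM_nth_less[OF M]) (use m in simp)
    then show ?thesis by (subst sum.atMost_Suc) (simp del: sum.atMost_Suc power_Suc)
  qed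
  also have "\<dots> = (\<Sum>j\<le>N. \<Sum>i\<le>N. of_nat (i + 1) * (a (i + 1) j * (fps_X ^ i * M ^ j) $ m))"
    by (intro sum.cong refl sum_shift_index[of "\<lambda>i i'. a i _ * (fps_X ^ i' * M ^ _) $ m"])
  also have "\<dots> = subst_sum N M (shift1 a) $ m"
    unfolding subst_sum_nth by (subst sum.swap) (simp add: mult.assoc)
  finally show ?thesis by (simp only: subst_series_nth[OF M m])
qed

text \<open>Chain rule for a(p, M(p)): the explicit p-derivative plus the p-bar-derivative times
  M'.\<close>

lemma fps_deriv_subst_series:
  assumes M: "M $ 0 = 0"
  shows "fps_deriv (subst_series M a) = subst_series M (shift1 a) + subst_series M (shift2 a) * fps_deriv M"
proof (rule fps_ext)
  fix m
  \<comment> \<open>Coefficient m of a derivative comes from degree m + 1, hence the truncation at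
    \<open>Suc m\<close>.\<close>
  have "fps_deriv (subst_series M a) $ m = fps_deriv (subst_sum (Suc m) M a) $ m"
    unfolding fps_deriv_nth by (subst subst_series_nth[OF M, of "m + 1" "Suc m"]) simp_all
  also have "\<dots> = (\<Sum>i\<le>Suc m. \<Sum>j\<le>Suc m. a i j * (of_nat i * fps_X ^ (i - 1) * M ^ j) $ m +
      a i j * (fps_X ^ i * (of_nat j * M ^ (j - 1) * fps_deriv M)) $ m)"
  proof -
    have d: "fps_deriv (fps_const c * (fps_X ^ i * M ^ j)) = fps_const c *
        (of_nat i * fps_X ^ (i - 1) * M ^ j + fps_X ^ i * (of_nat j * M ^ (j - 1) * fps_deriv M))" for c i j
      by (simp add: fps_deriv_power algebra_simps fps_of_nat)
    have "(fps_const c * f) $ m = c * (f $ m)" for c :: complex and f by simp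
    then show ?thesis
      unfolding subst_sum_def fps_deriv_sum fps_sum_nth d
      by (intro sum.cong refl) (simp only: distrib_left fps_add_nth)
  qed
  also have "\<dots> = (subst_series M (shift1 a) + subst_series M (shift2 a) * fps_deriv M) $ m"
    unfolding sum.distrib subst_sum_shift1[OF M order_refl] subst_sum_shift2[OF M order_refl] by simp
  finally show "fps_deriv (subst_series M a) $ m =
    (subst_series M (shift1 a) + subst_series M (shift2 a) * fps_deriv M) $ m" .
qed

text \<open>Power rule for series whose coefficients depend on the base point, where D is either
  Wirtinger derivative; both are derivations, so one induction treats them together.\<close>

lemma diff_power_series_nth:
  assumes D: "D = del \<or> D = delbar"
    and M: "\<And>m. (\<lambda>w. M w $ m) differentiable (at z)"
    and dM: "\<And>m. D (\<lambda>w. M w $ m) z = dM $ m"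
  shows "(\<lambda>w. (M w ^ j) $ m) differentiable (at z) \<and>
    D (\<lambda>w. (M w ^ j) $ m) z = (of_nat j * M z ^ (j - 1) * dM) $ m"
proof (induction j arbitrary: m)
  case 0
  have "D (\<lambda>w. c) z = 0" for c using D by auto
  then show ?case by (cases m) simp_all
next
  case (Suc j)
  have IH: "(\<lambda>w. (M w ^ j) $ m) differentiable (at z)" "D (\<lambda>w. (M w ^ j) $ m) z = (of_nat j * M z ^ (j - 1) * dM) $ m" for m
    using Suc by auto
  have m: "(\<lambda>w. M w $ i * (M w ^ j) $ (m - i)) differentiable (at z)" for i
    by (intro differentiable_mult M IH)
  have e: "(\<lambda>w. (M w ^ Suc j) $ m) = (\<lambda>w. \<Sum>i=0..m. M w $ i * (M w ^ j) $ (m - i))"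
    by (simp add: fps_mult_nth)
  have "D (\<lambda>w. \<Sum>i=0..m. M w $ i * (M w ^ j) $ (m - i)) z = (\<Sum>i=0..m. D (\<lambda>w. M w $ i * (M w ^ j) $ (m - i)) z)"
    using D del_sum[of "{0..m}" "\<lambda>i w. M w $ i * (M w ^ j) $ (m - i)" z] m by auto
  also have "\<dots> = (\<Sum>i=0..m. dM $ i * (M z ^ j) $ (m - i) + M z $ i * (of_nat j * M z ^ (j - 1) * dM) $ (m - i))"
  proof (rule sum.cong[OF refl])
    fix i
    show "D (\<lambda>w. M w $ i * (M w ^ j) $ (m - i)) z =
        dM $ i * (M z ^ j) $ (m - i) + M z $ i * (of_nat j * M z ^ (j - 1) * dM) $ (m - i)"
      using D del_mult[OF M[of i] IH(1)[of "m - i"]] IH(2)[of "m - i"] dM[of i] by auto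
  qed
  also have "\<dots> = (dM * M z ^ j + M z * (of_nat j * M z ^ (j - 1) * dM)) $ m"
    by (simp only: fps_mult_nth fps_add_nth sum.distrib)
  also have "dM * M z ^ j + M z * (of_nat j * M z ^ (j - 1) * dM) = of_nat (Suc j) * M z ^ (Suc j - 1) * dM"
    by (cases j) (simp_all add: algebra_simps)
  finally show ?case unfolding e using m by (auto intro: differentiable_sum)
qed

text \<open>The base-point counterpart of the chain rule: variation of the coefficients a, plus
  variation of the substituted series M.\<close>

lemma diff_subst_series_nth:
  assumes D: "D = del \<or> D = delbar"
    and M0: "\<And>w. M w $ 0 = 0"
    and M: "\<And>m. (\<lambda>w. M w $ m) differentiable (at z)"
    and dM: "\<And>m. D (\<lambda>w. M w $ m) z = dM $ m"
    and a: "\<And>i j. (\<lambda>w. a w i j) differentiable (at z)"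
    and da: "\<And>i j. D (\<lambda>w. a w i j) z = da i j"
  shows "(\<lambda>w. subst_series (M w) (a w) $ m) differentiable (at z)"
    and "D (\<lambda>w. subst_series (M w) (a w) $ m) z =
      subst_series (M z) da $ m + (subst_series (M z) (shift2 (a z)) * dM) $ m"
proof -
  let ?N = "Suc m"
  note P = diff_power_series_nth[OF D M dM]
  have X: "(\<lambda>w. (fps_X ^ i * M w ^ j) $ m) differentiable (at z)"
    "D (\<lambda>w. (fps_X ^ i * M w ^ j) $ m) z = (fps_X ^ i * (of_nat j * M z ^ (j - 1) * dM)) $ m" for i j
    by (cases "m < i"; insert D P; auto simp: fps_X_power_mult_nth)+
  have t: "(\<lambda>w. a w i j * (fps_X ^ i * M w ^ j) $ m) differentiable (at z)" for i j
    by (intro differentiable_mult a X)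
  have Dt: "D (\<lambda>w. a w i j * (fps_X ^ i * M w ^ j) $ m) z =
      da i j * (fps_X ^ i * M z ^ j) $ m + a z i j * (fps_X ^ i * (of_nat j * M z ^ (j - 1) * dM)) $ m" for i j
    using D del_mult[OF a X(1), of i j i j] X(2)[of i j] da[of i j] by auto
  have e: "(\<lambda>w. subst_series (M w) (a w) $ m) = (\<lambda>w. \<Sum>i\<le>?N. \<Sum>j\<le>?N. a w i j * (fps_X ^ i * M w ^ j) $ m)"
    by (rule ext) (simp only: subst_series_nth[OF M0, of m ?N] subst_sum_nth le_SucI order_refl)
  show "(\<lambda>w. subst_series (M w) (a w) $ m) differentiable (at z)"
    unfolding e by (intro differentiable_sum ballI t finite_atMost)
  have "D (\<lambda>w. \<Sum>i\<le>?N. \<Sum>j\<le>?N. a w i j * (fps_X ^ i * M w ^ j) $ m) z =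
      (\<Sum>i\<le>?N. D (\<lambda>w. \<Sum>j\<le>?N. a w i j * (fps_X ^ i * M w ^ j) $ m) z)"
    using D del_sum[of "{..?N}" "\<lambda>i w. \<Sum>j\<le>?N. a w i j * (fps_X ^ i * M w ^ j) $ m" z]
      differentiable_sum[of "{..?N}" "\<lambda>j w. a w _ j * (fps_X ^ _ * M w ^ j) $ m" "at z"] t by blast
  also have "\<dots> = (\<Sum>i\<le>?N. \<Sum>j\<le>?N. D (\<lambda>w. a w i j * (fps_X ^ i * M w ^ j) $ m) z)"
    using D del_sum[of "{..?N}" "\<lambda>j w. a w _ j * (fps_X ^ _ * M w ^ j) $ m" z] t
    by (intro sum.cong refl) blast
  also have "\<dots> = subst_sum ?N (M z) da $ m + (subst_series (M z) (shift2 (a z)) * dM) $ m"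
    unfolding Dt sum.distrib subst_sum_nth subst_sum_shift2[OF M0 order_refl] ..
  also have "subst_sum ?N (M z) da $ m = subst_series (M z) da $ m"
    by (rule subst_series_nth[OF M0, symmetric]) simp
  finally show "D (\<lambda>w. subst_series (M w) (a w) $ m) z =
      subst_series (M z) da $ m + (subst_series (M z) (shift2 (a z)) * dM) $ m" unfolding e .
qed

text \<open>The terms of total degree at least n that \<open>taylor\<close> omits affect only
  coefficients of degree at least n after the substitution.\<close>

lemma reduce_taylor:
  assumes M: "M $ 0 = 0" and m: "m < n"
  shows "reduce M (taylor n f) $ m = subst_series M (\<lambda>i j. taylor_coeff i j f) $ m"
proof -
  define g where "g = (\<lambda>i j. taylor_coeff i j f * (fps_X ^ i * M ^ j) $ m)"
  have z: "g i j = 0" if "m < i + j" for i j using XM_nth_less[OF M that] by (simp add: g_def)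
  have "reduce M (taylor n f) $ m = (\<Sum>i<n. \<Sum>j<n - i. g i j)"
    by (simp add: taylor_altdef reduce_sum reduce_fmonom fps_sum_nth mult.assoc g_def)
  also have "\<dots> = (\<Sum>i\<le>m. \<Sum>j<n - i. g i j)"
    using m by (intro sum.mono_neutral_right) (auto intro!: sum.neutral z)
  also have "\<dots> = (\<Sum>i\<le>m. \<Sum>j\<le>m. g i j)"
  proof (rule sum.cong[OF refl])
    fix i assume "i \<in> {..m}"
    have "(\<Sum>j<n - i. g i j) = (\<Sum>j\<in>{..<n - i} \<inter> {..m}. g i j)"
      by (intro sum.mono_neutral_right) (auto intro!: z)
    also have "\<dots> = (\<Sum>j\<le>m. g i j)"
      using m by (intro sum.mono_neutral_left) (auto simp: not_less intro!: z)
    finally show "(\<Sum>j<n - i. g i j) = (\<Sum>j\<le>m. g i j)" .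
  qed
  finally show ?thesis by (simp add: subst_series_nth[OF M order_refl] subst_sum_nth g_def)
qed

section \<open>The infinitesimal action\<close>

lemma structure_series_altdef:
  "structure_series n a = (\<Sum>k=2..n. fps_const (a k) * fps_X ^ (k - 1))"
  by (simp add: fps_of_structure_poly[symmetric] fps_of_poly_sum fps_of_poly_monom)

lemma reduce_structure_variation:
  "reduce M (\<Sum>k=2..n. fmonom (a k) (k - 1) 0) = structure_series n a"
  by (simp add: structure_series_altdef reduce_sum reduce_fmonom)

text \<open>Substitution is linear and commutes with multiplication by powers of p; the free
  exponents e cover M, its derivatives and the single power p^(n-1).\<close>

lemma subst_series_taylor_poly_mult:
  assumes M: "M $ 0 = 0" and I: "finite I" and G: "smooth_on UNIV G"
  shows "subst_series M (\<lambda>i j. taylor_coeff i j (\<lambda>p. \<Sum>k\<in>I. c k * (p ^ e k * G p))) =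
    (\<Sum>k\<in>I. fps_const (c k) * fps_X ^ e k) * subst_series M (\<lambda>i j. taylor_coeff i j G)"
proof -
  have s: "smooth_on UNIV (\<lambda>p. p ^ m * G p)" for m
    by (intro smooth_on_mult smooth_on_power smooth_on_ident G open_UNIV)
  have "taylor_coeff i j (\<lambda>p. \<Sum>k\<in>I. c k * (p ^ e k * G p)) =
      (\<Sum>k\<in>I. c k * (if i < e k then 0 else taylor_coeff (i - e k) j G))" for i j
    by (subst taylor_coeff_sum[OF I smooth_on_mult[OF open_UNIV smooth_on_const s]])
      (simp only: taylor_coeff_cmult[OF s] taylor_coeff_mult_power[OF G])
  then show ?thesis
    by (simp only: subst_series_sum[OF I] subst_series_linear(3)
        subst_series_shift[OF M, of _ "\<lambda>i j. taylor_coeff i j G"] sum_distrib_right mult.assoc)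
qed

lemma smooth_poly_mult:
  assumes "smooth_on UNIV G"
  shows "smooth_on UNIV (\<lambda>p :: complex. \<Sum>k\<in>I. c k * (p ^ e k * G p))"
  by (intro smooth_on_sum smooth_on_mult smooth_on_power smooth_on_ident smooth_on_const assms open_UNIV)

text \<open>Coefficient of p^m in delbar w + w' del M - M' del w, where \<mu>_(i+1) is the
  coefficient of p^i in M. The index i = m + 1 would carry w_0, which is zero for the Hamiltonians
  in question.\<close>

definition variation ::
  "(nat \<Rightarrow> complex \<Rightarrow> complex) \<Rightarrow> (nat \<Rightarrow> complex \<Rightarrow> complex) \<Rightarrow> nat \<Rightarrow> complex \<Rightarrow> complex" where
  "variation \<mu> w m z = delbar (w m) z +
     (\<Sum>i=1..m. of_nat (m + 1 - i) * del (\<mu> (i + 1)) z * w (m + 1 - i) z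
              - of_nat i * \<mu> (i + 1) z * del (w (m + 1 - i)) z)"

text \<open>The formal restriction of a Hamiltonian to \<open>p\<close>-bar \<open>= M(p)\<close>.\<close>

definition hamiltonian_series ::
  "nat \<Rightarrow> (nat \<Rightarrow> complex \<Rightarrow> complex) \<Rightarrow> (complex \<Rightarrow> complex \<Rightarrow> complex) \<Rightarrow> complex \<Rightarrow> complex fps" where
  "hamiltonian_series n \<mu> h z =
     subst_series (structure_series n (\<lambda>k. \<mu> k z)) (\<lambda>i j. taylor_coeff i j (h z))"

context
  fixes U :: "complex set" and h :: "complex \<Rightarrow> complex \<Rightarrow> complex"
    and n :: nat and \<mu> :: "nat \<Rightarrow> complex \<Rightarrow> complex"
  assumes U: "open U" and h: "smooth_on (U \<times> UNIV) (\<lambda>(z, p). h z p)"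
    and \<mu>: "\<And>k. k \<in> {2..n} \<Longrightarrow> smooth_on U (\<mu> k)"
begin

lemma smooth_taylor_coeff_h: "smooth_on U (\<lambda>z. taylor_coeff i j (h z))"
  using smooth_taylor_coeff[OF U h] by simp

lemma smooth_structure_series: "smooth_on U (\<lambda>z. structure_series n (\<lambda>k. \<mu> k z) $ m)"
  using \<mu>[of "m + 1"] by (cases "1 \<le> m \<and> m < n") (auto simp: structure_series_nth)

lemma smooth_structure_series_power: "smooth_on U (\<lambda>z. (structure_series n (\<lambda>k. \<mu> k z) ^ j) $ m)"
proof (induction j arbitrary: m)
  case 0 then show ?case by (cases m) simp_all
next
  case (Suc j)
  then show ?case
    by (simp add: fps_mult_nth) (intro smooth_on_sum smooth_on_mult smooth_structure_series Suc U)
qed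

lemma smooth_hamiltonian_series: "smooth_on U (\<lambda>z. hamiltonian_series n \<mu> h z $ m)"
proof -
  have "smooth_on U (\<lambda>z. (fps_X ^ i * structure_series n (\<lambda>k. \<mu> k z) ^ j) $ m)" for i j
    using smooth_structure_series_power by (cases "m < i") (simp_all add: fps_X_power_mult_nth)
  then show ?thesis
    unfolding hamiltonian_series_def subst_series_nth[OF structure_series_0 order_refl] subst_sum_nth
    by (intro smooth_on_sum smooth_on_mult smooth_taylor_coeff_h U)
qed

text \<open>Chain rules for w(z,p) = h(z, p, M(z,p)) along p, z and z-bar. In all three the
  dependence through M has the p-bar-derivative of h as common factor.\<close>

lemma hamiltonian_series_derivatives:
  assumes z: "z \<in> U"
  defines "M \<equiv> structure_series n (\<lambda>k. \<mu> k z)"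
  shows "fps_deriv (hamiltonian_series n \<mu> h z) =
      subst_series M (\<lambda>i j. taylor_coeff i j (\<lambda>p. del2 (\<lambda>(z, p). h z p) (z, p))) +
      subst_series M (\<lambda>i j. taylor_coeff i j (\<lambda>p. delbar2 (\<lambda>(z, p). h z p) (z, p))) * fps_deriv M"
    and "Abs_fps (\<lambda>m. del (\<lambda>z. hamiltonian_series n \<mu> h z $ m) z) =
      subst_series M (\<lambda>i j. taylor_coeff i j (\<lambda>p. del1 (\<lambda>(z, p). h z p) (z, p))) +
      subst_series M (\<lambda>i j. taylor_coeff i j (\<lambda>p. delbar2 (\<lambda>(z, p). h z p) (z, p))) *
        structure_series n (\<lambda>k. del (\<mu> k) z)"
    and "Abs_fps (\<lambda>m. delbar (\<lambda>z. hamiltonian_series n \<mu> h z $ m) z) =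
      subst_series M (\<lambda>i j. taylor_coeff i j (\<lambda>p. delbar1 (\<lambda>(z, p). h z p) (z, p))) +
      subst_series M (\<lambda>i j. taylor_coeff i j (\<lambda>p. delbar2 (\<lambda>(z, p). h z p) (z, p))) *
        structure_series n (\<lambda>k. delbar (\<mu> k) z)"
proof -
  note P = taylor_coeff_partials[OF U h z, unfolded split_conv]
  have M0: "M $ 0 = 0" by (simp add: M_def)
  show "fps_deriv (hamiltonian_series n \<mu> h z) =
      subst_series M (\<lambda>i j. taylor_coeff i j (\<lambda>p. del2 (\<lambda>(z, p). h z p) (z, p))) +
      subst_series M (\<lambda>i j. taylor_coeff i j (\<lambda>p. delbar2 (\<lambda>(z, p). h z p) (z, p))) * fps_deriv M"
    unfolding P hamiltonian_series_def M_def[symmetric] by (rule fps_deriv_subst_series[OF M0])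
  have Md: "(\<lambda>w. structure_series n (\<lambda>k. \<mu> k w) $ m) differentiable (at z)" for m
    by (rule smooth_on_imp_differentiable[OF smooth_structure_series z])
  have hd: "(\<lambda>w. taylor_coeff i j (h w)) differentiable (at z)" for i j
    by (rule smooth_on_imp_differentiable[OF smooth_taylor_coeff_h z])
  have dM: "del (\<lambda>w. structure_series n (\<lambda>k. \<mu> k w) $ m) z = structure_series n (\<lambda>k. del (\<mu> k) z) $ m"
    "delbar (\<lambda>w. structure_series n (\<lambda>k. \<mu> k w) $ m) z = structure_series n (\<lambda>k. delbar (\<mu> k) z) $ m" for m
    unfolding structure_series_nth using del_const by (cases "1 \<le> m \<and> m < n"; simp only: if_True if_False simp_thms)+
  note D = diff_subst_series_nth(2)[OF _ structure_series_0 Md _ hd]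
  show "Abs_fps (\<lambda>m. del (\<lambda>z. hamiltonian_series n \<mu> h z $ m) z) =
      subst_series M (\<lambda>i j. taylor_coeff i j (\<lambda>p. del1 (\<lambda>(z, p). h z p) (z, p))) +
      subst_series M (\<lambda>i j. taylor_coeff i j (\<lambda>p. delbar2 (\<lambda>(z, p). h z p) (z, p))) *
        structure_series n (\<lambda>k. del (\<mu> k) z)"
    unfolding P hamiltonian_series_def M_def
    by (rule fps_ext) (simp only: fps_nth_Abs_fps fps_add_nth D[OF disjI1[OF refl] dM(1) refl])
  show "Abs_fps (\<lambda>m. delbar (\<lambda>z. hamiltonian_series n \<mu> h z $ m) z) =
      subst_series M (\<lambda>i j. taylor_coeff i j (\<lambda>p. delbar1 (\<lambda>(z, p). h z p) (z, p))) +
      subst_series M (\<lambda>i j. taylor_coeff i j (\<lambda>p. delbar2 (\<lambda>(z, p). h z p) (z, p))) *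
        structure_series n (\<lambda>k. delbar (\<mu> k) z)"
    unfolding P hamiltonian_series_def M_def
    by (rule fps_ext) (simp only: fps_nth_Abs_fps fps_add_nth D[OF disjI2[OF refl] dM(2) refl])
qed

lemma smooth_partials:
  assumes "z \<in> U"
  shows "smooth_on UNIV (\<lambda>p. wirtinger s u v (\<lambda>(z, p). h z p) (z, p))"
  by (rule smooth_on_slice[OF smooth_on_wirtinger[OF open_slab[OF U h] h] U assms])

lemma partials_h:
  assumes "z \<in> U"
  shows "del (\<lambda>w. h w p) z = del1 (\<lambda>(z, p). h z p) (z, p)" "delbar (\<lambda>w. h w p) z = delbar1 (\<lambda>(z, p). h z p) (z, p)"
    and "del (h z) p = del2 (\<lambda>(z, p). h z p) (z, p)" "delbar (h z) p = delbar2 (\<lambda>(z, p). h z p) (z, p)"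
  using partial_wirtinger[OF smooth_on_imp_differentiable[OF h, of "(z, p)"]] assms by simp_all

lemma del_poly:
  fixes c :: "nat \<Rightarrow> complex"
  shows "(\<lambda>p. \<Sum>k=2..n. c k * p ^ (k - 1)) differentiable (at p)"
    and "del (\<lambda>p. \<Sum>k=2..n. c k * p ^ (k - 1)) p = (\<Sum>k=2..n. of_nat (k - 1) * c k * p ^ (k - 1 - 1))"
    and "delbar (\<lambda>p. \<Sum>k=2..n. c k * p ^ (k - 1)) p = 0"
proof -
  have "((\<lambda>p. c k * p ^ (k - 1)) has_field_derivative of_nat (k - 1) * c k * p ^ (k - 1 - 1)) (at p)" for k
    by (rule DERIV_cong[OF DERIV_cmult[OF DERIV_power[OF DERIV_ident]]]) (simp add: mult_ac)
  then have D: "((\<lambda>p. \<Sum>k=2..n. c k * p ^ (k - 1)) has_field_derivative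
      (\<Sum>k=2..n. of_nat (k - 1) * c k * p ^ (k - 1 - 1))) (at p)"
    by (intro DERIV_sum)
  then show "(\<lambda>p. \<Sum>k=2..n. c k * p ^ (k - 1)) differentiable (at p)"
    unfolding has_field_derivative_def differentiable_def by blast
  show "del (\<lambda>p. \<Sum>k=2..n. c k * p ^ (k - 1)) p = (\<Sum>k=2..n. of_nat (k - 1) * c k * p ^ (k - 1 - 1))"
    "delbar (\<lambda>p. \<Sum>k=2..n. c k * p ^ (k - 1)) p = 0"
    using del_holomorphic[OF D] by simp_all
qed

text \<open>For f = -p-bar + M the bracket is h_p del M - h_z M' + h_p-bar delbar M + h_z-bar.
  Rewriting it by derivatives of w adds the products of h_p-bar, del M and M' twice, with opposite
  signs.\<close>

lemma poisson_series:
  assumes z: "z \<in> U"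
  defines "M \<equiv> structure_series n (\<lambda>k. \<mu> k z)"
  shows "subst_series M (\<lambda>i j. taylor_coeff i j
      (poisson h (\<lambda>w p. - cnj p + (\<Sum>k=2..n. \<mu> k w * p ^ (k - 1))) z)) =
    structure_series n (\<lambda>k. del (\<mu> k) z) * fps_deriv (hamiltonian_series n \<mu> h z)
    - fps_deriv M * Abs_fps (\<lambda>m. del (\<lambda>z. hamiltonian_series n \<mu> h z $ m) z)
    + Abs_fps (\<lambda>m. delbar (\<lambda>z. hamiltonian_series n \<mu> h z $ m) z)"
proof -
  let ?F = "\<lambda>(z, p). h z p"
  let ?f = "\<lambda>w p. - cnj p + (\<Sum>k=2..n. \<mu> k w * p ^ (k - 1))"
  let ?S = "\<lambda>G. subst_series M (\<lambda>i j. taylor_coeff i j G)"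
  have M0: "M $ 0 = 0" by (simp add: M_def)
  have \<mu>d: "\<mu> k differentiable (at z)" if "k \<in> {2..n}" for k
    by (rule smooth_on_imp_differentiable[OF \<mu>[OF that] z])
  have f1: "del (\<lambda>w. ?f w p) z = (\<Sum>k=2..n. del (\<mu> k) z * p ^ (k - 1))"
    "delbar (\<lambda>w. ?f w p) z = (\<Sum>k=2..n. delbar (\<mu> k) z * p ^ (k - 1))" for p
  proof -
    have t: "(\<lambda>w. \<mu> k w * p ^ (k - 1)) differentiable (at z)" if "k \<in> {2..n}" for k
      by (intro differentiable_mult \<mu>d that) simp
    then have s: "(\<lambda>w. \<Sum>k=2..n. \<mu> k w * p ^ (k - 1)) differentiable (at z)"
      by (intro differentiable_sum) auto
    have m: "del (\<lambda>w. \<mu> k w * p ^ (k - 1)) z = del (\<mu> k) z * p ^ (k - 1)"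
      "delbar (\<lambda>w. \<mu> k w * p ^ (k - 1)) z = delbar (\<mu> k) z * p ^ (k - 1)" if "k \<in> {2..n}" for k
      using del_mult[OF \<mu>d[OF that], of "\<lambda>_. p ^ (k - 1)"] by simp_all
    show "del (\<lambda>w. ?f w p) z = (\<Sum>k=2..n. del (\<mu> k) z * p ^ (k - 1))"
      "delbar (\<lambda>w. ?f w p) z = (\<Sum>k=2..n. delbar (\<mu> k) z * p ^ (k - 1))"
      by (simp_all only: del_add[OF differentiable_const s] del_const add_0 del_sum[OF t] m cong: sum.cong)
  qed
  have f2: "del (?f z) p = (\<Sum>k=2..n. of_nat (k - 1) * \<mu> k z * p ^ (k - 1 - 1))" "delbar (?f z) p = - 1" for p
  proof -
    have c: "(\<lambda>p. - cnj p) differentiable (at p)" "cnj differentiable (at p)"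
      using bounded_linear_imp_differentiable[OF bounded_linear_cnj] by auto
    show "del (?f z) p = (\<Sum>k=2..n. of_nat (k - 1) * \<mu> k z * p ^ (k - 1 - 1))" "delbar (?f z) p = - 1"
      unfolding del_add[OF c(1) del_poly(1)] del_poly del_minus[OF c(2)] del_ident by simp_all
  qed
  \<comment> \<open>Since f has p-bar-derivative -1, the last term of the bracket becomes a plain
    z-bar-derivative of h.\<close>
  have pb: "poisson h ?f z = (\<lambda>p. ((\<Sum>k=2..n. del (\<mu> k) z * (p ^ (k - 1) * del2 ?F (z, p)))
      - (\<Sum>k=2..n. (of_nat (k - 1) * \<mu> k z) * (p ^ (k - 1 - 1) * del1 ?F (z, p))))
      + ((\<Sum>k=2..n. delbar (\<mu> k) z * (p ^ (k - 1) * delbar2 ?F (z, p))) + delbar1 ?F (z, p)))"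
    unfolding poisson_def partials_h[OF z] f1 f2
    by (rule ext) (simp add: sum_distrib_left sum_distrib_right mult_ac)
  note sp = smooth_partials[OF z]
  have lin: "?S (\<lambda>p. (G1 p - G2 p) + (G3 p + G4 p)) = ?S G1 - ?S G2 + (?S G3 + ?S G4)"
    if "smooth_on UNIV G1" "smooth_on UNIV G2" "smooth_on UNIV G3" "smooth_on UNIV G4" for G1 G2 G3 G4
    using that smooth_on_diff[OF open_UNIV that(1,2)] smooth_on_add[OF open_UNIV that(3,4)]
    by (simp add: taylor_coeff_add taylor_coeff_diff subst_series_linear)
  have dM: "(\<Sum>k=2..n. fps_const (of_nat (k - 1) * \<mu> k z) * fps_X ^ (k - 1 - 1)) = fps_deriv M"
    unfolding M_def structure_series_altdef fps_deriv_sum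
    by (intro sum.cong refl) (simp add: fps_deriv_power mult_ac flip: fps_const_mult)
  have "?S (poisson h ?f z) =
      structure_series n (\<lambda>k. del (\<mu> k) z) * ?S (\<lambda>p. del2 ?F (z, p))
      - fps_deriv M * ?S (\<lambda>p. del1 ?F (z, p))
      + (structure_series n (\<lambda>k. delbar (\<mu> k) z) * ?S (\<lambda>p. delbar2 ?F (z, p)) + ?S (\<lambda>p. delbar1 ?F (z, p)))"
    unfolding pb lin[OF smooth_poly_mult[OF sp] smooth_poly_mult[OF sp] smooth_poly_mult[OF sp] sp]
      subst_series_taylor_poly_mult[OF M0 finite_atLeastAtMost sp] dM structure_series_altdef ..
  \<comment> \<open>The two cross terms with the p-bar-derivative of h cancel in the final
    normalisation.\<close>
  then show ?thesis
    unfolding hamiltonian_series_derivatives[OF z] M_def[symmetric] by (simp add: algebra_simps)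
qed

end

section \<open>Hamiltonians vanishing on the zero-section\<close>

context
  fixes U :: "complex set" and h :: "complex \<Rightarrow> complex \<Rightarrow> complex"
    and n :: nat and \<mu> :: "nat \<Rightarrow> complex \<Rightarrow> complex"
  assumes U: "open U" and h: "smooth_on (U \<times> UNIV) (\<lambda>(z, p). h z p)"
    and \<mu>: "\<And>k. k \<in> {2..n} \<Longrightarrow> smooth_on U (\<mu> k)"
    and h0: "\<And>z. z \<in> U \<Longrightarrow> h z 0 = 0"
begin

lemma hamiltonian_series_0: "z \<in> U \<Longrightarrow> hamiltonian_series n \<mu> h z $ 0 = 0"
  by (simp add: hamiltonian_series_def subst_series_def subst_sum_nth taylor_coeff_def h0)

lemma poisson_series_nth:
  assumes z: "z \<in> U" and m: "m < n"
  shows "subst_series (structure_series n (\<lambda>k. \<mu> k z)) (\<lambda>i j. taylor_coeff i j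
      (poisson h (\<lambda>w p. - cnj p + (\<Sum>k=2..n. \<mu> k w * p ^ (k - 1))) z)) $ m =
    (if m = 0 then 0 else variation \<mu> (\<lambda>m z. hamiltonian_series n \<mu> h z $ m) m z)"
proof -
  define W where "W = (\<lambda>m z. hamiltonian_series n \<mu> h z $ m)"
  let ?M = "structure_series n (\<lambda>k. \<mu> k z)"
  let ?DM = "structure_series n (\<lambda>k. del (\<mu> k) z)"
  have W0: "W 0 z = 0" "del (W 0) z = 0" "delbar (W 0) z = 0"
    using del_cong[OF U z, of "W 0" "\<lambda>_. 0"] hamiltonian_series_0 z by (simp_all add: W_def)
  have r: "{0..m} = insert 0 {1..m}" by auto
  have 1: "(?DM * fps_deriv (hamiltonian_series n \<mu> h z)) $ m =
      (\<Sum>i=1..m. of_nat (m + 1 - i) * del (\<mu> (i + 1)) z * W (m + 1 - i) z)"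
  proof -
    have "(?DM * fps_deriv (hamiltonian_series n \<mu> h z)) $ m =
        (\<Sum>i=1..m. ?DM $ i * fps_deriv (hamiltonian_series n \<mu> h z) $ (m - i))"
      unfolding fps_mult_nth r by simp
    also have "\<dots> = (\<Sum>i=1..m. of_nat (m + 1 - i) * del (\<mu> (i + 1)) z * W (m + 1 - i) z)"
      using m by (intro sum.cong refl) (auto simp: structure_series_nth W_def Suc_diff_le)
    finally show ?thesis .
  qed
  have 2: "(fps_deriv ?M * Abs_fps (\<lambda>m. del (W m) z)) $ m = (\<Sum>i=1..m. of_nat i * \<mu> (i + 1) z * del (W (m + 1 - i)) z)"
  proof -
    have "(fps_deriv ?M * Abs_fps (\<lambda>m. del (W m) z)) $ m = (\<Sum>i=0..m. of_nat (i + 1) * ?M $ (i + 1) * del (W (m - i)) z)"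
      by (simp add: fps_mult_nth)
    \<comment> \<open>After reindexing, the last term i = m + 1 contains del w_0 and
      vanishes.\<close>
    also have "\<dots> = (\<Sum>i=1..m + 1. of_nat i * ?M $ i * del (W (m + 1 - i)) z)"
      by (rule sum.reindex_bij_witness[of _ "\<lambda>i. i - 1" "\<lambda>i. i + 1"]) auto
    also have "\<dots> = (\<Sum>i=1..m. of_nat i * ?M $ i * del (W (m + 1 - i)) z)"
      by (simp add: W0)
    also have "\<dots> = (\<Sum>i=1..m. of_nat i * \<mu> (i + 1) z * del (W (m + 1 - i)) z)"
      using m by (intro sum.cong refl) (auto simp: structure_series_nth)
    finally show ?thesis .
  qed
  have "subst_series ?M (\<lambda>i j. taylor_coeff i j
      (poisson h (\<lambda>w p. - cnj p + (\<Sum>k=2..n. \<mu> k w * p ^ (k - 1))) z)) $ m =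
      (?DM * fps_deriv (hamiltonian_series n \<mu> h z)) $ m - (fps_deriv ?M * Abs_fps (\<lambda>m. del (W m) z)) $ m + delbar (W m) z"
    by (subst poisson_series[OF U h _ z], erule \<mu>) (simp add: W_def)
  also have "\<dots> = (if m = 0 then 0 else variation \<mu> W m z)"
    unfolding 1 2 by (simp add: variation_def sum_subtractf W0)
  finally show ?thesis by (simp add: W_def)
qed

text \<open>The bracket of h with p^n is -n p^(n-1) h_z, and h_z has no constant term because h
  vanishes on the zero-section; this supplies the missing power of p.\<close>

lemma poisson_power_series_nth:
  assumes z: "z \<in> U" and m: "m < n" and M: "M $ 0 = 0"
  shows "subst_series M (\<lambda>i j. taylor_coeff i j (poisson h (\<lambda>w p. p ^ n) z)) $ m = 0"
proof -
  let ?G = "\<lambda>p. del1 (\<lambda>(z, p). h z p) (z, p)"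
  have d: "del (\<lambda>p. p ^ n) p = of_nat n * p ^ (n - 1)" "delbar (\<lambda>p. p ^ n) p = 0" for p
  proof -
    have "((\<lambda>p. p ^ n) has_field_derivative of_nat n * (1 * p ^ (n - Suc 0))) (at p)"
      by (rule DERIV_power[OF DERIV_ident])
    from del_holomorphic[OF this] show "del (\<lambda>p. p ^ n) p = of_nat n * p ^ (n - 1)" "delbar (\<lambda>p. p ^ n) p = 0"
      by simp_all
  qed
  have ph: "del (\<lambda>w. h w p) z = ?G p" for p
    using partial_wirtinger(1)[OF smooth_on_imp_differentiable[OF h, of "(z, p)"]] z by simp
  have sp: "smooth_on UNIV ?G"
    by (rule smooth_on_slice[OF smooth_on_wirtinger[OF open_slab[OF U h] h] U z])
  \<comment> \<open>The sum over a one-element set brings the expression into the form of the lemma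
    on polynomial factors.\<close>
  have "poisson h (\<lambda>w p. p ^ n) z = (\<lambda>p. \<Sum>k\<in>{()}. (- of_nat n) * (p ^ (n - 1) * ?G p))"
    unfolding poisson_def ph d by (simp add: mult_ac)
  then have "subst_series M (\<lambda>i j. taylor_coeff i j (poisson h (\<lambda>w p. p ^ n) z)) =
      (\<Sum>k\<in>{()}. fps_const (- of_nat n) * fps_X ^ (n - 1)) * subst_series M (\<lambda>i j. taylor_coeff i j ?G)"
    by (simp only: subst_series_taylor_poly_mult[OF M finite.insertI[OF finite.emptyI] sp])
  moreover have "subst_series M (\<lambda>i j. taylor_coeff i j ?G) $ 0 = 0"
  proof -
    have "?G 0 = del (\<lambda>w. h w 0) z" by (simp add: ph)
    also have "\<dots> = 0" using del_cong(1)[OF U z, of "\<lambda>w. h w 0" "\<lambda>_. 0"] h0 by simp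
    finally show ?thesis by (simp add: subst_series_def subst_sum_nth taylor_coeff_def)
  qed
  moreover have "m < n - 1 \<or> m - (n - 1) = 0" using m by auto
  moreover have "(fps_const c * fps_X ^ k * S) $ m = c * (if m < k then 0 else S $ (m - k))"
    for c :: complex and k S
    by (simp add: mult.assoc fps_X_power_mult_nth)
  ultimately show ?thesis by (auto simp only: sum.insert sum.empty finite.emptyI empty_iff add_0_right if_True if_False mult_zero_right not_False_eq_True split: if_splits)
qed

end

lemma smooth_variation:
  assumes U: "open U" and \<mu>: "\<And>k. k \<in> {2..m + 1} \<Longrightarrow> smooth_on U (\<mu> k)"
    and w: "\<And>m. smooth_on U (w m)"
  shows "smooth_on U (variation \<mu> w m)"
proof -
  have s: "smooth_on U (\<mu> (i + 1))" if "i \<in> {1..m}" for i using \<mu>[of "i + 1"] that by auto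
  show ?thesis unfolding variation_def[abs_def]
    by (intro smooth_on_add smooth_on_sum smooth_on_diff smooth_on_mult smooth_on_const smooth_on_del w s U)
qed

section \<open>Duality\<close>

definition conservation ::
  "nat \<Rightarrow> (nat \<Rightarrow> complex \<Rightarrow> complex) \<Rightarrow> (nat \<Rightarrow> complex \<Rightarrow> complex) \<Rightarrow> nat \<Rightarrow> complex \<Rightarrow> complex" where
  "conservation n \<mu> t k z =
     (- delbar (t k) z + \<mu> 2 z * del (t k) z + of_nat k * del (\<mu> 2) z * t k z)
     + (\<Sum>l=1..n - k. of_nat (l + k) * del (\<mu> (l + 2)) z * t (k + l) z
                     + of_nat (l + 1) * \<mu> (l + 2) z * del (t (k + l)) z)"

text \<open>The two terms with \<mu>_2 are the missing summand l = 0, so with i = l + 1 the equation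
  becomes a single sum.\<close>

lemma conservation_altdef:
  assumes "j + 1 \<le> n"
  shows "conservation n \<mu> t (j + 1) z = - delbar (t (j + 1)) z +
    (\<Sum>i=1..n - j. of_nat (j + i) * del (\<mu> (i + 1)) z * t (j + i) z + of_nat i * \<mu> (i + 1) z * del (t (j + i)) z)"
proof -
  let ?f = "\<lambda>i. of_nat (j + i) * del (\<mu> (i + 1)) z * t (j + i) z + of_nat i * \<mu> (i + 1) z * del (t (j + i)) z"
  have "(\<Sum>i=1..n - j. ?f i) = ?f 1 + (\<Sum>i=2..n - j. ?f i)"
    using assms by (simp add: sum.atLeast_Suc_atMost numeral_2_eq_2)
  also have "(\<Sum>i=2..n - j. ?f i) = (\<Sum>l=1..n - (j + 1). ?f (l + 1))"
    by (rule sum.reindex_bij_witness[of _ "\<lambda>l. l + 1" "\<lambda>i. i - 1"]) auto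
  finally show ?thesis by (simp add: conservation_def add_ac numeral_2_eq_2)
qed

lemma smooth_conservation:
  assumes U: "open U" and \<mu>: "\<And>k. k \<in> {2..n} \<Longrightarrow> smooth_on U (\<mu> k)"
    and t: "\<And>k. k \<in> {2..n} \<Longrightarrow> smooth_on U (t k)" and k: "k \<in> {2..n}"
  shows "smooth_on U (conservation n \<mu> t k)"
proof -
  have s: "smooth_on U (\<mu> 2)" "smooth_on U (t k)" using k by (auto intro: \<mu> t)
  have s': "smooth_on U (\<mu> (l + 2))" "smooth_on U (t (k + l))" if "l \<in> {1..n - k}" for l
    using k that by (auto intro!: \<mu> t)
  show ?thesis unfolding conservation_def[abs_def]
    by (intro smooth_on_add smooth_on_minus smooth_on_sum smooth_on_mult smooth_on_const smooth_on_del s s' U)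
qed

text \<open>This and \<open>flux2\<close> are the boundary terms of the integration by parts: moving
  delbar off w leaves a (1,0)-form, moving del off w leaves a (0,1)-form.\<close>

definition flux1 :: "nat \<Rightarrow> (nat \<Rightarrow> complex \<Rightarrow> complex) \<Rightarrow> (nat \<Rightarrow> complex \<Rightarrow> complex) \<Rightarrow> complex \<Rightarrow> complex" where
  "flux1 n t w z = (\<Sum>m=1..<n. t (m + 1) z * w m z)"

definition flux2 :: "nat \<Rightarrow> (nat \<Rightarrow> complex \<Rightarrow> complex) \<Rightarrow> (nat \<Rightarrow> complex \<Rightarrow> complex) \<Rightarrow>
    (nat \<Rightarrow> complex \<Rightarrow> complex) \<Rightarrow> complex \<Rightarrow> complex" where
  "flux2 n \<mu> t w z = (\<Sum>m=1..<n. \<Sum>i=1..m. - of_nat i * (\<mu> (i + 1) z * w (m + 1 - i) z * t (m + 1) z))"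

lemma smooth_flux:
  assumes U: "open U" and \<mu>: "\<And>k. k \<in> {2..n} \<Longrightarrow> smooth_on U (\<mu> k)"
    and t: "\<And>k. k \<in> {2..n} \<Longrightarrow> smooth_on U (t k)" and w: "\<And>m. smooth_on U (w m)"
  shows "smooth_on U (flux1 n t w)" "smooth_on U (flux2 n \<mu> t w)"
proof -
  have t': "smooth_on U (t (m + 1))" if "m \<in> {1..<n}" for m using that t[of "m + 1"] by auto
  have \<mu>': "smooth_on U (\<mu> (i + 1))" if "m \<in> {1..<n}" "i \<in> {1..m}" for m i using that \<mu>[of "i + 1"] by auto
  show "smooth_on U (flux1 n t w)" unfolding flux1_def[abs_def]
    by (intro smooth_on_sum smooth_on_mult t' w U)
  show "smooth_on U (flux2 n \<mu> t w)" unfolding flux2_def[abs_def]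
    by (intro smooth_on_sum smooth_on_mult smooth_on_const t' \<mu>' w U)
qed

text \<open>The operators in the variations and in the equations are formally adjoint to each other.\<close>

lemma pairing_by_parts:
  assumes U: "open U" and \<mu>: "\<And>k. k \<in> {2..n} \<Longrightarrow> smooth_on U (\<mu> k)"
    and t: "\<And>k. k \<in> {2..n} \<Longrightarrow> smooth_on U (t k)" and w: "\<And>m. smooth_on U (w m)" and z: "z \<in> U"
  shows "(\<Sum>k=2..n. t k z * variation \<mu> w (k - 1) z) =
    (\<Sum>m=1..<n. w m z * conservation n \<mu> t (m + 1) z) + (delbar (flux1 n t w) z + del (flux2 n \<mu> t w) z)"
proof -
  have td: "t (m + 1) differentiable (at z)" if "m \<in> {1..<n}" for m
    using that t[of "m + 1"] by (intro smooth_on_imp_differentiable[OF _ z]) auto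
  have \<mu>d: "\<mu> (i + 1) differentiable (at z)" if "m \<in> {1..<n}" "i \<in> {1..m}" for m i
    using that \<mu>[of "i + 1"] by (intro smooth_on_imp_differentiable[OF _ z]) auto
  have wd: "w m differentiable (at z)" for m by (rule smooth_on_imp_differentiable[OF w z])
  have f1: "delbar (flux1 n t w) z = (\<Sum>m=1..<n. delbar (t (m + 1)) z * w m z + t (m + 1) z * delbar (w m) z)"
  proof -
    have "(\<lambda>z. t (m + 1) z * w m z) differentiable (at z)" if "m \<in> {1..<n}" for m
      by (intro differentiable_mult td wd that)
    from del_sum(2)[of "{1..<n}" "\<lambda>m z. t (m + 1) z * w m z" z, OF this] have "delbar (flux1 n t w) z = (\<Sum>m=1..<n. delbar (\<lambda>z. t (m + 1) z * w m z) z)"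
      by (simp add: flux1_def[abs_def])
    also have "\<dots> = (\<Sum>m=1..<n. delbar (t (m + 1)) z * w m z + t (m + 1) z * delbar (w m) z)"
      by (intro sum.cong refl del_mult(2) td wd)
    finally show ?thesis .
  qed
  have f2: "del (flux2 n \<mu> t w) z = (\<Sum>m=1..<n. \<Sum>i=1..m. - of_nat i *
      ((del (\<mu> (i + 1)) z * w (m + 1 - i) z + \<mu> (i + 1) z * del (w (m + 1 - i)) z) * t (m + 1) z
        + \<mu> (i + 1) z * w (m + 1 - i) z * del (t (m + 1)) z))"
  proof -
    have d: "(\<lambda>z. \<mu> (i + 1) z * w (m + 1 - i) z * t (m + 1) z) differentiable (at z)"
      if "m \<in> {1..<n}" "i \<in> {1..m}" for m i
      using that by (intro differentiable_mult td \<mu>d[of m] wd)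
    have d': "(\<lambda>z. - of_nat i * (\<mu> (i + 1) z * w (m + 1 - i) z * t (m + 1) z)) differentiable (at z)"
      if "m \<in> {1..<n}" "i \<in> {1..m}" for m i
      by (rule differentiable_mult[OF differentiable_const d[OF that]])
    have d'': "(\<lambda>z. \<Sum>i=1..m. - of_nat i * (\<mu> (i + 1) z * w (m + 1 - i) z * t (m + 1) z)) differentiable (at z)"
      if "m \<in> {1..<n}" for m
      using that by (intro differentiable_sum ballI d') auto
    have "del (flux2 n \<mu> t w) z = (\<Sum>m=1..<n. del (\<lambda>z. \<Sum>i=1..m. - of_nat i * (\<mu> (i + 1) z * w (m + 1 - i) z * t (m + 1) z)) z)"
      unfolding flux2_def[abs_def] by (rule del_sum(1)) (rule d'')
    also have "\<dots> = (\<Sum>m=1..<n. \<Sum>i=1..m. del (\<lambda>z. - of_nat i * (\<mu> (i + 1) z * w (m + 1 - i) z * t (m + 1) z)) z)"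
      by (rule sum.cong[OF refl], rule del_sum(1)) (rule d')
    also have "\<dots> = (\<Sum>m=1..<n. \<Sum>i=1..m. - of_nat i *
      ((del (\<mu> (i + 1)) z * w (m + 1 - i) z + \<mu> (i + 1) z * del (w (m + 1 - i)) z) * t (m + 1) z
        + \<mu> (i + 1) z * w (m + 1 - i) z * del (t (m + 1)) z))"
    proof (intro sum.cong refl)
      fix m i assume mi: "m \<in> {1..<n}" "i \<in> {1..m}"
      have p: "(\<lambda>z. \<mu> (i + 1) z * w (m + 1 - i) z) differentiable (at z)"
        using mi by (intro differentiable_mult \<mu>d[of m] wd)
      show "del (\<lambda>z. - of_nat i * (\<mu> (i + 1) z * w (m + 1 - i) z * t (m + 1) z)) z = - of_nat i *
      ((del (\<mu> (i + 1)) z * w (m + 1 - i) z + \<mu> (i + 1) z * del (w (m + 1 - i)) z) * t (m + 1) z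
        + \<mu> (i + 1) z * w (m + 1 - i) z * del (t (m + 1)) z)"
        unfolding del_cmult(1)[OF d[OF mi]] del_mult(1)[OF p td[OF mi(1)]] del_mult(1)[OF \<mu>d[OF mi] wd] ..
    qed
    finally show ?thesis .
  qed
  let ?g = "\<lambda>j i. w j z * (of_nat (j + i) * del (\<mu> (i + 1)) z * t (j + i) z + of_nat i * \<mu> (i + 1) z * del (t (j + i)) z)"
  have "(\<Sum>m=1..<n. w m z * conservation n \<mu> t (m + 1) z) =
      (\<Sum>m=1..<n. - (delbar (t (m + 1)) z * w m z) + (\<Sum>i=1..n - m. ?g m i))"
  proof (rule sum.cong[OF refl])
    fix m assume "m \<in> {1..<n}"
    then have "m + 1 \<le> n" by auto
    then show "w m z * conservation n \<mu> t (m + 1) z = - (delbar (t (m + 1)) z * w m z) + (\<Sum>i=1..n - m. ?g m i)"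
      by (subst conservation_altdef, assumption, subst distrib_left)
        (simp only: sum_distrib_left mult_minus_right mult.commute[of "w m z" "delbar (t (m + 1)) z"])
  qed
  also have "\<dots> = - (\<Sum>m=1..<n. delbar (t (m + 1)) z * w m z) + (\<Sum>m=1..<n. \<Sum>i=1..n - m. ?g m i)"
    by (simp only: sum.distrib sum_negf)
  \<comment> \<open>The triangle is summed along constant m = j + i - 1, because the factor t_(j+i)
    is then t_(m+1), as in the variation.\<close>
  also have "(\<Sum>m=1..<n. \<Sum>i=1..n - m. ?g m i) = (\<Sum>m=1..<n. \<Sum>i=1..m. ?g (m + 1 - i) i)"
    unfolding sum.Sigma[OF finite_atLeastLessThan ballI[OF finite_atLeastAtMost]]
    by (rule sum.reindex_bij_witness[of _ "\<lambda>(m, i). (m + 1 - i, i)" "\<lambda>(j, i). (j + i - 1, i)"]) auto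
  finally have E: "(\<Sum>m=1..<n. w m z * conservation n \<mu> t (m + 1) z) =
      - (\<Sum>m=1..<n. delbar (t (m + 1)) z * w m z) + (\<Sum>m=1..<n. \<Sum>i=1..m. ?g (m + 1 - i) i)" .
  have "(\<Sum>k=2..n. t k z * variation \<mu> w (k - 1) z) = (\<Sum>m=1..<n. t (m + 1) z * variation \<mu> w m z)"
    by (rule sum.reindex_bij_witness[of _ "\<lambda>m. m + 1" "\<lambda>k. k - 1"]) auto
  also have "\<dots> = (\<Sum>m=1..<n. t (m + 1) z * delbar (w m) z) + (\<Sum>m=1..<n. \<Sum>i=1..m.
      t (m + 1) z * (of_nat (m + 1 - i) * del (\<mu> (i + 1)) z * w (m + 1 - i) z - of_nat i * \<mu> (i + 1) z * del (w (m + 1 - i)) z))"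
    by (simp add: variation_def distrib_left sum_distrib_left sum.distrib)
  also have "(\<Sum>m=1..<n. \<Sum>i=1..m.
      t (m + 1) z * (of_nat (m + 1 - i) * del (\<mu> (i + 1)) z * w (m + 1 - i) z - of_nat i * \<mu> (i + 1) z * del (w (m + 1 - i)) z)) =
      (\<Sum>m=1..<n. \<Sum>i=1..m. ?g (m + 1 - i) i) + del (flux2 n \<mu> t w) z"
    unfolding f2 sum.distrib[symmetric]
  proof (intro sum.cong refl)
    fix m i assume "m \<in> {1..<n}" "i \<in> {1..m}"
    \<comment> \<open>The subtraction is exact since i is at most m. The weight m + 1 on del \<mu>
      in the equation is m + 1 - i from the variation plus i from the divergence.\<close>
    then have e: "m + 1 - i + i = m + 1" and o: "of_nat (m + 1 - i) = (of_nat (m + 1) - of_nat i :: complex)"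
      by (auto simp: of_nat_diff)
    show "t (m + 1) z * (of_nat (m + 1 - i) * del (\<mu> (i + 1)) z * w (m + 1 - i) z - of_nat i * \<mu> (i + 1) z * del (w (m + 1 - i)) z) =
      ?g (m + 1 - i) i + - of_nat i *
      ((del (\<mu> (i + 1)) z * w (m + 1 - i) z + \<mu> (i + 1) z * del (w (m + 1 - i)) z) * t (m + 1) z
        + \<mu> (i + 1) z * w (m + 1 - i) z * del (t (m + 1)) z)"
      unfolding e o by (simp add: algebra_simps del: of_nat_Suc of_nat_add)
  qed
  also have "(\<Sum>m=1..<n. t (m + 1) z * delbar (w m) z) = delbar (flux1 n t w) z - (\<Sum>m=1..<n. delbar (t (m + 1)) z * w m z)"
    unfolding f1 by (simp add: sum.distrib)
  finally show ?thesis unfolding E by (simp add: algebra_simps)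
qed

section \<open>Hamiltonians on the cotangent bundle\<close>

context riemann_surface begin

lemma covector_change:
  assumes "c \<in> A" "d \<in> A" "z \<in> overlap c d"
  shows "covector A c z p = covector A d (transition c d z) (p / deriv (transition c d) z)"
proof -
  have "deriv (transition c e) z = deriv (transition d e) (transition c d z) * deriv (transition c d) z"
    if "e \<in> A" "chart_point c z \<in> fst e" for e
    using that assms overlapD[OF assms(3)] by (intro deriv_transition_cocycle) (auto simp: overlap_iff)
  then show ?thesis unfolding covector_def
    by (auto simp: fun_eq_iff chart_point_transition[OF assms] divide_divide_eq_left mult.commute)
qed

text \<open>The fibre coordinate changes by a constant factor at each base point; it is written as a
  left multiple to fit \<open>taylor_coeff_scale\<close>.\<close>

lemma in_chart_change:
  assumes "c \<in> A" "d \<in> A" "z \<in> overlap c d"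
  shows "in_chart A c H z p = in_chart A d H (transition c d z) (inverse (deriv (transition c d) z) * p)"
  unfolding in_chart_def covector_change[OF assms] by (simp add: divide_inverse mult.commute)

lemma smooth_in_chart:
  assumes "smooth_cotangent A H" "c \<in> A"
  shows "smooth_on (chart_image c \<times> UNIV) (\<lambda>(z, p). in_chart A c H z p)"
proof -
  have "smooth_on (chart_image c \<times> UNIV) (\<lambda>x. complex_of_real (case x of (z, p) \<Rightarrow> H (covector A c z p)))"
    using assms open_chart_image[OF assms(2)] unfolding smooth_cotangent_def
    by (intro smooth_on_of_real open_Times) auto
  then show ?thesis by (simp add: in_chart_def case_prod_beta')
qed

lemma in_chart_zero_section:
  assumes "\<forall>\<xi>\<in>zero_section A. H \<xi> = 0" "c \<in> A" "z \<in> chart_image c"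
  shows "in_chart A c H z 0 = 0"
proof -
  have "covector A c z 0 \<in> zero_section A" unfolding zero_section_def using assms(2,3) by blast
  with assms(1) show ?thesis by (simp add: in_chart_def)
qed

lemma differentials_smooth: "s \<in> differentials A k l \<Longrightarrow> c \<in> A \<Longrightarrow> smooth_on (chart_image c) (s c)"
  by (simp add: differentials_def smooth_family_def)

lemma differentials_zero: "s \<in> differentials A k l \<Longrightarrow> \<not> (c \<in> A \<and> z \<in> chart_image c) \<Longrightarrow> s c z = 0"
  unfolding differentials_def smooth_family_def by blast

lemma differentials_change:
  "s \<in> differentials A k l \<Longrightarrow> c \<in> A \<Longrightarrow> d \<in> A \<Longrightarrow> z \<in> overlap c d \<Longrightarrow>
   s c z = s d (transition c d z) * deriv (transition c d) z powi k * cnj (deriv (transition c d) z) powi l"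
  by (simp add: differentials_def)

section \<open>Symbol and variation of a Hamiltonian on the surface\<close>

context
  fixes n :: nat and \<mu> :: "'a family_tuple" and H :: "'a covector \<Rightarrow> real"
  assumes \<mu>: "\<mu> \<in> (\<Pi>\<^sub>E k\<in>{2..n}. differentials A (1 - int k) 1)"
    and H: "smooth_cotangent A H" and H0: "\<forall>\<xi>\<in>zero_section A. H \<xi> = 0"
begin

text \<open>The coefficient w_m in each chart; by \<open>symbol_change\<close> it transforms as a
  differential of type (-m,0).\<close>

definition symbol :: "nat \<Rightarrow> 'a local_family" where
  "symbol m c z = hamiltonian_series n (\<lambda>k. \<mu> k c) (in_chart A c H) z $ m"

text \<open>Cut off to zero outside the chart images, in line with the unique representation of
  differentials.\<close>

definition hamiltonian_variation :: "'a family_tuple" where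
  "hamiltonian_variation = (\<lambda>k\<in>{2..n}. \<lambda>c z. if c \<in> A \<and> z \<in> chart_image c
     then variation (\<lambda>k. \<mu> k c) (\<lambda>m. symbol m c) (k - 1) z else 0)"

lemma \<mu>_diff: "k \<in> {2..n} \<Longrightarrow> \<mu> k \<in> differentials A (1 - int k) 1"
  using \<mu> by auto

lemma \<mu>_smooth: "c \<in> A \<Longrightarrow> k \<in> {2..n} \<Longrightarrow> smooth_on (chart_image c) (\<mu> k c)"
  using differentials_smooth[OF \<mu>_diff] by blast

lemma \<mu>_change:
  assumes "c \<in> A" "d \<in> A" "z \<in> overlap c d" "k \<in> {2..n}"
  shows "deriv (transition c d) z ^ (k - 1) * \<mu> k c z = cnj (deriv (transition c d) z) * \<mu> k d (transition c d z)"
  using differentials_change[OF \<mu>_diff[OF assms(4)] assms(1-3)] assms(4)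
    powi_differential[OF _ deriv_transition_nz[OF assms(1-3)], of k "\<mu> k c z" "\<mu> k d (transition c d z)"]
  by auto

lemma smooth_symbol: "c \<in> A \<Longrightarrow> smooth_on (chart_image c) (symbol m c)"
  unfolding symbol_def[abs_def]
  by (rule smooth_hamiltonian_series[OF open_chart_image smooth_in_chart[OF H]]) (auto intro: \<mu>_smooth)

text \<open>The first generator is always preserved modulo the ideal. The second condition compares
  reductions degree by degree: degree 0 is trivial and degree k - 1 determines the k-th
  component.\<close>

lemma variation_condition:
  assumes c: "c \<in> A" and z: "z \<in> chart_image c"
  shows "taylor n (poisson (in_chart A c H) (\<lambda>w p. p ^ n) z) \<in> structure_of n \<mu> c z"
    and "taylor n (poisson (in_chart A c H) (\<lambda>w p. - cnj p + (\<Sum>k=2..n. \<mu> k c w * p ^ (k - 1))) z)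
             - (\<Sum>k=2..n. fmonom (\<delta> k c z) (k - 1) 0) \<in> structure_of n \<mu> c z \<longleftrightarrow>
      (\<forall>k\<in>{2..n}. \<delta> k c z = variation (\<lambda>k. \<mu> k c) (\<lambda>m. symbol m c) (k - 1) z)"
proof -
  let ?M = "structure_series n (\<lambda>k. \<mu> k c z)"
  have sm: "smooth_on (chart_image c) (\<mu> k c)" if "k \<in> {2..n}" for k by (rule \<mu>_smooth[OF c that])
  have h0: "in_chart A c H w 0 = 0" if "w \<in> chart_image c" for w by (rule in_chart_zero_section[OF H0 c that])
  note o = open_chart_image[OF c] and h = smooth_in_chart[OF H c]
  show "taylor n (poisson (in_chart A c H) (\<lambda>w p. p ^ n) z) \<in> structure_of n \<mu> c z"
    unfolding structure_of_eq structure_ideal_iff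
  proof (intro allI impI)
    fix m assume m: "m < n"
    show "reduce ?M (taylor n (poisson (in_chart A c H) (\<lambda>w p. p ^ n) z)) $ m = 0"
      unfolding reduce_taylor[OF structure_series_0 m]
      by (rule poisson_power_series_nth[OF o h _ h0 z m structure_series_0, where \<mu>="\<lambda>k. \<mu> k c"]) (rule sm)
  qed
  let ?P = "poisson (in_chart A c H) (\<lambda>w p. - cnj p + (\<Sum>k=2..n. \<mu> k c w * p ^ (k - 1))) z"
  have r: "reduce ?M (taylor n ?P) $ m = (if m = 0 then 0 else variation (\<lambda>k. \<mu> k c) (\<lambda>m. symbol m c) m z)"
    if m: "m < n" for m
    unfolding reduce_taylor[OF structure_series_0 m] symbol_def[abs_def]
    by (rule poisson_series_nth[OF o h _ h0 z m, where \<mu>="\<lambda>k. \<mu> k c"]) (rule sm)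
  have e: "(reduce ?M (taylor n ?P) $ m = structure_series n (\<lambda>k. \<delta> k c z) $ m) \<longleftrightarrow>
      (m \<noteq> 0 \<longrightarrow> \<delta> (m + 1) c z = variation (\<lambda>k. \<mu> k c) (\<lambda>m. symbol m c) m z)" if m: "m < n" for m
    unfolding r[OF m] using m by (auto simp: structure_series_nth)
  have "taylor n ?P - (\<Sum>k=2..n. fmonom (\<delta> k c z) (k - 1) 0) \<in> structure_of n \<mu> c z \<longleftrightarrow>
      (\<forall>m<n. reduce ?M (taylor n ?P) $ m = structure_series n (\<lambda>k. \<delta> k c z) $ m)"
    by (simp add: structure_of_eq structure_ideal_iff reduce_diff reduce_structure_variation[simplified])
  also have "\<dots> \<longleftrightarrow> (\<forall>m<n. m \<noteq> 0 \<longrightarrow> \<delta> (m + 1) c z = variation (\<lambda>k. \<mu> k c) (\<lambda>m. symbol m c) m z)"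
    using e by blast
  also have "\<dots> \<longleftrightarrow> (\<forall>k\<in>{2..n}. \<delta> k c z = variation (\<lambda>k. \<mu> k c) (\<lambda>m. symbol m c) (k - 1) z)"
  proof (intro iffI ballI allI impI)
    fix k assume *: "\<forall>m<n. m \<noteq> 0 \<longrightarrow> \<delta> (m + 1) c z = variation (\<lambda>k. \<mu> k c) (\<lambda>m. symbol m c) m z" and "k \<in> {2..n}"
    then have "k - 1 < n" "k - 1 \<noteq> 0" "k - 1 + 1 = k" by auto
    then show "\<delta> k c z = variation (\<lambda>k. \<mu> k c) (\<lambda>m. symbol m c) (k - 1) z" using * by metis
  next
    fix m assume *: "\<forall>k\<in>{2..n}. \<delta> k c z = variation (\<lambda>k. \<mu> k c) (\<lambda>m. symbol m c) (k - 1) z" and "m < n" "m \<noteq> 0"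
    then have "m + 1 \<in> {2..n}" by auto
    with * show "\<delta> (m + 1) c z = variation (\<lambda>k. \<mu> k c) (\<lambda>m. symbol m c) m z" by (metis add_diff_cancel_right')
  qed
  finally show "taylor n ?P - (\<Sum>k=2..n. fmonom (\<delta> k c z) (k - 1) 0) \<in> structure_of n \<mu> c z \<longleftrightarrow>
      (\<forall>k\<in>{2..n}. \<delta> k c z = variation (\<lambda>k. \<mu> k c) (\<lambda>m. symbol m c) (k - 1) z)" .
qed

text \<open>The factors a^(-i) and a-bar^(-j) from the fibre rescaling cancel against those of X^i
  and of M^j, leaving the single factor a^m.\<close>

lemma symbol_change:
  assumes cd: "c \<in> A" "d \<in> A" "z \<in> overlap c d"
  shows "deriv (transition c d) z ^ m * symbol m c z = symbol m d (transition c d z)"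
proof -
  let ?a = "deriv (transition c d) z"
  let ?Mc = "structure_series n (\<lambda>k. \<mu> k c z)"
  let ?Md = "structure_series n (\<lambda>k. \<mu> k d (transition c d z))"
  have a: "?a \<noteq> 0" by (rule deriv_transition_nz[OF cd])
  have Md: "?a ^ l * (?Mc $ l) = cnj ?a * (?Md $ l)" for l
    by (rule structure_series_scale) (rule \<mu>_change[OF cd])
  have "transition c d z \<in> chart_image d" by (rule overlapD[OF transition_in[OF cd]])
  then have sm: "smooth_on UNIV (in_chart A d H (transition c d z))"
    using smooth_on_slice[OF smooth_in_chart[OF H cd(2)] open_chart_image[OF cd(2)]] by simp
  have tc: "taylor_coeff i j (in_chart A c H z) = inverse ?a ^ i * cnj (inverse ?a) ^ j * taylor_coeff i j (in_chart A d H (transition c d z))" for i j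
    unfolding in_chart_change[OF cd, abs_def] by (rule taylor_coeff_scale[OF sm])
  have K: "?a ^ m * (inverse ?a ^ i * cnj (inverse ?a) ^ j * t * (fps_X ^ i * ?Mc ^ j) $ m) = t * (fps_X ^ i * ?Md ^ j) $ m" for i j t
  proof (cases "m < i")
    case False
    then have "?a ^ m = ?a ^ i * ?a ^ (m - i)" by (simp flip: power_add)
    then have "?a ^ m * (inverse ?a ^ i * cnj (inverse ?a) ^ j * t * (?Mc ^ j) $ (m - i)) =
        (?a ^ i * inverse ?a ^ i) * cnj (inverse ?a) ^ j * t * (?a ^ (m - i) * (?Mc ^ j) $ (m - i))"
      by (simp add: mult_ac)
    also have "\<dots> = (?a ^ i * inverse ?a ^ i) * (cnj (inverse ?a) ^ j * cnj ?a ^ j) * (t * (?Md ^ j) $ (m - i))"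
      by (subst scaled_power[OF Md]) (simp add: mult_ac)
    also have "\<dots> = t * (?Md ^ j) $ (m - i)"
    proof -
      have "?a ^ i * inverse ?a ^ i = 1" "cnj (inverse ?a) ^ j * cnj ?a ^ j = 1"
        using a by (simp_all flip: power_mult_distrib)
      then show ?thesis by simp
    qed
    finally show ?thesis using False by (simp add: fps_X_power_mult_nth)
  qed (simp add: fps_X_power_mult_nth)
  show ?thesis
    unfolding symbol_def hamiltonian_series_def subst_series_def fps_nth_Abs_fps subst_sum_nth tc sum_distrib_left K ..
qed

text \<open>Differentiating the transition factors produces second derivatives of T. They cancel
  within each summand, because \<mu>_(i+1) and w_(m+1-i) enter with weights i and m + 1 - i.\<close>

lemma variation_change:
  assumes cd: "c \<in> A" "d \<in> A" "z \<in> overlap c d" and m: "m + 1 \<le> n"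
  shows "deriv (transition c d) z ^ m * variation (\<lambda>k. \<mu> k c) (\<lambda>m. symbol m c) m z =
    cnj (deriv (transition c d) z) * variation (\<lambda>k. \<mu> k d) (\<lambda>m. symbol m d) m (transition c d z)"
proof -
  let ?T = "transition c d"
  let ?a = "deriv ?T z"
  define q where "q = (\<lambda>w. inverse (deriv ?T w))"
  define q' where "q' = - (inverse ?a * deriv (deriv ?T) z * inverse ?a)"
  note o = open_overlap[OF cd(1,2)]
  note T' = deriv_transition_differentiable[OF cd]
  have a: "?a \<noteq> 0" by (rule deriv_transition_nz[OF cd])
  have qd: "(q has_field_derivative q') (at z)"
    unfolding q_def q'_def by (rule DERIV_inverse'[OF T'(1) a])
  have qp: "((\<lambda>w. q w ^ i) has_field_derivative of_nat i * (q' * q z ^ (i - 1))) (at z)" for i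
    using DERIV_power[OF qd, of i] by simp
  have qpd: "(\<lambda>w. q w ^ i) differentiable (at z)" for i
    using qp[of i] unfolding has_field_derivative_def differentiable_def by blast
  have T'cnj: "(\<lambda>w. cnj (deriv ?T w)) differentiable (at z)"
    using has_derivative_cnj[OF differentiable_works[OF T'(2)]] differentiable_def by blast
  have Tz: "?T z \<in> chart_image d" by (rule overlapD[OF transition_in[OF cd]])
  have wc: "symbol j c w = symbol j d (?T w) * q w ^ j" if "w \<in> overlap c d" for j w
    using symbol_change[OF cd(1,2) that, of j] deriv_transition_nz[OF cd(1,2) that]
    by (simp add: q_def field_simps flip: power_inverse)
  have wdiff: "symbol j d differentiable (at (?T z))" for j
    by (rule smooth_on_imp_differentiable[OF smooth_symbol[OF cd(2)] Tz])
  note wpull = differentiable_transition_pullback[OF cd smooth_symbol[OF cd(2)]]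
  have Dw: "del (symbol j c) z = del (symbol j d) (?T z) * ?a * q z ^ j + symbol j d (?T z) * (of_nat j * (q' * q z ^ (j - 1)))"
    "delbar (symbol j c) z = delbar (symbol j d) (?T z) * cnj ?a * q z ^ j" for j
    using del_cong[OF o cd(3) wc[of _ j]] del_mult[OF wpull qpd, of j j]
      del_compose_holomorphic[OF wdiff transition_has_derivative[OF cd], of j] del_holomorphic[OF qp, of j]
    by simp_all
  have \<mu>c: "\<mu> (i + 1) c w = \<mu> (i + 1) d (?T w) * q w ^ i * cnj (deriv ?T w)"
    if "w \<in> overlap c d" "i \<in> {1..m}" for i w
    using \<mu>_change[OF cd(1,2) that(1), of "i + 1"] that(2) m deriv_transition_nz[OF cd(1,2) that(1)]
    by (simp add: q_def field_simps flip: power_inverse)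
  have D\<mu>: "del (\<mu> (i + 1) c) z = (del (\<mu> (i + 1) d) (?T z) * ?a * q z ^ i +
      \<mu> (i + 1) d (?T z) * (of_nat i * (q' * q z ^ (i - 1)))) * cnj ?a" if i: "i \<in> {1..m}" for i
  proof -
    have s: "smooth_on (chart_image d) (\<mu> (i + 1) d)" using i m by (intro \<mu>_smooth cd(2)) auto
    have d: "\<mu> (i + 1) d differentiable (at (?T z))" by (rule smooth_on_imp_differentiable[OF s Tz])
    note p = differentiable_transition_pullback[OF cd s]
    have "del (\<mu> (i + 1) c) z = del (\<lambda>w. \<mu> (i + 1) d (?T w) * q w ^ i * cnj (deriv ?T w)) z"
      by (rule del_cong(1)[OF o cd(3)]) (rule \<mu>c[OF _ i])
    also have "\<dots> = del (\<lambda>w. \<mu> (i + 1) d (?T w) * q w ^ i) z * cnj ?a"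
      using del_mult(1)[OF differentiable_mult[OF p qpd] T'cnj, of i] del_cnj(1)[OF T'(2)] del_holomorphic(2)[OF T'(1)]
      by simp
    finally show ?thesis
      using del_mult(1)[OF p qpd, of i] del_compose_holomorphic(1)[OF d transition_has_derivative[OF cd]]
        del_holomorphic(1)[OF qp, of i] by simp
  qed
  have aq: "?a * q z = 1" using a by (simp add: q_def)
  have apow: "?a ^ m * q z ^ m = 1" using aq by (metis power_mult_distrib power_one)
  have summand: "of_nat (m + 1 - i) * del (\<mu> (i + 1) c) z * symbol (m + 1 - i) c z
      - of_nat i * \<mu> (i + 1) c z * del (symbol (m + 1 - i) c) z =
     q z ^ m * cnj ?a * (of_nat (m + 1 - i) * del (\<mu> (i + 1) d) (?T z) * symbol (m + 1 - i) d (?T z)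
      - of_nat i * \<mu> (i + 1) d (?T z) * del (symbol (m + 1 - i) d) (?T z))" if i: "i \<in> {1..m}" for i
  proof -
    \<comment> \<open>Successor form makes the exponents i - 1 and m - i in the derivatives of q^i
      and q^(m+1-i) explicit.\<close>
    obtain i' where i': "i = Suc i'" using i by (cases i) auto
    obtain j' where j': "m + 1 - i = Suc j'" using i by (cases "m + 1 - i") auto
    have m': "m = i' + Suc j'" using i i' j' by auto
    \<comment> \<open>Here r is the derivative of q: both products contain I J M W r with equal
      powers, so r disappears, and b Q is then replaced by 1.\<close>
    have alg: "J * ((DM * b * Q ^ Suc i + M * (I * (r * Q ^ i))) * C) * (W * Q ^ Suc j)
        - I * (M * Q ^ Suc i * C) * (DW * b * Q ^ Suc j + W * (J * (r * Q ^ j))) =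
        Q ^ (i + Suc j) * C * (b * Q) * (J * DM * W - I * M * DW)"
      for J I DM M b Q r C W DW :: complex and i j
      by (simp add: power_add algebra_simps)
    show ?thesis
      unfolding D\<mu>[OF i] wc[OF cd(3)] \<mu>c[OF cd(3) i] Dw(1) unfolding j' unfolding i' unfolding m'
      by (simp only: diff_Suc_1 alg aq mult_1_right)
  qed
  have "variation (\<lambda>k. \<mu> k c) (\<lambda>m. symbol m c) m z = delbar (symbol m d) (?T z) * cnj ?a * q z ^ m +
      (\<Sum>i=1..m. q z ^ m * cnj ?a * (of_nat (m + 1 - i) * del (\<mu> (i + 1) d) (?T z) * symbol (m + 1 - i) d (?T z)
      - of_nat i * \<mu> (i + 1) d (?T z) * del (symbol (m + 1 - i) d) (?T z)))"
    unfolding variation_def Dw(2) by (intro arg_cong2[where f="(+)"] refl sum.cong summand)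
  also have "\<dots> = q z ^ m * cnj ?a * variation (\<lambda>k. \<mu> k d) (\<lambda>m. symbol m d) m (?T z)"
    unfolding variation_def by (simp only: sum_distrib_left distrib_left mult_ac)
  finally have "variation (\<lambda>k. \<mu> k c) (\<lambda>m. symbol m c) m z =
      q z ^ m * cnj ?a * variation (\<lambda>k. \<mu> k d) (\<lambda>m. symbol m d) m (?T z)" .
  then show ?thesis using apow by (simp flip: mult.assoc)
qed

lemma hamiltonian_variation_differential:
  assumes "k \<in> {2..n}"
  shows "hamiltonian_variation k \<in> differentials A (1 - int k) 1"
proof -
  have "smooth_on (chart_image c) (hamiltonian_variation k c)" if c: "c \<in> A" for c
  proof -
    have "smooth_on (chart_image c) (variation (\<lambda>k. \<mu> k c) (\<lambda>m. symbol m c) (k - 1))"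
      using assms by (intro smooth_variation open_chart_image c smooth_symbol \<mu>_smooth) auto
    then show ?thesis
      by (subst smooth_on_cong[OF open_chart_image[OF c]]) (use assms c in \<open>auto simp: hamiltonian_variation_def\<close>)
  qed
  moreover have "hamiltonian_variation k c z = hamiltonian_variation k d (transition c d z) *
      deriv (transition c d) z powi (1 - int k) * cnj (deriv (transition c d) z) powi 1"
    if cd: "c \<in> A" "d \<in> A" "z \<in> overlap c d" for c d z
  proof -
    have "hamiltonian_variation k c z = variation (\<lambda>k. \<mu> k c) (\<lambda>m. symbol m c) (k - 1) z"
      "hamiltonian_variation k d (transition c d z) = variation (\<lambda>k. \<mu> k d) (\<lambda>m. symbol m d) (k - 1) (transition c d z)"
      using assms cd overlapD[OF cd(3)] overlapD[OF transition_in[OF cd]] by (simp_all add: hamiltonian_variation_def)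
    then show ?thesis
      using variation_change[OF cd, of "k - 1"] assms powi_differential[OF _ deriv_transition_nz[OF cd], of k] by auto
  qed
  ultimately show ?thesis
    using assms by (auto simp: differentials_def smooth_family_def hamiltonian_variation_def)
qed

lemma hamiltonian_variation_in: "hamiltonian_variation \<in> higher_variations A n \<mu>"
proof -
  have "hamiltonian_variation \<in> (\<Pi>\<^sub>E k\<in>{2..n}. differentials A (1 - int k) 1)"
    using hamiltonian_variation_differential by (auto simp: PiE_iff hamiltonian_variation_def)
  moreover have "\<forall>k\<in>{2..n}. hamiltonian_variation k c z = variation (\<lambda>k. \<mu> k c) (\<lambda>m. symbol m c) (k - 1) z"
    if "c \<in> A" "z \<in> chart_image c" for c z
    using that by (simp add: hamiltonian_variation_def)
  ultimately show ?thesis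
    unfolding higher_variations_def using H H0 variation_condition by blast
qed

text \<open>A variation is determined by its Hamiltonian, inside the charts by the reduced bracket
  and elsewhere by the convention of zero values.\<close>

lemma higher_variation_eq:
  assumes \<delta>: "\<delta> \<in> (\<Pi>\<^sub>E k\<in>{2..n}. differentials A (1 - int k) 1)"
    and *: "\<And>c z. c \<in> A \<Longrightarrow> z \<in> chart_image c \<Longrightarrow>
      taylor n (poisson (in_chart A c H) (\<lambda>w p. - cnj p + (\<Sum>k=2..n. \<mu> k c w * p ^ (k - 1))) z)
             - (\<Sum>k=2..n. fmonom (\<delta> k c z) (k - 1) 0) \<in> structure_of n \<mu> c z"
  shows "\<delta> = hamiltonian_variation"
proof (rule PiE_ext[OF \<delta>])
  show "hamiltonian_variation \<in> (\<Pi>\<^sub>E k\<in>{2..n}. differentials A (1 - int k) 1)"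
    using hamiltonian_variation_in by (simp add: higher_variations_def)
  fix k assume k: "k \<in> {2..n}"
  show "\<delta> k = hamiltonian_variation k"
  proof (intro ext)
    fix c z
    show "\<delta> k c z = hamiltonian_variation k c z"
    proof (cases "c \<in> A \<and> z \<in> chart_image c")
      case True
      then show ?thesis using variation_condition(2)[of c z \<delta>] * k by (simp add: hamiltonian_variation_def)
    next
      case False
      have "\<delta> k \<in> differentials A (1 - int k) 1" using \<delta> k by auto
      from differentials_zero[OF this False] show ?thesis using False k by (auto simp: hamiltonian_variation_def)
    qed
  qed
qed

lemma symbol_vanishes:
  assumes "\<And>p. H (covector A c z p) = 0"
  shows "symbol m c z = 0"
proof -
  have "in_chart A c H z = (\<lambda>p. 0)" using assms by (simp add: in_chart_def fun_eq_iff)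
  then show ?thesis by (simp add: symbol_def hamiltonian_series_def subst_series_linear)
qed

end

end

section \<open>The annihilator of the infinitesimal action\<close>

text \<open>The fundamental lemma of the calculus of variations for a complex integrand, with bumps
  centred at the point in question.\<close>

lemma bump_integral_zero_imp:
  fixes E :: "complex \<Rightarrow> complex"
  assumes U: "open U" and E: "continuous_on U E" and z0: "z0 \<in> U"
    and int: "\<And>r. r > 0 \<Longrightarrow> cball z0 r \<subseteq> U \<Longrightarrow> integral U (\<lambda>z. of_real (bump z0 r z) * E z) = 0"
  shows "E z0 = 0"
proof (rule ccontr)
  assume nz: "E z0 \<noteq> 0"
  \<comment> \<open>Rotating E by the conjugate of E z0 makes its real part positive at z0, hence on
    a small ball; the radius is chosen afterwards.\<close>
  define g where "g = (\<lambda>z. Re (cnj (E z0) * E z))"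
  have "g z0 = (cmod (E z0))\<^sup>2" by (simp add: g_def cmod_power2 flip: power2_eq_square)
  then have g0: "g z0 > 0" using nz by simp
  have gc: "continuous_on U g" unfolding g_def by (intro continuous_intros E)
  have "open (U \<inter> g -` {0<..})"
    by (rule continuous_open_preimage[OF gc U open_greaterThan])
  moreover have "z0 \<in> U \<inter> g -` {0<..}" using z0 g0 by simp
  ultimately obtain r where r: "r > 0" "cball z0 r \<subseteq> U \<inter> g -` {0<..}"
    using open_contains_cball by blast
  let ?f = "\<lambda>z. complex_of_real (bump z0 r z) * E z"
  have bz: "z \<in> cball z0 r" if "bump z0 r z \<noteq> 0" for z
    using bump_nonzero[OF r(1) that] by (simp add: less_imp_le)
  have si: "set_integrable lborel U ?f"
  proof (rule set_integrable_compact_support[OF U _ compact_cball])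
    show "continuous_on U ?f"
      by (intro continuous_intros E continuous_on_subset[OF smooth_on_imp_continuous_on[OF smooth_bump]]) simp
    show "cball z0 r \<subseteq> U" using r by blast
    show "z \<in> cball z0 r" if "?f z \<noteq> 0" for z using that by (intro bz) auto
  qed
  let ?F = "\<lambda>z. indicator U z *\<^sub>R ?f z"
  let ?G = "\<lambda>z. Re (cnj (E z0) * ?F z)"
  have i: "integrable lborel ?F" using si by (simp add: set_integrable_def)
  have F0: "integral\<^sup>L lborel ?F = 0"
    using set_borel_integral_eq_integral(2)[OF si] int[of r] r by (auto simp: set_lebesgue_integral_def)
  have G0: "integral\<^sup>L lborel ?G = 0"
    by (simp only: integral_Re[OF integrable_mult_right[OF i]] integral_mult_right_zero F0 mult_zero_right zero_complex.sel)
  have Gi: "integrable lborel ?G" by (intro integrable_Re integrable_mult_right i)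
  have Gv: "?G z = (if z \<in> U then bump z0 r z * g z else 0)" for z
    by (simp add: g_def indicator_def algebra_simps)
  have "AE z in lborel. 0 \<le> ?G z"
  proof (rule AE_I2)
    fix z show "0 \<le> ?G z"
    proof (cases "z \<in> U \<and> bump z0 r z \<noteq> 0")
      case True
      then have "g z > 0" using bz[of z] r by auto
      then show ?thesis using bump_nonneg[of z0 r z] unfolding Gv by simp
    qed (auto simp: Gv)
  qed
  \<comment> \<open>A nonnegative function with zero integral vanishes almost everywhere, yet this
    one is positive on the ball, which has positive measure.\<close>
  then have "AE z in lborel. ?G z = 0"
    using integral_nonneg_eq_0_iff_AE[OF Gi] G0 by blast
  then have "AE z in lborel. z \<notin> ball z0 r"
  proof (rule AE_mp, intro AE_I2 impI notI)
    fix z assume G: "?G z = 0" and z: "z \<in> ball z0 r"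
    have "z \<in> U \<inter> g -` {0<..}" using r(2) ball_subset_cball z by blast
    then have "z \<in> U" "g z > 0" by auto
    moreover have "bump z0 r z > 0" using bump_pos_iff[OF r(1)] z by simp
    ultimately show False using G unfolding Gv by simp
  qed
  then have "ball z0 r \<in> null_sets lborel" by (subst AE_iff_null_sets) simp_all
  then have "negligible (ball z0 r)"
    unfolding negligible_iff_null_sets by (rule null_sets_completionI)
  then show False using r(1) open_not_negligible[of "ball z0 r"] by simp
qed

section \<open>The pairing with the variation of a Hamiltonian\<close>

context riemann_surface begin

context
  fixes n :: nat and \<mu> t :: "'a family_tuple" and H :: "'a covector \<Rightarrow> real"
  assumes \<mu>: "\<mu> \<in> (\<Pi>\<^sub>E k\<in>{2..n}. differentials A (1 - int k) 1)"
    and H: "smooth_cotangent A H" and H0: "\<forall>\<xi>\<in>zero_section A. H \<xi> = 0"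
    and t: "t \<in> (\<Pi>\<^sub>E k\<in>{2..n}. differentials A (int k) 0)"
begin

definition action_density :: "'a local_family" where
  "action_density c z = (\<Sum>m=1..<n. symbol n \<mu> H m c z * conservation n (\<lambda>k. \<mu> k c) (\<lambda>k. t k c) (m + 1) z)"

lemma t_diff: "k \<in> {2..n} \<Longrightarrow> t k \<in> differentials A (int k) 0"
  using t by auto

lemma t_smooth: "c \<in> A \<Longrightarrow> k \<in> {2..n} \<Longrightarrow> smooth_on (chart_image c) (t k c)"
  using differentials_smooth[OF t_diff] by blast

lemma t_change:
  assumes "c \<in> A" "d \<in> A" "z \<in> overlap c d" "k \<in> {2..n}"
  shows "t k c z = t k d (transition c d z) * deriv (transition c d) z ^ k"
  using differentials_change[OF t_diff[OF assms(4)] assms(1-3)] by simp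

lemma smooth_action_density:
  assumes "c \<in> A" shows "smooth_on (chart_image c) (action_density c)"
proof -
  have "smooth_on (chart_image c) (conservation n (\<lambda>k. \<mu> k c) (\<lambda>k. t k c) (m + 1))" if "m \<in> {1..<n}" for m
    using that by (intro smooth_conservation open_chart_image assms \<mu>_smooth[OF \<mu> H H0 assms] t_smooth[OF assms]) auto
  then show ?thesis unfolding action_density_def[abs_def]
    by (intro smooth_on_sum smooth_on_mult open_chart_image assms smooth_symbol[OF \<mu> H H0])
qed

abbreviation "flux_a c \<equiv> flux1 n (\<lambda>k. t k c) (\<lambda>m. symbol n \<mu> H m c)"
abbreviation "flux_b c \<equiv> flux2 n (\<lambda>k. \<mu> k c) (\<lambda>k. t k c) (\<lambda>m. symbol n \<mu> H m c)"

lemma smooth_flux_ab: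
  assumes "c \<in> A"
  shows "smooth_on (chart_image c) (flux_a c)" "smooth_on (chart_image c) (flux_b c)"
  using smooth_flux[OF open_chart_image[OF assms], of n "\<lambda>k. \<mu> k c" "\<lambda>k. t k c" "\<lambda>m. symbol n \<mu> H m c"]
    \<mu>_smooth[OF \<mu> H H0 assms] t_smooth[OF assms] smooth_symbol[OF \<mu> H H0 assms] by simp_all

lemma density_eq:
  assumes c: "c \<in> A" and z: "z \<in> chart_image c"
  shows "(\<Sum>k=2..n. t k c z * hamiltonian_variation n \<mu> H k c z) =
    action_density c z + (delbar (flux_a c) z + del (flux_b c) z)"
proof -
  have "(\<Sum>k=2..n. t k c z * hamiltonian_variation n \<mu> H k c z) =
      (\<Sum>k=2..n. t k c z * variation (\<lambda>k. \<mu> k c) (\<lambda>m. symbol n \<mu> H m c) (k - 1) z)"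
    by (intro sum.cong refl) (simp add: hamiltonian_variation_def[OF \<mu> H H0] c z)
  also have "\<dots> = action_density c z + (delbar (flux_a c) z + del (flux_b c) z)"
    unfolding action_density_def
    by (rule pairing_by_parts[OF open_chart_image[OF c] _ _ _ z])
      (simp_all add: \<mu>_smooth[OF \<mu> H H0 c] t_smooth[OF c] smooth_symbol[OF \<mu> H H0 c])
  finally show ?thesis .
qed

lemma symbol_div:
  assumes "c \<in> A" "d \<in> A" "z \<in> overlap c d"
  shows "deriv (transition c d) z ^ m * symbol n \<mu> H m c z = symbol n \<mu> H m d (transition c d z)"
  by (rule symbol_change[OF \<mu> H H0 assms])

text \<open>The weights m + 1 of t_(m+1) and -m of w_m add up to 1.\<close>

lemma flux_a_change:
  assumes cd: "c \<in> A" "d \<in> A" "z \<in> overlap c d"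
  shows "flux_a c z = flux_a d (transition c d z) * deriv (transition c d) z"
  unfolding flux1_def sum_distrib_right
proof (rule sum.cong[OF refl])
  fix m assume "m \<in> {1..<n}"
  then have "m + 1 \<in> {2..n}" by auto
  then show "t (m + 1) c z * symbol n \<mu> H m c z =
      t (m + 1) d (transition c d z) * symbol n \<mu> H m d (transition c d z) * deriv (transition c d) z"
    using t_change[OF cd] by (simp add: mult_ac flip: symbol_div[OF cd])
qed

text \<open>The types (-i,1), (-(m+1-i),0) and (m+1,0) of the factors add up to (0,1).\<close>

lemma flux_b_change:
  assumes cd: "c \<in> A" "d \<in> A" "z \<in> overlap c d"
  shows "flux_b c z = flux_b d (transition c d z) * cnj (deriv (transition c d) z)"
  unfolding flux2_def sum_distrib_right
proof (intro sum.cong refl)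
  fix m i assume mi: "m \<in> {1..<n}" "i \<in> {1..m}"
  let ?a = "deriv (transition c d) z"
  have m: "m + 1 \<in> {2..n}" "i + 1 \<in> {2..n}" using mi by auto
  have "?a ^ (m + 1) = ?a ^ i * ?a ^ (m + 1 - i)" using mi by (simp flip: power_add)
  then have "\<mu> (i + 1) c z * symbol n \<mu> H (m + 1 - i) c z * t (m + 1) c z =
      (?a ^ i * \<mu> (i + 1) c z) * (?a ^ (m + 1 - i) * symbol n \<mu> H (m + 1 - i) c z) * t (m + 1) d (transition c d z)"
    unfolding t_change[OF cd m(1)] by (simp add: mult_ac)
  also have "\<dots> = cnj ?a * \<mu> (i + 1) d (transition c d z) * symbol n \<mu> H (m + 1 - i) d (transition c d z) * t (m + 1) d (transition c d z)"
    using \<mu>_change[OF \<mu> H H0 cd m(2)] by (simp add: symbol_div[OF cd])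
  finally show "- of_nat i * (\<mu> (i + 1) c z * symbol n \<mu> H (m + 1 - i) c z * t (m + 1) c z) =
      - of_nat i * (\<mu> (i + 1) d (transition c d z) * symbol n \<mu> H (m + 1 - i) d (transition c d z) * t (m + 1) d (transition c d z)) * cnj ?a"
    by (simp add: mult_ac)
qed

text \<open>No transformation law of the equations is computed. By \<open>density_eq\<close> the
  density is the pairing density minus two divergences, and each of these is known to be a
  (1,1)-form.\<close>

lemma action_density_covariant: "covariant11 action_density"
  unfolding covariant11_def
proof (intro conjI ballI)
  show "continuous_on (chart_image c) (action_density c)" if "c \<in> A" for c
    by (rule smooth_on_imp_continuous_on[OF smooth_action_density[OF that]])
  fix c d z assume cd: "c \<in> A" "d \<in> A" "z \<in> overlap c d"
  let ?T = "transition c d" and ?a = "deriv (transition c d) z"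
  have a: "?a \<noteq> 0" by (rule deriv_transition_nz[OF cd])
  have "(\<Sum>k=2..n. t k c z * hamiltonian_variation n \<mu> H k c z) =
      (\<Sum>k=2..n. t k d (?T z) * hamiltonian_variation n \<mu> H k d (?T z)) * ?a * cnj ?a"
    unfolding sum_distrib_right
  proof (rule sum.cong[OF refl])
    fix k assume k: "k \<in> {2..n}"
    \<comment> \<open>The types (k,0) of t_k and (1-k,1) of the variation combine to (1,1).\<close>
    have "?a ^ k * ?a powi (1 - int k) = ?a powi (int k + (1 - int k))"
      using a by (subst power_int_add) simp_all
    then have p: "?a ^ k * ?a powi (1 - int k) = ?a" by simp
    have "hamiltonian_variation n \<mu> H k c z = hamiltonian_variation n \<mu> H k d (?T z) * ?a powi (1 - int k) * cnj ?a powi 1"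
      by (rule differentials_change[OF hamiltonian_variation_differential[OF \<mu> H H0 k] cd])
    then have "t k c z * hamiltonian_variation n \<mu> H k c z =
        t k d (?T z) * hamiltonian_variation n \<mu> H k d (?T z) * (?a ^ k * ?a powi (1 - int k)) * cnj ?a"
      using t_change[OF cd k] by (simp add: mult_ac)
    then show "t k c z * hamiltonian_variation n \<mu> H k c z =
        t k d (?T z) * hamiltonian_variation n \<mu> H k d (?T z) * ?a * cnj ?a" unfolding p .
  qed
  moreover have "delbar (flux_a c) z = delbar (flux_a d) (?T z) * ?a * cnj ?a"
    by (rule delbar_covariant[OF cd smooth_flux_ab(1)[OF cd(2)]]) (rule flux_a_change[OF cd(1,2)])
  moreover have "del (flux_b c) z = del (flux_b d) (?T z) * ?a * cnj ?a"
    by (rule del_covariant[OF cd smooth_flux_ab(2)[OF cd(2)]]) (rule flux_b_change[OF cd(1,2)])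
  ultimately show "action_density c z = action_density d (?T z) * ?a * cnj ?a"
    using density_eq[OF cd(1) overlapD[OF cd(3)]] density_eq[OF cd(2) overlapD[OF transition_in[OF cd]]]
    by (simp add: algebra_simps)
qed

text \<open>Both divergences integrate to zero for the partition of unity behind
  \<open>surface_integral\<close>, which is therefore passed on to the caller.\<close>

lemma pairing_hamiltonian_variation:
  "\<exists>F \<rho>. partition_of_unity A F \<rho> \<and>
    pairing A n t (hamiltonian_variation n \<mu> H) = - 2 * \<i> * chart_sum F \<rho> action_density"
proof -
  obtain F \<rho> where pou: "partition_of_unity A F \<rho>"
    and p: "pairing A n t (hamiltonian_variation n \<mu> H) =
      - 2 * \<i> * chart_sum F \<rho> (\<lambda>c z. \<Sum>k=2..n. t k c z * hamiltonian_variation n \<mu> H k c z)"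
    unfolding pairing_def using surface_integral_chart_sum by blast
  have c0: "continuous_on (chart_image c) (action_density c)"
    and c1: "continuous_on (chart_image c) (delbar (flux_a c))"
    and c2: "continuous_on (chart_image c) (del (flux_b c))" if "c \<in> A" for c
    by (intro smooth_on_imp_continuous_on smooth_action_density smooth_on_del smooth_flux_ab open_chart_image that)+
  have "chart_sum F \<rho> (\<lambda>c z. \<Sum>k=2..n. t k c z * hamiltonian_variation n \<mu> H k c z) =
      chart_sum F \<rho> (\<lambda>c z. action_density c z + (delbar (flux_a c) z + del (flux_b c) z))"
    by (rule chart_sum_cong[OF pou]) (rule density_eq)
  also have "\<dots> = chart_sum F \<rho> action_density + chart_sum F \<rho> (\<lambda>c z. delbar (flux_a c) z + del (flux_b c) z)"
    by (rule chart_sum_add[OF pou], erule c0, intro continuous_on_add c1 c2)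
  also have "chart_sum F \<rho> (\<lambda>c z. delbar (flux_a c) z + del (flux_b c) z) =
      chart_sum F \<rho> (\<lambda>c. delbar (flux_a c)) + chart_sum F \<rho> (\<lambda>c. del (flux_b c))"
    by (rule chart_sum_add[OF pou], erule c1, erule c2)
  also have "chart_sum F \<rho> (\<lambda>c. delbar (flux_a c)) = 0"
    by (rule chart_sum_delbar[OF pou smooth_flux_ab(1) flux_a_change])
  also have "chart_sum F \<rho> (\<lambda>c. del (flux_b c)) = 0"
    by (rule chart_sum_del[OF pou smooth_flux_ab(2) flux_b_change])
  finally show ?thesis using pou p by auto
qed

end

section \<open>Test Hamiltonians supported over one chart\<close>

definition test_hamiltonian :: "'a chart \<Rightarrow> (complex \<Rightarrow> complex) \<Rightarrow> nat \<Rightarrow> 'a covector \<Rightarrow> real" where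
  "test_hamiltonian c f j \<xi> = (if fst \<xi> \<in> fst c then 2 * Re (f (snd c (fst \<xi>)) * snd \<xi> c ^ j) else 0)"

context
  fixes c :: "'a chart" and f :: "complex \<Rightarrow> complex" and S :: "complex set" and j :: nat
  assumes c: "c \<in> A" and f: "smooth_on (chart_image c) f"
    and S: "compact S" "S \<subseteq> chart_image c" and fS: "\<And>z. f z \<noteq> 0 \<Longrightarrow> z \<in> S" and j: "j \<ge> 1"
begin

lemma test_hamiltonian_covector:
  assumes "d \<in> A"
  shows "test_hamiltonian c f j (covector A d z p) = (if chart_point d z \<in> fst c
    then 2 * Re (f (transition d c z) * (p * inverse (deriv (transition d c) z)) ^ j) else 0)"
  using c by (simp add: test_hamiltonian_def covector_def transition_def[of d c] divide_inverse)

lemma test_hamiltonian_off_support: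
  assumes d: "d \<in> A" and z: "z \<in> chart_image d" "chart_point d z \<notin> chart_point c ` S"
  shows "test_hamiltonian c f j (covector A d z p) = 0"
proof (cases "chart_point d z \<in> fst c")
  case True
  then have "transition d c z \<notin> S"
    using z(2) by (simp add: in_chart_point_image_iff[OF c S(2)] transition_def)
  then have "f (transition d c z) = 0" using fS by blast
  then show ?thesis by (simp add: test_hamiltonian_covector[OF d])
qed (simp add: test_hamiltonian_covector[OF d])

text \<open>As for functions on the surface: over the overlap an explicit formula in the transition
  map, and elsewhere zero on a neighbourhood avoiding the support.\<close>

lemma smooth_test_hamiltonian: "smooth_cotangent A (test_hamiltonian c f j)"
  unfolding smooth_cotangent_def
proof (rule ballI, rule smooth_on_local)
  fix d and x :: "complex \<times> complex" assume d: "d \<in> A" and x: "x \<in> chart_image d \<times> UNIV"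
  let ?h = "\<lambda>(z, p). test_hamiltonian c f j (covector A d z p)"
  obtain z p where zp: "x = (z, p)" and z: "z \<in> chart_image d" using x by auto
  show "\<exists>U. open U \<and> x \<in> U \<and> smooth_on U ?h"
  proof (cases "chart_point d z \<in> fst c")
    case True
    let ?U = "overlap d c \<times> (UNIV :: complex set)"
    have oU: "open ?U" using open_overlap[OF d c] by (simp add: open_Times)
    have sfst: "smooth_on ?U fst" and ssnd: "smooth_on ?U snd" by (rule smooth_on_fst smooth_on_snd)+
    have pull: "smooth_on ?U (\<lambda>x. g (fst x))" if "smooth_on (overlap d c) g" for g :: "complex \<Rightarrow> complex"
      by (rule smooth_on_compose[OF that sfst oU open_overlap[OF d c]]) auto
    have fT: "smooth_on (overlap d c) (\<lambda>z. f (transition d c z))"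
      using transition_in[OF d c] overlapD[of _ c d]
      by (intro smooth_on_compose[OF f smooth_transition[OF d c] open_overlap[OF d c] open_chart_image[OF c]]) auto
    have iT: "smooth_on (overlap d c) (\<lambda>z. inverse (deriv (transition d c) z))"
      by (intro holomorphic_imp_smooth_on open_overlap d c holomorphic_on_inverse holomorphic_deriv
          transition_holomorphic deriv_transition_nz)
    have "smooth_on ?U (\<lambda>x. 2 * Re (f (transition d c (fst x)) * (snd x * inverse (deriv (transition d c) (fst x))) ^ j))"
      by (intro smooth_on_mult smooth_on_const smooth_on_Re smooth_on_power pull fT iT ssnd oU)
    moreover have "?h y = 2 * Re (f (transition d c (fst y)) * (snd y * inverse (deriv (transition d c) (fst y))) ^ j)"
      if "y \<in> ?U" for y
      using that by (auto simp: test_hamiltonian_covector[OF d] overlap_iff[OF d])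
    ultimately have "smooth_on ?U ?h" by (subst smooth_on_cong[OF oU]) auto
    then show ?thesis using oU True z zp by (intro exI[of _ ?U]) (simp add: overlap_iff[OF d])
  next
    case False
    let ?V = "{z \<in> chart_image d. chart_point d z \<notin> chart_point c ` S}"
    let ?U = "?V \<times> (UNIV :: complex set)"
    have oU: "open ?U" using open_avoid_compact[OF c S d] by (simp add: open_Times)
    have "?h y = 0" if "y \<in> ?U" for y
      using that by (auto simp: test_hamiltonian_off_support[OF d])
    then have "smooth_on ?U ?h" by (rule smooth_on_eq_const[OF _ oU])
    moreover have "x \<in> ?U" using False z zp by (simp add: in_chart_point_image_iff[OF c S(2)])
    ultimately show ?thesis using oU by blast
  qed
qed

lemma test_hamiltonian_zero_section: "\<forall>\<xi>\<in>zero_section A. test_hamiltonian c f j \<xi> = 0"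
  unfolding zero_section_def using j by (auto simp: test_hamiltonian_covector)

lemma in_chart_test_hamiltonian:
  assumes "z \<in> chart_image c"
  shows "in_chart A c (test_hamiltonian c f j) z = (\<lambda>p. f z * (p ^ j * 1) + cnj (f z) * (cnj p ^ j * 1))"
proof
  fix p
  have w: "complex_of_real (2 * Re w) = w + cnj w" for w
    by (simp add: complex_eq_iff)
  show "in_chart A c (test_hamiltonian c f j) z p = f z * (p ^ j * 1) + cnj (f z) * (cnj p ^ j * 1)"
    unfolding in_chart_def test_hamiltonian_covector[OF c]
    using chart_point_in[OF assms] transition_self[OF c assms] deriv_transition_self[OF c assms]
    by (simp only: if_True w) simp
qed

text \<open>The only Taylor coefficients are f at p^j and f-bar at p-bar^j; substituting M for p-bar
  turns the latter into M^j.\<close>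

lemma symbol_test_hamiltonian:
  assumes \<mu>: "\<mu> \<in> (\<Pi>\<^sub>E k\<in>{2..n}. differentials A (1 - int k) 1)"
    and z: "z \<in> chart_image c"
  shows "symbol n \<mu> (test_hamiltonian c f j) m c z =
    f z * (if m = j then 1 else 0) + cnj (f z) * (structure_series n (\<lambda>k. \<mu> k c z) ^ j) $ m"
proof -
  let ?M = "structure_series n (\<lambda>k. \<mu> k c z)"
  \<comment> \<open>Large enough for the coefficient m and also for the indices equal to j.\<close>
  let ?N = "m + j"
  have one: "smooth_on UNIV (\<lambda>p. 1 :: complex)" by simp
  have s: "smooth_on UNIV (\<lambda>p. p ^ j * 1 :: complex)" "smooth_on UNIV (\<lambda>p. cnj p ^ j * 1)"
    by (intro smooth_on_mult smooth_on_power smooth_on_ident smooth_cnj one open_UNIV)+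
  have s': "smooth_on UNIV (\<lambda>p. f z * (p ^ j * 1))" "smooth_on UNIV (\<lambda>p. cnj (f z) * (cnj p ^ j * 1))"
    by (intro smooth_on_mult[OF open_UNIV smooth_on_const] s)+
  have tc: "taylor_coeff i l (in_chart A c (test_hamiltonian c f j) z) =
      f z * (if i = j then if l = 0 then 1 else 0 else 0) + cnj (f z) * (if i = 0 then if l = j then 1 else 0 else 0)" for i l
    unfolding in_chart_test_hamiltonian[OF z] taylor_coeff_add[OF s'] taylor_coeff_cmult[OF s(1)] taylor_coeff_cmult[OF s(2)]
      taylor_coeff_mult_power[OF one] taylor_coeff_mult_cnj_power[OF one] taylor_coeff_const
    using j by auto
  have d1: "(\<Sum>i\<le>?N. \<Sum>l\<le>?N. (if i = j then if l = 0 then 1 else 0 else 0) * g i l) = g j 0" for g :: "nat \<Rightarrow> nat \<Rightarrow> complex"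
  proof -
    have "(\<Sum>i\<le>?N. \<Sum>l\<le>?N. (if i = j then if l = 0 then 1 else 0 else 0) * g i l) = (\<Sum>i\<le>?N. if i = j then g j 0 else 0)"
      by (intro sum.cong refl) (simp add: if_distrib[of "\<lambda>x. x * _"] cong: if_cong)
    then show ?thesis by simp
  qed
  have d2: "(\<Sum>i\<le>?N. \<Sum>l\<le>?N. (if i = 0 then if l = j then 1 else 0 else 0) * g i l) = g 0 j" for g :: "nat \<Rightarrow> nat \<Rightarrow> complex"
  proof -
    have "(\<Sum>i\<le>?N. \<Sum>l\<le>?N. (if i = 0 then if l = j then 1 else 0 else 0) * g i l) = (\<Sum>i\<le>?N. if i = 0 then g 0 j else 0)"
      by (intro sum.cong refl) (simp add: if_distrib[of "\<lambda>x. x * _"] cong: if_cong)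
    then show ?thesis by simp
  qed
  have "symbol n \<mu> (test_hamiltonian c f j) m c z =
      (\<Sum>i\<le>?N. \<Sum>l\<le>?N. (f z * (if i = j then if l = 0 then 1 else 0 else 0)
        + cnj (f z) * (if i = 0 then if l = j then 1 else 0 else 0)) * (fps_X ^ i * ?M ^ l) $ m)"
    unfolding symbol_def[OF \<mu> smooth_test_hamiltonian test_hamiltonian_zero_section] hamiltonian_series_def
    by (subst subst_series_nth[OF structure_series_0, of _ ?N]) (simp_all only: subst_sum_nth tc le_add1)
  also have "\<dots> = f z * (fps_X ^ j * ?M ^ 0) $ m + cnj (f z) * (fps_X ^ 0 * ?M ^ j) $ m"
    by (simp only: distrib_right sum.distrib mult.assoc sum_distrib_left[symmetric] d1 d2)
  also have "\<dots> = f z * (if m = j then 1 else 0) + cnj (f z) * (?M ^ j) $ m"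
    by (simp add: fps_X_power_nth)
  finally show ?thesis .
qed

end

end

section \<open>Annihilation of all variations versus the differential equations\<close>

context riemann_surface begin

text \<open>Every variation comes from a Hamiltonian, so its pairing is the integral of a density
  each term of which contains a left-hand side E_k.\<close>

lemma conservation_imp_cotangent:
  assumes \<mu>: "\<mu> \<in> (\<Pi>\<^sub>E k\<in>{2..n}. differentials A (1 - int k) 1)"
    and t: "t \<in> (\<Pi>\<^sub>E k\<in>{2..n}. differentials A (int k) 0)"
    and E: "\<And>k c z. k \<in> {2..n} \<Longrightarrow> c \<in> A \<Longrightarrow> z \<in> chart_image c \<Longrightarrow>
      conservation n (\<lambda>k. \<mu> k c) (\<lambda>k. t k c) k z = 0"
  shows "t \<in> cotangent_space A n \<mu>"
  unfolding cotangent_space_def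
proof (intro CollectI conjI t ballI)
  fix \<delta> assume "\<delta> \<in> higher_variations A n \<mu>"
  then obtain H :: "'a covector \<Rightarrow> real" where \<delta>: "\<delta> \<in> (\<Pi>\<^sub>E k\<in>{2..n}. differentials A (1 - int k) 1)"
    and H: "smooth_cotangent A H" "\<forall>\<xi>\<in>zero_section A. H \<xi> = 0"
    and *: "\<And>c z. c \<in> A \<Longrightarrow> z \<in> chart_image c \<Longrightarrow>
      taylor n (poisson (in_chart A c H) (\<lambda>w p. - cnj p + (\<Sum>k=2..n. \<mu> k c w * p ^ (k - 1))) z)
             - (\<Sum>k=2..n. fmonom (\<delta> k c z) (k - 1) 0) \<in> structure_of n \<mu> c z"
    unfolding higher_variations_def by blast
  have "\<delta> = hamiltonian_variation n \<mu> H" by (rule higher_variation_eq[OF \<mu> H \<delta> *])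
  moreover obtain F \<rho> where pou: "partition_of_unity A F \<rho>"
    and p: "pairing A n t (hamiltonian_variation n \<mu> H) = - 2 * \<i> * chart_sum F \<rho> (action_density n \<mu> t H)"
    using pairing_hamiltonian_variation[OF \<mu> H t] by blast
  moreover have "chart_sum F \<rho> (action_density n \<mu> t H) = chart_sum F \<rho> (\<lambda>c z. 0)"
  proof (rule chart_sum_cong[OF pou])
    fix c z assume c: "c \<in> A" "z \<in> chart_image c"
    have "m + 1 \<in> {2..n}" if "m \<in> {1..<n}" for m using that by auto
    then show "action_density n \<mu> t H c z = 0"
      unfolding action_density_def[OF \<mu> H t] using E[OF _ c] by (intro sum.neutral ballI) simp
  qed
  ultimately show "pairing A n t \<delta> = 0" by (simp add: chart_sum_def)
qed

lemma cotangent_imp_conservation: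
  assumes \<mu>: "\<mu> \<in> (\<Pi>\<^sub>E k\<in>{2..n}. differentials A (1 - int k) 1)"
    and t: "t \<in> cotangent_space A n \<mu>"
    and k: "k \<in> {2..n}" and c: "c \<in> A" and z: "z \<in> chart_image c"
  shows "conservation n (\<lambda>k. \<mu> k c) (\<lambda>k. t k c) k z = 0"
  using k c z
proof (induction "n - k" arbitrary: k c z rule: less_induct)
  case less
  note k = less.prems(1) and c = less.prems(2) and z0 = less.prems(3)
  have tP: "t \<in> (\<Pi>\<^sub>E k\<in>{2..n}. differentials A (int k) 0)"
    and tp: "\<And>\<delta>. \<delta> \<in> higher_variations A n \<mu> \<Longrightarrow> pairing A n t \<delta> = 0"
    using t by (auto simp: cotangent_space_def)
  define j where "j = k - 1"
  have j: "j \<ge> 1" "k = j + 1" "j \<in> {1..<n}" using k by (auto simp: j_def)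
  \<comment> \<open>The zero Hamiltonian serves to instantiate the contexts in which smoothness of
    \<open>\<mu>\<close> and t was derived.\<close>
  have z00: "smooth_cotangent A (\<lambda>\<xi>. 0 :: real)" "\<forall>\<xi>\<in>zero_section A. (\<lambda>\<xi>. 0 :: real) \<xi> = 0"
    by (simp_all add: smooth_cotangent_def case_prod_beta')
  note \<mu>s = \<mu>_smooth[OF \<mu> z00 c]
  let ?E = "conservation n (\<lambda>k. \<mu> k c) (\<lambda>k. t k c)"
  \<comment> \<open>This is the power \<mu>_2^j, kept as a coefficient of M^j; what matters below is
    its continuity.\<close>
  define B where "B = (\<lambda>z. (structure_series n (\<lambda>k. \<mu> k c z) ^ j) $ j)"
  have o: "open (chart_image c)" by (rule open_chart_image[OF c])
  have Bc: "continuous_on (chart_image c) B"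
    unfolding B_def
    by (rule smooth_on_imp_continuous_on, rule smooth_structure_series_power[OF o, where h="\<lambda>_ _. 0"])
      (simp_all add: case_prod_beta' \<mu>s)
  have Ec: "continuous_on (chart_image c) (?E k)"
    using k \<mu>s t_smooth[OF \<mu> z00 tP c]
    by (intro smooth_on_imp_continuous_on smooth_conservation o) auto
  show ?case
  proof (rule bump_integral_zero_imp[OF o Ec z0])
    fix r :: real assume r: "r > 0" "cball z r \<subseteq> chart_image c"
    let ?b = "\<lambda>z'. complex_of_real (bump z r z')"
    have bS: "w \<in> cball z r" if "bump z r w \<noteq> 0" for w
      using bump_nonzero[OF r(1) that] by (simp add: less_imp_le)
    have bc: "continuous_on (chart_image c) ?b"
      by (intro continuous_intros continuous_on_subset[OF smooth_on_imp_continuous_on[OF smooth_bump]]) simp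
    have int: "(\<lambda>w. ?b w * g w) integrable_on chart_image c" if "continuous_on (chart_image c) g" for g :: "complex \<Rightarrow> complex"
      by (rule set_borel_integral_eq_integral(1)[OF set_integrable_compact_support[OF o _ compact_cball r(2)]])
        (auto intro!: continuous_intros bc that dest: bS)
    \<comment> \<open>The function tested is \<kappa> times a real bump, so conjugation acts on the
      constant alone.\<close>
    have "integral (chart_image c) (\<lambda>w. (\<kappa> * ?b w + cnj (\<kappa> * ?b w) * B w) * ?E k w) = 0" for \<kappa>
    proof -
      define f where "f = (\<lambda>w. \<kappa> * ?b w)"
      have fs: "smooth_on (chart_image c) f" unfolding f_def
        by (intro smooth_on_mult smooth_on_const smooth_on_of_real smooth_on_subset[OF smooth_bump] o) simp
      have fS: "w \<in> cball z r" if "f w \<noteq> 0" for w using that by (intro bS) (auto simp: f_def)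
      let ?H = "test_hamiltonian c f j"
      have H: "smooth_cotangent A ?H" "\<forall>\<xi>\<in>zero_section A. ?H \<xi> = 0"
        by (rule smooth_test_hamiltonian[OF c fs compact_cball r(2) _ j(1)]
            test_hamiltonian_zero_section[OF c fs compact_cball r(2) _ j(1)], erule fS)+
      obtain F \<rho> where pou: "partition_of_unity A F \<rho>"
        and p: "pairing A n t (hamiltonian_variation n \<mu> ?H) = - 2 * \<i> * chart_sum F \<rho> (action_density n \<mu> t ?H)"
        using pairing_hamiltonian_variation[OF \<mu> H tP] by blast
      have "chart_sum F \<rho> (action_density n \<mu> t ?H) = integral (chart_image c) (action_density n \<mu> t ?H c)"
      proof (rule chart_sum_localize[OF pou action_density_covariant[OF \<mu> H tP] c compact_cball r(2)])
        fix d w assume d: "d \<in> A" "w \<in> chart_image d" and nz: "action_density n \<mu> t ?H d w \<noteq> 0"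
        show "chart_point d w \<in> chart_point c ` cball z r"
        proof (rule ccontr)
          assume "chart_point d w \<notin> chart_point c ` cball z r"
          then have "?H (covector A d w p) = 0" for p
            by (intro test_hamiltonian_off_support[OF c fs compact_cball r(2) _ j(1) d]) (rule fS)
          then have "symbol n \<mu> ?H m d w = 0" for m
            by (rule symbol_vanishes[OF \<mu> H])
          then show False using nz by (simp add: action_density_def[OF \<mu> H tP])
        qed
      qed
      then have "integral (chart_image c) (action_density n \<mu> t ?H c) = 0"
        using p tp[OF hamiltonian_variation_in[OF \<mu> H]] by simp
      also have "integral (chart_image c) (action_density n \<mu> t ?H c) =
          integral (chart_image c) (\<lambda>w. (f w + cnj (f w) * B w) * ?E k w)"
      proof (rule integral_cong)
        fix w assume w: "w \<in> chart_image c"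
        have s: "symbol n \<mu> ?H m c w = f w * (if m = j then 1 else 0)
            + cnj (f w) * (structure_series n (\<lambda>k. \<mu> k c w) ^ j) $ m" for m
          by (rule symbol_test_hamiltonian[OF c fs compact_cball r(2) _ j(1) \<mu> w]) (rule fS)
        have "action_density n \<mu> t ?H c w = (\<Sum>m\<in>{1..<n}. if m = j then (f w + cnj (f w) * B w) * ?E k w else 0)"
          unfolding action_density_def[OF \<mu> H tP]
        proof (rule sum.cong[OF refl])
          fix m assume m: "m \<in> {1..<n}"
          consider "m < j" | "m = j" | "m > j" by linarith
          then show "symbol n \<mu> ?H m c w * ?E (m + 1) w = (if m = j then (f w + cnj (f w) * B w) * ?E k w else 0)"
          proof cases
            \<comment> \<open>The power M^j begins in degree j, so nothing survives below.\<close>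
            case 1
            then have "symbol n \<mu> ?H m c w = 0"
              using fps_power_nth_less[OF structure_series_0, of m j] by (simp add: s)
            then show ?thesis using 1 by simp
          next
            case 2
            then show ?thesis by (simp add: s B_def j(2))
          next
            \<comment> \<open>These equations have larger index, hence hold by the induction
              hypothesis.\<close>
            case 3
            then have "?E (m + 1) w = 0" using m j by (intro less.hyps c w) auto
            then show ?thesis using 3 by simp
          qed
        qed
        then show "action_density n \<mu> t ?H c w = (f w + cnj (f w) * B w) * ?E k w"
          using j(3) by simp
      qed
      finally show ?thesis by (simp add: f_def)
    qed
    moreover have "integral (chart_image c) (\<lambda>w. (\<kappa> * ?b w + cnj (\<kappa> * ?b w) * B w) * ?E k w) =
        \<kappa> * integral (chart_image c) (\<lambda>w. ?b w * ?E k w) + cnj \<kappa> * integral (chart_image c) (\<lambda>w. ?b w * (B w * ?E k w))" for \<kappa>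
    proof -
      note i1 = int[OF Ec] and i2 = int[OF continuous_on_mult[OF Bc Ec]]
      have "integral (chart_image c) (\<lambda>w. (\<kappa> * ?b w + cnj (\<kappa> * ?b w) * B w) * ?E k w) =
          integral (chart_image c) (\<lambda>w. \<kappa> * (?b w * ?E k w) + cnj \<kappa> * (?b w * (B w * ?E k w)))"
        by (intro integral_cong) (simp add: algebra_simps)
      also have "\<dots> = integral (chart_image c) (\<lambda>w. \<kappa> * (?b w * ?E k w)) + integral (chart_image c) (\<lambda>w. cnj \<kappa> * (?b w * (B w * ?E k w)))"
        by (intro Henstock_Kurzweil_Integration.integral_add integrable_on_mult_right i1 i2)
      finally show ?thesis by simp
    qed
    ultimately have *: "\<kappa> * integral (chart_image c) (\<lambda>w. ?b w * ?E k w) + cnj \<kappa> * integral (chart_image c) (\<lambda>w. ?b w * (B w * ?E k w)) = 0" for \<kappa>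
      by metis
    \<comment> \<open>The two choices give I + J = 0 and I - J = 0 for the two integrals I and
      J.\<close>
    from *[of 1] *[of \<i>] show "integral (chart_image c) (\<lambda>w. ?b w * ?E k w) = 0"
      by (simp add: algebra_simps)
  qed
qed

section \<open>Passage to equivalence classes\<close>

text \<open>The constant flow of the zero Hamiltonian; it makes the equivalence of structures
  reflexive.\<close>

lemma id_in_Symp0: "(\<lambda>\<xi>. \<xi>) \<in> Symp0 A"
proof -
  let ?H = "\<lambda>(s :: real) (\<xi> :: 'a covector). 0 :: real"
  let ?\<Phi> = "\<lambda>(s :: real) (\<xi> :: 'a covector). \<xi>"
  have "in_chart A d (?H s) = (\<lambda>z p. 0)" for d s by (simp add: fun_eq_iff in_chart_def)
  then have zero: "hamiltonian_vector (in_chart A d (?H s)) x = 0" for d s x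
    by (cases x) (simp add: hamiltonian_vector_def zero_prod_def)
  have "hamiltonian_isotopy A ?H ?\<Phi>"
    unfolding hamiltonian_isotopy_def Let_def
  proof (intro conjI ballI allI)
    show "smooth_on (UNIV \<times> chart_image c \<times> UNIV) (\<lambda>(s, z, p). ?H s (covector A c z p))" for c
      by (simp add: case_prod_beta')
    show "bij_betw (?\<Phi> s) (cotangent_surface A) (cotangent_surface A)" for s
      using bij_betw_id by (simp add: id_def)
    show "?\<Phi> 0 \<xi> = \<xi>" for \<xi> by simp
  next
    fix c d assume cd: "c \<in> A" "d \<in> A"
    let ?W = "{(s :: real, z, p :: complex). z \<in> chart_image c \<and> fst (covector A c z p) \<in> fst d}"
    \<comment> \<open>For the constant flow the domain is a product over the overlap, where the
      coordinates are the transition map and p divided by its derivative.\<close>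
    have W: "?W = UNIV \<times> overlap c d \<times> UNIV"
      by (auto simp: covector_def overlap_iff[OF cd(1)])
    have oW: "open (UNIV \<times> overlap c d \<times> UNIV :: (real \<times> complex \<times> complex) set)"
      by (intro open_Times open_UNIV open_overlap cd)
    show "open ?W" unfolding W by (rule oW)
    show "case x of (s, z, p) \<Rightarrow> ((\<lambda>r. covector_coords d (covector A c z p)) has_vector_derivative
        hamiltonian_vector (in_chart A d (?H s)) (covector_coords d (covector A c z p))) (at s)"
      if "x \<in> ?W" for x
      by (auto simp: zero split: prod.split)
    have sz: "smooth_on (UNIV \<times> overlap c d \<times> UNIV) (\<lambda>x :: real \<times> complex \<times> complex. fst (snd x))"
      and sp: "smooth_on (UNIV \<times> overlap c d \<times> UNIV) (\<lambda>x :: real \<times> complex \<times> complex. snd (snd x))"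
      by (intro smooth_on_linear_self bounded_linear_fst_comp bounded_linear_snd_comp bounded_linear_snd)+
    have pull: "smooth_on (UNIV \<times> overlap c d \<times> UNIV) (\<lambda>x :: real \<times> complex \<times> complex. g (fst (snd x)))"
      if "smooth_on (overlap c d) g" for g :: "complex \<Rightarrow> complex"
      by (rule smooth_on_compose[OF that sz oW open_overlap[OF cd]]) auto
    have iT: "smooth_on (overlap c d) (\<lambda>z. inverse (deriv (transition c d) z))"
      by (intro holomorphic_imp_smooth_on open_overlap cd holomorphic_on_inverse holomorphic_deriv
          transition_holomorphic deriv_transition_nz)
    have "smooth_on (UNIV \<times> overlap c d \<times> UNIV) (\<lambda>x :: real \<times> complex \<times> complex.
        (transition c d (fst (snd x)), snd (snd x) * inverse (deriv (transition c d) (fst (snd x)))))"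
      by (intro smooth_on_Pair smooth_on_mult pull smooth_transition cd iT sp oW)
    then show "smooth_on ?W (\<lambda>(s, z, p). covector_coords d (covector A c z p))"
      unfolding W
      by (subst smooth_on_cong[OF oW, where g="\<lambda>x. (transition c d (fst (snd x)), snd (snd x) * inverse (deriv (transition c d) (fst (snd x))))"])
        (auto simp: covector_coords_def covector_def transition_def[of c d] overlap_iff[OF cd(1)] cd divide_inverse)
  qed
  then show ?thesis unfolding Symp0_def by force
qed

text \<open>A structure in some orbit is compatible by the definition of the equivalence;
  conversely, by reflexivity a compatible structure lies in its own orbit, so every pair occurs in
  some fibre.\<close>

lemma cotangent_bundle_altdef:
  "cotangent_bundle A n =
    {cotangent_equivalence A n `` {(\<mu>, t)} | \<mu> t. compatible A n \<mu> \<and> t \<in> cotangent_space A n \<mu>}"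
proof -
  have refl: "(\<mu>, \<mu>) \<in> structure_equivalence A n" if "compatible A n \<mu>" for \<mu>
    unfolding structure_equivalence_def using that id_in_Symp0
    by (auto simp: carries_def o_def intro!: bexI[of _ "\<lambda>\<xi>. \<xi>"])
  show ?thesis
  proof (intro equalityI subsetI)
    fix x assume "x \<in> cotangent_bundle A n"
    then obtain \<tau> where \<tau>: "\<tau> \<in> {\<mu>. compatible A n \<mu>} // structure_equivalence A n"
      and x: "x \<in> {(\<mu>, t). \<mu> \<in> \<tau> \<and> t \<in> cotangent_space A n \<mu>} // cotangent_equivalence A n"
      unfolding cotangent_bundle_def cotangent_fibre_def moduli_space_def by blast
    obtain \<mu> t where "\<mu> \<in> \<tau>" "t \<in> cotangent_space A n \<mu>" "x = cotangent_equivalence A n `` {(\<mu>, t)}"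
      using x by (auto elim!: quotientE)
    moreover have "compatible A n \<mu>"
      using \<tau> \<open>\<mu> \<in> \<tau>\<close> by (auto elim!: quotientE simp: structure_equivalence_def)
    ultimately show "x \<in> {cotangent_equivalence A n `` {(\<mu>, t)} | \<mu> t. compatible A n \<mu> \<and> t \<in> cotangent_space A n \<mu>}"
      by blast
  next
    fix x assume "x \<in> {cotangent_equivalence A n `` {(\<mu>, t)} | \<mu> t. compatible A n \<mu> \<and> t \<in> cotangent_space A n \<mu>}"
    then obtain \<mu> t where \<mu>: "compatible A n \<mu>" and t: "t \<in> cotangent_space A n \<mu>"
      and x: "x = cotangent_equivalence A n `` {(\<mu>, t)}" by blast
    let ?\<tau> = "structure_equivalence A n `` {\<mu>}"
    have "?\<tau> \<in> moduli_space A n" unfolding moduli_space_def by (rule quotientI) (simp add: \<mu>)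
    moreover have "x \<in> cotangent_fibre A n ?\<tau>"
      unfolding x cotangent_fibre_def by (rule quotientI) (simp add: refl[OF \<mu>] t)
    ultimately show "x \<in> cotangent_bundle A n" unfolding cotangent_bundle_def by (rule UN_I)
  qed
qed

end

theorem theorem7p1:
  fixes X :: "'a topology" and A :: "'a chart set" and g n :: nat
  assumes "closed_riemann_surface X A g" and "g \<ge> 2" and "n \<ge> 2"
  shows "cotangent_bundle A n =
    {cotangent_equivalence A n `` {(\<mu>, t)} | \<mu> t.
       \<mu> \<in> (\<Pi>\<^sub>E k\<in>{2..n}. differentials A (1 - int k) 1) \<and>
       (\<forall>c\<in>A. \<forall>z\<in>chart_image c. (cmod (\<mu> 2 c z))\<^sup>2 < 1) \<and>
       t \<in> (\<Pi>\<^sub>E k\<in>{2..n}. differentials A (int k) 0) \<and>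
       (\<forall>k\<in>{2..n}. \<forall>c\<in>A. \<forall>z\<in>chart_image c.
          (- delbar (t k c) z + \<mu> 2 c z * del (t k c) z + of_nat k * del (\<mu> 2 c) z * t k c z)
          + (\<Sum>l=1..n - k. of_nat (l + k) * del (\<mu> (l + 2) c) z * t (k + l) c z
                          + of_nat (l + 1) * \<mu> (l + 2) c z * del (t (k + l) c) z) = 0)}"
proof -
  interpret riemann_surface X A
    using assms(1) by unfold_locales (simp_all add: closed_riemann_surface_def)
  have "t \<in> cotangent_space A n \<mu> \<longleftrightarrow> t \<in> (\<Pi>\<^sub>E k\<in>{2..n}. differentials A (int k) 0) \<and>
       (\<forall>k\<in>{2..n}. \<forall>c\<in>A. \<forall>z\<in>chart_image c. conservation n (\<lambda>k. \<mu> k c) (\<lambda>k. t k c) k z = 0)"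
    if \<mu>: "\<mu> \<in> (\<Pi>\<^sub>E k\<in>{2..n}. differentials A (1 - int k) 1)" for \<mu> t
  proof
    assume t: "t \<in> cotangent_space A n \<mu>"
    then have "t \<in> (\<Pi>\<^sub>E k\<in>{2..n}. differentials A (int k) 0)" by (simp add: cotangent_space_def)
    then show "t \<in> (\<Pi>\<^sub>E k\<in>{2..n}. differentials A (int k) 0) \<and>
       (\<forall>k\<in>{2..n}. \<forall>c\<in>A. \<forall>z\<in>chart_image c. conservation n (\<lambda>k. \<mu> k c) (\<lambda>k. t k c) k z = 0)"
      using cotangent_imp_conservation[OF \<mu> t] by blast
  next
    assume "t \<in> (\<Pi>\<^sub>E k\<in>{2..n}. differentials A (int k) 0) \<and>
       (\<forall>k\<in>{2..n}. \<forall>c\<in>A. \<forall>z\<in>chart_image c. conservation n (\<lambda>k. \<mu> k c) (\<lambda>k. t k c) k z = 0)"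
    then show "t \<in> cotangent_space A n \<mu>"
      using conservation_imp_cotangent[OF \<mu>, of t] by blast
  qed
  then have "compatible A n \<mu> \<and> t \<in> cotangent_space A n \<mu> \<longleftrightarrow>
       \<mu> \<in> (\<Pi>\<^sub>E k\<in>{2..n}. differentials A (1 - int k) 1) \<and>
       (\<forall>c\<in>A. \<forall>z\<in>chart_image c. (cmod (\<mu> 2 c z))\<^sup>2 < 1) \<and>
       t \<in> (\<Pi>\<^sub>E k\<in>{2..n}. differentials A (int k) 0) \<and>
       (\<forall>k\<in>{2..n}. \<forall>c\<in>A. \<forall>z\<in>chart_image c. conservation n (\<lambda>k. \<mu> k c) (\<lambda>k. t k c) k z = 0)" for \<mu> t
    unfolding compatible_iff[OF assms(3)] by blast
  \<comment> \<open>Both sides collect the classes of pairs under the same relation, so equality of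
    the sets of representatives suffices.\<close>
  then show ?thesis
    unfolding cotangent_bundle_altdef conservation_def by simp
qed

end
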